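(* Let $p\ge1$ and let $U:\mathcal{P}_2(\mathbb{R}^d)\to\mathbb{R}$ be such that $\partial^p_\mu U$ exists and $\partial^p_\mu U\in L^\infty$ (i.e. it is bounded on $\mathcal{P}_2(\mathbb{R}^d)\times(\mathbb{R}^d)^p$). Then there is a constant $C_p>0$ such that $$\Big|\frac{\delta^pU}{\delta m^p}(m,y_1,\dots,y_p)\Big|\le C_p\big(|y_1|^p+\dots+|y_p|^p\big)$$ for all $m\in\mathcal{P}_2(\mathbb{R}^d)$ and $y_1,\dots,y_p\in\mathbb{R}^d$.
   Context: $\mathcal{P}_2(\mathbb{R}^d)$ is the space of square-integrable probability measures on $\mathbb{R}^d$ with the $2$-Wasserstein distance. **Linear functional derivatives.** A continuous $\frac{\delta U}{\delta m}:\mathcal{P}_2(\mathbb{R}^d)\times\mathbb{R}^d\to\mathbb{R}$ is the linear functional derivative of $U:\mathcal{P}_2(\mathbb{R}^d)\to\mathbb{R}$ if for any bounded $\mathcal{K}\subset\mathcal{P}_2(\mathbb{R}^d)$ it has at most quadratic growth in $y$ uniformly in $m\in\mathcal{K}$, and for all $m,m'$, $U(m')-U(m)=\int_0^1\int_{\mathbb{R}^d}\frac{\delta U}{\delta m}((1-s)m+sm',y)\,(m'-m)(dy)\,ds$. Inductively, the $p$-th order linear functional derivative is a continuous function $\frac{\delta^pU}{\delta m^p}:\mathcal{P}_2(\mathbb{R}^d)\times(\mathbb{R}^d)^{p-1}\times\mathbb{R}^d\to\mathbb{R}$, with at most quadratic growth in $(y,y')$ uniformly for $m$ in bounded sets,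 such that $$\frac{\delta^{p-1}U}{\delta m^{p-1}}(m',y)-\frac{\delta^{p-1}U}{\delta m^{p-1}}(m,y)=\int_0^1\int_{\mathbb{R}^d}\frac{\delta^pU}{\delta m^p}((1-s)m+sm',y,y')\,(m'-m)(dy')\,ds.$$ These derivatives are defined up to an additive constant and are normalised to vanish when the last spatial argument is $0$: $\frac{\delta^pU}{\delta m^p}(m,y,0)=0$ for all $y\in(\mathbb{R}^d)^{p-1}$. **L-derivatives.** $\partial_\mu U(m,y):=\partial_y\frac{\delta U}{\delta m}(m,y)$, and higher orders are obtained by iterating componentwise: $\partial^k_\mu U(m,y_1,\dots,y_k)$ is the L-derivative at $y_k$ of $m\mapsto\partial^{k-1}_\mu U(m,y_1,\dots,y_{k-1})$. One has the correspondence $$\partial^n_\mu U=\partial_{y_n}\frac{\delta}{\delta m}\cdots\partial_{y_1}\frac{\delta}{\delta m}U=\partial_{y_n}\cdots\partial_{y_1}\frac{\delta^n}{\delta m^n}U,$$ provided one of the two derivatives is well defined.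
   Formalization: For orders p ≥ 2, "at most quadratic growth in (y,y')" is taken as quadratic growth in each spatial argument (product of 1+|y_i|²); with joint growth the derivative need not exist, e.g. U(m)=(∫y dm)³, where it is 6y₁y₂y₃. Existence is proved too. *)

theory Defs
  imports "HOL-Probability.Probability"
begin

text \<open>
  The space \<open>R^d\<close> is an arbitrary type of class \<^class>\<open>euclidean_space\<close>.  A point
  \<open>(y\<^sub>1, \<dots>, y\<^sub>k)\<close> of \<open>(R^d)^k\<close> is a list of length \<open>k\<close>; a function on
  \<open>P\<^sub>2(R^d) \<times> (R^d)^k\<close> is a total HOL function whose values outside that set are irrelevant.
\<close>

section \<open>Wasserstein space\<close>

definition P2 :: "'a::euclidean_space measure set" where
  "P2 = {m. prob_space m \<and> sets m = sets borel \<and> integrable m (\<lambda>x. (norm x)\<^sup>2)}"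

definition couplings ::
  "'a::euclidean_space measure \<Rightarrow> 'a measure \<Rightarrow> ('a \<times> 'a) measure set" where
  "couplings m m' =
     {\<pi>. prob_space \<pi> \<and> sets \<pi> = sets (borel \<Otimes>\<^sub>M borel) \<and>
         distr \<pi> borel fst = m \<and> distr \<pi> borel snd = m'}"

definition W2 :: "'a::euclidean_space measure \<Rightarrow> 'a measure \<Rightarrow> real" where
  "W2 m m' =
     sqrt (enn2real (INF \<pi>\<in>couplings m m'. \<integral>\<^sup>+ z. ennreal ((dist (fst z) (snd z))\<^sup>2) \<partial>\<pi>))"

definition bounded_P2 :: "'a::euclidean_space measure set \<Rightarrow> bool" where
  "bounded_P2 K \<longleftrightarrow> K \<subseteq> P2 \<and> (\<exists>m\<^sub>0\<in>P2. \<exists>R. \<forall>m\<in>K. W2 m\<^sub>0 m \<le> R)"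

text \<open>The measure \<open>(1 - s) m + s m'\<close>, for \<open>0 \<le> s \<le> 1\<close>.\<close>

definition mixture ::
  "real \<Rightarrow> 'a::euclidean_space measure \<Rightarrow> 'a measure \<Rightarrow> 'a measure" where
  "mixture s m m' =
     measure_of UNIV (sets borel) (\<lambda>A. ennreal (1 - s) * emeasure m A + ennreal s * emeasure m' A)"

definition continuous_P2 ::
  "nat \<Rightarrow> ('a::euclidean_space measure \<Rightarrow> 'a list \<Rightarrow> real) \<Rightarrow> bool" where
  "continuous_P2 k F \<longleftrightarrow>
     (\<forall>m\<in>P2. \<forall>ys. length ys = k \<longrightarrow>
        (\<forall>\<epsilon>>0. \<exists>\<delta>>0. \<forall>m'\<in>P2. \<forall>ys'. length ys' = k \<longrightarrow>
           W2 m m' < \<delta> \<longrightarrow> (\<forall>i<k. dist (ys ! i) (ys' ! i) < \<delta>) \<longrightarrow>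
           \<bar>F m' ys' - F m ys\<bar> < \<epsilon>))"

section \<open>Linear functional derivatives\<close>

text \<open>
  At most quadratic growth in each of the \<open>k\<close> spatial arguments, uniformly for \<open>m\<close> in bounded sets.
  For \<open>k = 1\<close> this is the bound \<open>C (1 + |y|\<^sup>2)\<close>.  For \<open>k \<ge> 2\<close> it is implied by the joint bound
  \<open>C (1 + |y\<^sub>1|\<^sup>2 + \<dots> + |y\<^sub>k|\<^sup>2)\<close>, but it also admits derivatives such as
  \<open>6 y\<^sub>1 y\<^sub>2 y\<^sub>3\<close>, the third derivative of \<open>m \<mapsto> (\<integral>y dm)^3\<close> in dimension one, which the
  joint bound would exclude although the third L-derivative of that functional is constant.
\<close>

definition quadratic_growth_P2 ::
  "nat \<Rightarrow> ('a::euclidean_space measure \<Rightarrow> 'a list \<Rightarrow> real) \<Rightarrow> bool" where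
  "quadratic_growth_P2 k F \<longleftrightarrow>
     (\<forall>K. bounded_P2 K \<longrightarrow>
        (\<exists>C. \<forall>m\<in>K. \<forall>ys. length ys = k \<longrightarrow>
           \<bar>F m ys\<bar> \<le> C * prod_list (map (\<lambda>y. 1 + (norm y)\<^sup>2) ys)))"

text \<open>
  \<open>F\<close>, a function of \<open>k + 1\<close> points, is the normalised linear functional derivative of \<open>G\<close>, a
  function of \<open>k\<close> points: the new point is the last one, the first \<open>k\<close> are parameters in the
  identity but arguments for continuity and growth.
\<close>

definition lin_fun_deriv_step ::
  "nat \<Rightarrow> ('a::euclidean_space measure \<Rightarrow> 'a list \<Rightarrow> real) \<Rightarrow>
   ('a measure \<Rightarrow> 'a list \<Rightarrow> real) \<Rightarrow> bool" where
  "lin_fun_deriv_step k G F \<longleftrightarrow>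
     continuous_P2 (Suc k) F \<and>
     quadratic_growth_P2 (Suc k) F \<and>
     (\<forall>m\<in>P2. \<forall>m'\<in>P2. \<forall>ys. length ys = k \<longrightarrow>
        G m' ys - G m ys =
          (LINT s:{0..1}|lborel.
             (LINT y|m'. F (mixture s m m') (ys @ [y])) -
             (LINT y|m. F (mixture s m m') (ys @ [y])))) \<and>
     (\<forall>m\<in>P2. \<forall>ys. length ys = k \<longrightarrow> F m (ys @ [0]) = 0)"

text \<open>\<open>F\<close> is the normalised linear functional derivative of \<open>U\<close> of the given order.\<close>

fun lin_fun_deriv ::
  "nat \<Rightarrow> ('a::euclidean_space measure \<Rightarrow> real) \<Rightarrow>
   ('a measure \<Rightarrow> 'a list \<Rightarrow> real) \<Rightarrow> bool" where
  "lin_fun_deriv 0 U F \<longleftrightarrow> (\<forall>m\<in>P2. F m [] = U m)"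
| "lin_fun_deriv (Suc p) U F \<longleftrightarrow> (\<exists>G. lin_fun_deriv p U G \<and> lin_fun_deriv_step p G F)"

section \<open>L-derivatives\<close>

definition has_L_deriv ::
  "('a::euclidean_space measure \<Rightarrow> real) \<Rightarrow> ('a measure \<Rightarrow> 'a \<Rightarrow> 'a) \<Rightarrow> bool" where
  "has_L_deriv V E \<longleftrightarrow>
     (\<exists>F. lin_fun_deriv 1 V F \<and> (\<forall>m\<in>P2. \<forall>y. GDERIV (\<lambda>x. F m [x]) y :> E m y))"

text \<open>
  The iterated L-derivative of order \<open>p\<close> takes values in the \<open>p\<close>-fold tensors over \<open>R^d\<close>.  It is given
  by its components: \<open>D bs m ys\<close>, for a list \<open>bs\<close> of \<open>p\<close> vectors of \<^const>\<open>Basis\<close>, is the component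
  whose \<open>i\<close>-th index is the coordinate \<open>bs ! i\<close>, the one belonging to the differentiation in \<open>ys ! i\<close>.
\<close>

definition tensor_index :: "nat \<Rightarrow> 'a::euclidean_space list set" where
  "tensor_index p = {bs. length bs = p \<and> set bs \<subseteq> Basis}"

fun iterated_L_deriv ::
  "nat \<Rightarrow> ('a::euclidean_space measure \<Rightarrow> real) \<Rightarrow>
   ('a list \<Rightarrow> 'a measure \<Rightarrow> 'a list \<Rightarrow> real) \<Rightarrow> bool" where
  "iterated_L_deriv 0 U D \<longleftrightarrow> (\<forall>m\<in>P2. D [] m [] = U m)"
| "iterated_L_deriv (Suc p) U D \<longleftrightarrow>
     (\<exists>G. iterated_L_deriv p U G \<and>
        (\<forall>bs\<in>tensor_index p. \<forall>ys. length ys = p \<longrightarrow>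
           (\<exists>E. has_L_deriv (\<lambda>m. G bs m ys) E \<and>
              (\<forall>b\<in>Basis. \<forall>m\<in>P2. \<forall>y. D (bs @ [b]) m (ys @ [y]) = E m y \<bullet> b))))"

end

theory Submission
  imports Defs
begin

text \<open>
  Write \<open>V\<^sub>b\<^sub>,\<^sub>y\<close> for the functional \<open>m \<mapsto> \<partial>\<^sub>\<mu>U(m, y) \<bullet> b\<close>.  Induction on the order gives
  linear functional derivatives of every \<open>V\<^sub>b\<^sub>,\<^sub>y\<close>, the one of top order being bounded by
  \<open>|y\<^sub>2| \<cdots> |y\<^sub>p|\<close> uniformly in \<open>y\<close>; they have to be integrated in \<open>y\<close>, starting from the fact that
  \<open>\<delta>U/\<delta>m\<close> has the gradient \<open>V\<^sub>b\<^sub>,\<^sub>y\<close>.  Those of intermediate order need not be locally bounded, or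
  even integrable, in \<open>y\<close>.  Therefore the derivative in \<open>m\<close> at each intermediate order is computed by a numerical
  differentiation rule along segments of measures whose error only involves the top order derivative:
  the error is uniform in \<open>y\<close>, and one may pass to the limit in the differences of the antiderivative itself,
  together with their gradients.  At the top order the gradients still converge
  pointwise and boundedly, and dominated convergence along the segment from \<open>0\<close> to \<open>y\<close> suffices.
  This produces \<open>\<delta>\<^sup>pU/\<delta>m\<^sup>p\<close> with the bound \<open>C |y\<^sub>1| \<cdots> |y\<^sub>p|\<close>, and normalised derivatives are unique.
\<close>

section \<open>Mixtures\<close>

text \<open>Along a segment of measures, the Taylor coefficients of \<open>\<Phi> b y 0\<close>
  depend on \<open>y\<close> without any control; only the remainder of order n is uniform in
  \<open>y\<close>. The differentiation rule must therefore cancel the orders 0, 2, ..., n - 1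
  exactly, which leaves an error of order e^(n-1). For n \<ge> 2 it tends to 0, so gradients
  converge uniformly; for n = 1 it is merely bounded, and the top order needs its own argument. The
  nodes are one-sided because a segment of measures cannot in general be prolonged beyond its end
  points. Expansions are made for finitely supported measures, whose pairings are finite sums, so
  that measurability of the coefficients is never at issue; density does the rest. Each order costs
  one factor d, because a gradient is estimated by components, whence the constant d^p times the
  bound of \<open>D\<close>. A product of p norms is finally at most the p-th power of the
  largest.\<close>

lemma P2D:
  assumes "m \<in> P2"
  shows "prob_space m" "sets m = sets borel" "space m = UNIV" "integrable m (\<lambda>x. (norm x)\<^sup>2)"
  using assms sets_eq_imp_space_eq[of m borel] by (auto simp: P2_def)

lemma sets_mixture [simp]: "sets (mixture s m m') = sets (borel :: 'a::euclidean_space measure)"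
  by (simp add: mixture_def sets.sigma_sets_eq[of borel, simplified])

lemma space_mixture [simp]: "space (mixture s m m') = (UNIV :: 'a::euclidean_space set)"
  by (simp add: mixture_def)

text \<open>\<open>measure_of\<close> yields the null measure when its set function is not a
  measure, so countable additivity is checked here, once and for all. \<open>ennreal\<close>
  truncates negative weights to 0, which makes the formula hold for every real
  \<open>s\<close>.\<close>

lemma emeasure_mixture:
  fixes m :: "'a::euclidean_space measure"
  assumes "sets m = sets borel" "sets m' = sets borel" "A \<in> sets borel"
  shows "emeasure (mixture s m m') A = ennreal (1 - s) * emeasure m A + ennreal s * emeasure m' A"
  unfolding mixture_def
proof (rule emeasure_measure_of_sigma)
  show "sigma_algebra UNIV (sets (borel :: 'a measure))"
    using sets.sigma_algebra_axioms[of "borel :: 'a measure"] by simp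
  show "positive (sets borel) (\<lambda>A. ennreal (1 - s) * emeasure m A + ennreal s * emeasure m' A)"
    by (simp add: positive_def)
  show "countably_additive (sets borel)
      (\<lambda>A. ennreal (1 - s) * emeasure m A + ennreal s * emeasure m' A)"
    using assms(1,2)
    by (auto simp: countably_additive_def suminf_add[symmetric] suminf_emeasure)
qed (use assms in auto)

lemma mixture_eqI:
  fixes m :: "'a::euclidean_space measure"
  assumes "sets m = sets borel" "sets m' = sets borel" "sets n = sets borel"
    and "\<And>A. A \<in> sets borel \<Longrightarrow>
      ennreal (1 - s) * emeasure m A + ennreal s * emeasure m' A = emeasure n A"
  shows "mixture s m m' = n"
  using assms by (intro measure_eqI) (auto simp: emeasure_mixture)

lemma mixture_0 [simp]: "sets m = sets borel \<Longrightarrow> sets m' = sets borel \<Longrightarrow> mixture 0 m m' = m"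
  by (rule mixture_eqI) auto

lemma mixture_1 [simp]: "sets m = sets borel \<Longrightarrow> sets m' = sets borel \<Longrightarrow> mixture 1 m m' = m'"
  by (rule mixture_eqI) auto

lemma mixture_same [simp]:
  "sets m = sets borel \<Longrightarrow> 0 \<le> s \<Longrightarrow> s \<le> 1 \<Longrightarrow> mixture s m m = m"
  by (rule mixture_eqI) (auto simp: distrib_right[symmetric] ennreal_plus[symmetric] simp del: ennreal_plus)

text \<open>A subsegment of a segment is again a segment, affinely reparametrised. This turns the
  identity between two end points into information at interior points.\<close>

lemma mixture_mixture:
  fixes m :: "'a::euclidean_space measure"
  assumes [simp]: "sets m = sets borel" "sets m' = sets borel"
    and "0 \<le> s" "s \<le> 1" "0 \<le> a" "a \<le> 1" "0 \<le> b" "b \<le> 1"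
  shows "mixture s (mixture a m m') (mixture b m m') = mixture ((1 - s) * a + s * b) m m'"
proof (rule mixture_eqI)
  fix A :: "'a set" assume A: "A \<in> sets borel"
  have 1: "1 - ((1 - s) * a + s * b) = (1 - s) * (1 - a) + s * (1 - b)" by (simp add: algebra_simps)
  have 2: "ennreal ((1 - s) * (1 - a) + s * (1 - b))
      = ennreal (1 - s) * ennreal (1 - a) + ennreal s * ennreal (1 - b)"
    "ennreal ((1 - s) * a + s * b) = ennreal (1 - s) * ennreal a + ennreal s * ennreal b"
    using assms(3-) by (simp_all add: ennreal_mult)
  show "ennreal (1 - s) * emeasure (mixture a m m') A + ennreal s * emeasure (mixture b m m') A
      = emeasure (mixture ((1 - s) * a + s * b) m m') A"
    unfolding emeasure_mixture[OF assms(1,2) A] 1 2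
    by (simp only: distrib_left distrib_right ac_simps)
qed auto

lemma distr_mixture:
  fixes m :: "'a::euclidean_space measure" and f :: "'a \<Rightarrow> 'b::euclidean_space"
  assumes [simp]: "sets m = sets borel" "sets m' = sets borel" and f: "f \<in> borel_measurable borel"
  shows "distr (mixture s m m') borel f = mixture s (distr m borel f) (distr m' borel f)"
proof (rule mixture_eqI[symmetric])
  fix A :: "'b set" assume A: "A \<in> sets borel"
  have [simp]: "space m = UNIV" "space m' = UNIV"
    using sets_eq_imp_space_eq[OF assms(1)] sets_eq_imp_space_eq[OF assms(2)] by auto
  have [measurable]: "f \<in> borel_measurable m" "f \<in> borel_measurable m'" "f \<in> borel_measurable (mixture s m m')"
    using f by (simp_all cong: measurable_cong_sets)
  have "f -` A \<in> sets borel" using measurable_sets[OF f A] by simp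
  then show "ennreal (1 - s) * emeasure (distr m borel f) A + ennreal s * emeasure (distr m' borel f) A
      = emeasure (distr (mixture s m m') borel f) A"
    using A by (simp add: emeasure_distr emeasure_mixture)
qed auto

lemma nn_integral_mixture:
  fixes m :: "'a::euclidean_space measure" and f :: "'a \<Rightarrow> ennreal"
  assumes [simp]: "sets m = sets borel" "sets m' = sets borel" and f: "f \<in> borel_measurable borel"
  shows "nn_integral (mixture s m m') f
    = ennreal (1 - s) * nn_integral m f + ennreal s * nn_integral m' f"
  using f
proof (induction rule: borel_measurable_induct)
  case (cong f g)
  then have "f = g" by auto
  then show ?case using cong by simp
next
  case (set A)
  then show ?case by (simp add: emeasure_mixture)
next
  case (mult u c)
  then show ?case
    by (simp add: nn_integral_cmult measurable_cong_sets[OF assms(1) refl]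
      measurable_cong_sets[OF assms(2) refl] measurable_cong_sets[OF sets_mixture refl] algebra_simps)
next
  case (add u v)
  then show ?case
    by (simp add: nn_integral_add measurable_cong_sets[OF assms(1) refl]
      measurable_cong_sets[OF assms(2) refl] measurable_cong_sets[OF sets_mixture refl] algebra_simps)
next
  case (seq U)
  have mono: "incseq (\<lambda>i. nn_integral M (U i))" for M :: "'a measure"
    using seq(4) by (intro monoI nn_integral_mono) (simp add: le_funD[OF incseqD[OF seq(3)]])
  have SUP: "nn_integral M (SUP i. U i) = (SUP i. nn_integral M (U i))" if "sets M = sets borel" for M
    using seq by (simp add: SUP_apply[abs_def] measurable_cong_sets[OF that refl]
      nn_integral_monotone_convergence_SUP)
  have m2: "incseq (\<lambda>i. c * nn_integral M (U i))" for M :: "'a measure" and c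
    using mono[of M] by (auto simp: incseq_def intro: mult_left_mono)
  show ?case
    unfolding SUP[OF assms(1)] SUP[OF assms(2)] SUP[OF sets_mixture] SUP_mult_left_ennreal
    by (subst ennreal_SUP_add[OF m2 m2, symmetric]) (simp add: seq.IH)
qed

lemma integral_mixture:
  fixes m :: "'a::euclidean_space measure" and f :: "'a \<Rightarrow> real"
  assumes [simp]: "sets m = sets borel" "sets m' = sets borel" and f: "f \<in> borel_measurable borel"
    and i: "integrable m f" "integrable m' f" and s: "0 \<le> s" "s \<le> 1"
  shows "integrable (mixture s m m') f"
    "integral\<^sup>L (mixture s m m') f = (1 - s) * integral\<^sup>L m f + s * integral\<^sup>L m' f"
proof -
  have f1: "(\<lambda>x. ennreal (f x)) \<in> borel_measurable borel" "(\<lambda>x. ennreal (- f x)) \<in> borel_measurable borel"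
    "(\<lambda>x. ennreal (norm (f x))) \<in> borel_measurable borel"
    using f by measurable
  note nn = nn_integral_mixture[OF assms(1,2) f1(1)] nn_integral_mixture[OF assms(1,2) f1(2)]
    nn_integral_mixture[OF assms(1,2) f1(3)]
  have fin: "nn_integral m (\<lambda>x. ennreal (norm (f x))) < top" "nn_integral m' (\<lambda>x. ennreal (norm (f x))) < top"
    using i by (auto simp: integrable_iff_bounded)
  have le: "nn_integral M (\<lambda>x. ennreal (f x)) \<le> nn_integral M (\<lambda>x. ennreal (norm (f x)))"
    "nn_integral M (\<lambda>x. ennreal (- f x)) \<le> nn_integral M (\<lambda>x. ennreal (norm (f x)))" for M
    by (auto intro!: nn_integral_mono ennreal_leI)
  show int: "integrable (mixture s m m') f"
    using fin nn(3) f
    by (auto simp: integrable_iff_bounded measurable_cong_sets[OF sets_mixture refl]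
      ennreal_mult_less_top)
  have e: "enn2real (ennreal (1 - s) * a + ennreal s * b) = (1 - s) * enn2real a + s * enn2real b"
    if "a < top" "b < top" for a b
    using that s by (subst enn2real_plus) (auto simp: ennreal_mult_less_top enn2real_mult)
  show "integral\<^sup>L (mixture s m m') f = (1 - s) * integral\<^sup>L m f + s * integral\<^sup>L m' f"
    using int i s
    by (simp add: real_lebesgue_integral_def nn e le_less_trans[OF le(1) fin(1)] le_less_trans[OF le(2) fin(1)]
      le_less_trans[OF le(1) fin(2)] le_less_trans[OF le(2) fin(2)] e)
      (simp add: algebra_simps)
qed

lemma prob_space_mixture:
  fixes m :: "'a::euclidean_space measure"
  assumes "prob_space m" "prob_space m'" "sets m = sets borel" "sets m' = sets borel" "0 \<le> s" "s \<le> 1"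
  shows "prob_space (mixture s m m')"
proof
  have "emeasure m UNIV = 1" "emeasure m' UNIV = 1"
    using assms prob_space.emeasure_space_1[of m] prob_space.emeasure_space_1[of m']
      sets_eq_imp_space_eq[OF assms(3)] sets_eq_imp_space_eq[OF assms(4)] by auto
  then show "emeasure (mixture s m m') (space (mixture s m m')) = 1"
    using assms by (simp add: emeasure_mixture ennreal_plus[symmetric] del: ennreal_plus)
qed

text \<open>The square of the distance to the Dirac mass at 0. Being affine in the measure, unlike
  \<open>W2\<close>, it controls mixtures directly.\<close>

definition second_moment :: "'a::euclidean_space measure \<Rightarrow> real" where
  "second_moment m = (LINT x|m. (norm x)\<^sup>2)"

lemma second_moment_nonneg: "0 \<le> second_moment m"
  by (simp add: second_moment_def)

lemma mixture_in_P2 [intro]: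
  assumes "m \<in> P2" "m' \<in> P2" "0 \<le> s" "s \<le> 1"
  shows "mixture s m m' \<in> P2"
  using assms prob_space_mixture[of m m' s] integral_mixture(1)[of m m' "\<lambda>x. (norm x)\<^sup>2" s]
  by (auto simp: P2_def)

lemma second_moment_mixture:
  assumes "m \<in> P2" "m' \<in> P2" "0 \<le> s" "s \<le> 1"
  shows "second_moment (mixture s m m') = (1 - s) * second_moment m + s * second_moment m'"
  unfolding second_moment_def
  by (rule integral_mixture) (use assms P2D[OF assms(1)] P2D[OF assms(2)] in auto)

lemma second_moment_mixture_le:
  assumes "m \<in> P2" "m' \<in> P2" "0 \<le> s" "s \<le> 1"
  shows "second_moment (mixture s m m') \<le> second_moment m + second_moment m'"
proof -
  have "(1 - s) * second_moment m \<le> 1 * second_moment m" "s * second_moment m' \<le> 1 * second_moment m'"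
    using assms(3,4) by (intro mult_right_mono second_moment_nonneg; simp)+
  then show ?thesis using second_moment_mixture[OF assms] by simp
qed

lemma return_in_P2 [simp, intro]: "return borel (z::'a::euclidean_space) \<in> P2"
  by (auto simp: P2_def prob_space_return intro!: integrableI_bounded simp: nn_integral_return)

lemma integral_return_borel [simp]:
  "f \<in> borel_measurable borel \<Longrightarrow> integral\<^sup>L (return borel z) f = (f z :: real)"
  by (simp add: integral_return)

lemma second_moment_return [simp]: "second_moment (return borel z) = (norm z)\<^sup>2"
  by (simp add: second_moment_def)

lemma nn_second_moment:
  assumes "m \<in> P2"
  shows "(\<integral>\<^sup>+ x. ennreal ((norm x)\<^sup>2) \<partial>m) = ennreal (second_moment m)"
  unfolding second_moment_def using P2D[OF assms] by (intro nn_integral_eq_integral) auto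

section \<open>Wasserstein distance\<close>

abbreviation "coupling_cost \<pi> \<equiv> (\<integral>\<^sup>+ z. ennreal ((dist (fst z) (snd z))\<^sup>2) \<partial>\<pi>)"

text \<open>The product sigma-algebra is the Borel sigma-algebra of the product
  (\<open>borel_prod\<close>), so couplings are Borel measures on a Euclidean space and the lemmas
  on \<open>mixture\<close> apply to them.\<close>

lemma couplingsD:
  fixes \<pi> :: "('a::euclidean_space \<times> 'a) measure"
  assumes "\<pi> \<in> couplings m m'"
  shows "prob_space \<pi>" "sets \<pi> = sets borel" "space \<pi> = UNIV" 
    "distr \<pi> borel fst = m" "distr \<pi> borel snd = m'"
proof -
  show "sets \<pi> = sets borel"
    using assms unfolding couplings_def borel_prod by simp
  from sets_eq_imp_space_eq[OF this] show "space \<pi> = UNIV" by simp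
qed (use assms in \<open>auto simp: couplings_def\<close>)

lemma couplingsI:
  fixes \<pi> :: "('a::euclidean_space \<times> 'a) measure"
  assumes "prob_space \<pi>" "sets \<pi> = sets borel" "distr \<pi> borel fst = m" "distr \<pi> borel snd = m'"
  shows "\<pi> \<in> couplings m m'"
  using assms unfolding couplings_def borel_prod by simp

lemma measurable_borel_cong: "sets m = sets borel \<Longrightarrow> measurable m N = measurable borel N"
  by (rule measurable_cong_sets) auto

lemma nn_integral_coupling:
  fixes \<pi> :: "('a::euclidean_space \<times> 'a) measure" and f :: "'a \<Rightarrow> ennreal"
  assumes "\<pi> \<in> couplings m m'" and f: "f \<in> borel_measurable borel"
  shows "(\<integral>\<^sup>+ z. f (fst z) \<partial>\<pi>) = nn_integral m f" "(\<integral>\<^sup>+ z. f (snd z) \<partial>\<pi>) = nn_integral m' f"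
proof -
  note c = couplingsD[OF assms(1)]
  have "fst \<in> borel_measurable \<pi>" "snd \<in> borel_measurable \<pi>"
    unfolding measurable_borel_cong[OF c(2)] by (intro borel_measurable_continuous_onI continuous_intros)+
  then show "(\<integral>\<^sup>+ z. f (fst z) \<partial>\<pi>) = nn_integral m f" "(\<integral>\<^sup>+ z. f (snd z) \<partial>\<pi>) = nn_integral m' f"
    using f c(4,5) by (subst nn_integral_distr[symmetric]; force)+
qed

lemma W2_le:
  assumes "\<pi> \<in> couplings m m'" "coupling_cost \<pi> \<le> ennreal c" "0 \<le> c"
  shows "W2 m m' \<le> sqrt c"
proof -
  have "(INF \<pi>\<in>couplings m m'. coupling_cost \<pi>) \<le> ennreal c"
    using assms by (meson INF_lower order_trans)
  then show ?thesis
    unfolding W2_def using enn2real_mono[of _ "ennreal c"] assms(3) by fastforce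
qed

lemma W2_nonneg: "0 \<le> W2 m m'"
  by (simp add: W2_def)

lemma norm_diff_square_le: "(norm (x - y))\<^sup>2 \<le> 2 * (norm x)\<^sup>2 + 2 * (norm (y::'a::real_normed_vector))\<^sup>2"
proof -
  have "(norm (x - y))\<^sup>2 \<le> (norm x + norm y)\<^sup>2"
    by (intro power_mono norm_triangle_ineq4 norm_ge_zero)
  also have "\<dots> \<le> 2 * (norm x)\<^sup>2 + 2 * (norm y)\<^sup>2"
    using zero_le_power2[of "norm x - norm y"] by (simp add: power2_sum power2_diff)
  finally show ?thesis .
qed

lemma coupling_cost_le:
  assumes "\<pi> \<in> couplings m m'" "m \<in> P2" "m' \<in> P2"
  shows "coupling_cost \<pi> \<le> ennreal (2 * second_moment m + 2 * second_moment m')"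
proof -
  note c = couplingsD[OF assms(1)]
  have [measurable]: "(\<lambda>z. ennreal (2 * (norm (fst z))\<^sup>2)) \<in> borel_measurable \<pi>"
    "(\<lambda>z. ennreal (2 * (norm (snd z))\<^sup>2)) \<in> borel_measurable \<pi>"
    unfolding measurable_borel_cong[OF c(2)]
    by (intro measurable_compose[OF _ measurable_ennreal] borel_measurable_continuous_onI continuous_intros)+
  have [measurable]: "fst \<in> borel_measurable \<pi>" "snd \<in> borel_measurable \<pi>"
    unfolding measurable_borel_cong[OF c(2)] by (intro borel_measurable_continuous_onI continuous_intros)+
  have "coupling_cost \<pi> \<le> (\<integral>\<^sup>+ z. ennreal (2 * (norm (fst z))\<^sup>2) + ennreal (2 * (norm (snd z))\<^sup>2) \<partial>\<pi>)"
    by (intro nn_integral_mono) (auto simp: dist_norm norm_diff_square_le simp flip: ennreal_plus)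
  also have "\<dots> = (\<integral>\<^sup>+ z. ennreal (2 * (norm (fst z))\<^sup>2) \<partial>\<pi>) + (\<integral>\<^sup>+ z. ennreal (2 * (norm (snd z))\<^sup>2) \<partial>\<pi>)"
    by (rule nn_integral_add) auto
  also have "\<dots> = 2 * ennreal (second_moment m) + 2 * ennreal (second_moment m')"
    using nn_integral_coupling[OF assms(1), of "\<lambda>x. ennreal ((norm x)\<^sup>2)"] assms
    by (simp add: ennreal_mult nn_integral_cmult nn_second_moment)
  finally show ?thesis by (simp add: ennreal_mult second_moment_nonneg)
qed

text \<open>The independent coupling has finite cost, so the infimum that defines \<open>W2\<close>
  is finite on \<open>P2\<close>.\<close>

lemma pair_coupling:
  fixes m :: "'a::euclidean_space measure"
  assumes "m \<in> P2" "m' \<in> P2"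
  shows "m \<Otimes>\<^sub>M m' \<in> couplings m m'"
proof -
  note m = P2D[OF assms(1)] and m' = P2D[OF assms(2)]
  interpret m: prob_space m by (rule m)
  interpret m': prob_space m' by (rule m')
  interpret pair_prob_space m m' ..
  have s: "sets (m \<Otimes>\<^sub>M m') = sets (borel \<Otimes>\<^sub>M borel)" using m(2) m'(2) by (rule sets_pair_measure_cong)
  have d: "distr (m \<Otimes>\<^sub>M m') borel fst = m"
    using m'.distr_pair_fst[of m] distr_cong[OF refl m(2), of "m \<Otimes>\<^sub>M m'" fst fst] by simp
  have "distr (m \<Otimes>\<^sub>M m') borel snd = m'"
  proof (rule measure_eqI)
    fix A assume "A \<in> sets (distr (m \<Otimes>\<^sub>M m') borel snd)"
    then have A: "A \<in> sets borel" by simp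
    have "emeasure (distr (m \<Otimes>\<^sub>M m') borel snd) A = emeasure (m \<Otimes>\<^sub>M m') (space m \<times> A)"
      using A m m' by (subst emeasure_distr)
        (auto simp: space_pair_measure measurable_cong_sets[OF s refl] intro!: arg_cong[where f="emeasure _"])
    also have "\<dots> = emeasure m' A"
      using A m' m m.emeasure_space_1 by (subst m'.emeasure_pair_measure_Times) auto
    finally show "emeasure (distr (m \<Otimes>\<^sub>M m') borel snd) A = emeasure m' A" .
  qed (use m' in auto)
  with d s show ?thesis using P.prob_space_axioms by (simp add: couplings_def)
qed

lemma W2_le_moments:
  assumes "m \<in> P2" "m' \<in> P2"
  shows "W2 m m' \<le> sqrt (2 * second_moment m + 2 * second_moment m')"
  by (rule W2_le[OF pair_coupling[OF assms] coupling_cost_le[OF pair_coupling[OF assms] assms]])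
    (simp add: second_moment_nonneg)

text \<open>\<open>enn2real\<close> sends an infinite infimum to 0, so finiteness must be known
  before \<open>W2 m m' < r\<close> says anything about costs; the independent coupling supplies it.
  The strict inequality then produces a coupling from the infimum.\<close>

lemma W2_lessD:
  assumes "m \<in> P2" "m' \<in> P2" "W2 m m' < r"
  obtains \<pi> where "\<pi> \<in> couplings m m'" "coupling_cost \<pi> \<le> ennreal (r\<^sup>2)"
proof -
  define I where "I = (INF \<pi>\<in>couplings m m'. coupling_cost \<pi>)"
  have "I \<le> ennreal (2 * second_moment m + 2 * second_moment m')"
    unfolding I_def using pair_coupling[OF assms(1,2)] coupling_cost_le[OF pair_coupling[OF assms(1,2)] assms(1,2)]
    by (meson INF_lower order_trans)
  then have fin: "I < top" by (simp add: le_less_trans)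
  have "sqrt (enn2real I) < r" using assms(3) by (simp add: W2_def I_def)
  then have "enn2real I < r\<^sup>2"
    by (metis enn2real_nonneg real_sqrt_ge_zero real_less_lsqrt real_sqrt_pow2 power_strict_mono zero_less_numeral)
  then have "I < ennreal (r\<^sup>2)"
    using fin by (metis ennreal_enn2real ennreal_lessI enn2real_nonneg le_less_trans)
  then obtain \<pi> where "\<pi> \<in> couplings m m'" "coupling_cost \<pi> < ennreal (r\<^sup>2)"
    unfolding I_def INF_less_iff by auto
  then show thesis using that by (meson less_imp_le)
qed

lemma second_moment_coupling_le:
  assumes "\<pi> \<in> couplings m m'" "m \<in> P2" "m' \<in> P2" "coupling_cost \<pi> \<le> ennreal c" "0 \<le> c"
  shows "second_moment m' \<le> 2 * second_moment m + 2 * c"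
proof -
  note cp = couplingsD[OF assms(1)]
  have [measurable]: "fst \<in> borel_measurable \<pi>" "snd \<in> borel_measurable \<pi>"
    unfolding measurable_borel_cong[OF cp(2)] by (intro borel_measurable_continuous_onI continuous_intros)+
  have "ennreal (second_moment m') = (\<integral>\<^sup>+ z. ennreal ((norm (snd z))\<^sup>2) \<partial>\<pi>)"
    using nn_integral_coupling(2)[OF assms(1), of "\<lambda>x. ennreal ((norm x)\<^sup>2)"]
      nn_second_moment[OF assms(3)] by simp
  also have "\<dots> \<le> (\<integral>\<^sup>+ z. 2 * ennreal ((norm (fst z))\<^sup>2) + 2 * ennreal ((dist (fst z) (snd z))\<^sup>2) \<partial>\<pi>)"
  proof (intro nn_integral_mono)
    fix z :: "'a \<times> 'a"
    have "(norm (snd z))\<^sup>2 \<le> 2 * (norm (fst z))\<^sup>2 + 2 * (dist (fst z) (snd z))\<^sup>2"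
      using norm_diff_square_le[of "fst z" "fst z - snd z"] by (simp add: dist_norm)
    then show "ennreal ((norm (snd z))\<^sup>2) \<le> 2 * ennreal ((norm (fst z))\<^sup>2) + 2 * ennreal ((dist (fst z) (snd z))\<^sup>2)"
      by (subst ennreal_leI[THEN order_trans]) (auto simp: ennreal_mult ennreal_plus)
  qed
  also have "\<dots> = 2 * (\<integral>\<^sup>+ z. ennreal ((norm (fst z))\<^sup>2) \<partial>\<pi>) + 2 * coupling_cost \<pi>"
    by (simp add: nn_integral_add nn_integral_cmult)
  also have "\<dots> \<le> 2 * ennreal (second_moment m) + 2 * ennreal c"
    using nn_integral_coupling(1)[OF assms(1), of "\<lambda>x. ennreal ((norm x)\<^sup>2)"] assms(4)
      nn_second_moment[OF assms(2)]
    by (auto intro!: add_mono mult_left_mono)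
  also have "\<dots> = ennreal (2 * second_moment m + 2 * c)"
    using assms second_moment_nonneg[of m] by (simp add: ennreal_mult)
  finally show ?thesis
    using assms second_moment_nonneg[of m] by (simp add: ennreal_le_iff del: ennreal_plus)
qed

text \<open>A ball around an arbitrary centre becomes a bound on second moments through a
  near-optimal coupling; conversely, the Dirac mass at 0 serves as centre.\<close>

lemma bounded_P2_iff:
  "bounded_P2 K \<longleftrightarrow> K \<subseteq> P2 \<and> (\<exists>R. \<forall>m\<in>K. second_moment m \<le> R)"
proof safe
  assume "bounded_P2 K"
  then obtain m0 R where K: "K \<subseteq> P2" "m0 \<in> P2" "\<And>m. m \<in> K \<Longrightarrow> W2 m0 m \<le> R"
    unfolding bounded_P2_def by auto
  have "second_moment m \<le> 2 * second_moment m0 + 2 * (R + 1)\<^sup>2" if m: "m \<in> K" for m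
  proof -
    have "W2 m0 m < R + 1" using K(3)[OF m] by simp
    from W2_lessD[OF K(2) _ this] m K(1) obtain \<pi> where
      "\<pi> \<in> couplings m0 m" "coupling_cost \<pi> \<le> ennreal ((R+1)\<^sup>2)" by blast
    then show ?thesis
      using second_moment_coupling_le[of _ m0 m "(R + 1)\<^sup>2"] m K(1,2) by auto
  qed
  then show "\<exists>R. \<forall>m\<in>K. second_moment m \<le> R" by blast
next
  fix R assume K: "K \<subseteq> P2" "\<forall>m\<in>K. second_moment m \<le> R"
  have "W2 (return borel 0) m \<le> sqrt (2 * R)" if "m \<in> K" for m
  proof -
    have "W2 (return borel 0) m \<le> sqrt (2 * second_moment m)"
      using W2_le_moments[of "return borel 0" m] K(1) that by auto
    also have "\<dots> \<le> sqrt (2 * R)" using K(2) that by simp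
    finally show ?thesis .
  qed
  then show "bounded_P2 K" using K unfolding bounded_P2_def by blast
qed (auto simp: bounded_P2_def)

section \<open>Sequential convergence in the Wasserstein distance\<close>

definition converges_P2 :: "(nat \<Rightarrow> 'a::euclidean_space measure) \<Rightarrow> 'a measure \<Rightarrow> bool" where
  "converges_P2 M m \<longleftrightarrow> (\<forall>j. M j \<in> P2) \<and> m \<in> P2 \<and> (\<lambda>j. W2 m (M j)) \<longlonglongrightarrow> 0"

lemma converges_P2I:
  assumes "\<And>j. M j \<in> P2" "m \<in> P2" "\<And>j. \<pi> j \<in> couplings m (M j)"
    "\<And>j. coupling_cost (\<pi> j) \<le> ennreal (c j)" "\<And>j. 0 \<le> c j" "c \<longlonglongrightarrow> 0"
  shows "converges_P2 M m"
proof -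
  have "(\<lambda>j. sqrt (c j)) \<longlonglongrightarrow> 0" using tendsto_real_sqrt[OF assms(6)] by simp
  then have "(\<lambda>j. W2 m (M j)) \<longlonglongrightarrow> 0"
    by (rule tendsto_sandwich[OF _ _ tendsto_const, rotated 2])
      (auto simp: W2_nonneg intro!: always_eventually W2_le[OF assms(3,4)] assms(5))
  then show ?thesis using assms by (auto simp: converges_P2_def)
qed

lemma converges_P2_couplings:
  assumes "converges_P2 M m"
  obtains \<pi> c where "\<And>j. \<pi> j \<in> couplings m (M j)" "\<And>j. coupling_cost (\<pi> j) \<le> ennreal (c j)"
    "\<And>j. 0 \<le> c j" "c \<longlonglongrightarrow> 0"
proof -
  \<comment> \<open>The added \<open>inverse (real (Suc j))\<close> provides the strict inequality
    that \<open>W2_lessD\<close> asks for.\<close>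
  define c where "c j = (W2 m (M j) + inverse (real (Suc j)))\<^sup>2" for j
  have "\<exists>\<pi>. \<pi> \<in> couplings m (M j) \<and> coupling_cost \<pi> \<le> ennreal (c j)" for j
    using W2_lessD[of m "M j" "W2 m (M j) + inverse (real (Suc j))"] assms
    by (auto simp: converges_P2_def c_def)
  then obtain \<pi> where "\<And>j. \<pi> j \<in> couplings m (M j)" "\<And>j. coupling_cost (\<pi> j) \<le> ennreal (c j)"
    by metis
  moreover have "c \<longlonglongrightarrow> (0 + 0)\<^sup>2"
    unfolding c_def using assms
    by (intro tendsto_intros LIMSEQ_inverse_real_of_nat) (auto simp: converges_P2_def)
  ultimately show thesis using that[of \<pi> c] by (auto simp: c_def)
qed

lemma converges_P2_bounded:
  assumes "converges_P2 M m"
  obtains R where "\<And>j. second_moment (M j) \<le> R" "second_moment m \<le> R"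
proof -
  from assms have c: "(\<lambda>j. W2 m (M j)) \<longlonglongrightarrow> 0" and P: "\<And>j. M j \<in> P2" "m \<in> P2"
    by (auto simp: converges_P2_def)
  have "Bseq (\<lambda>j. W2 m (M j))" using c convergentI convergent_imp_Bseq by blast
  then obtain K where "\<And>j. W2 m (M j) \<le> K" by (metis Bseq_def abs_le_D1 real_norm_def)
  then have "bounded_P2 (range M)" using P unfolding bounded_P2_def by blast
  then obtain R where "\<And>j. second_moment (M j) \<le> R" unfolding bounded_P2_iff by auto
  then show thesis by (intro that[of "max R (second_moment m)"]) (auto intro: le_max_iff_disj[THEN iffD2])
qed

text \<open>Push-forward commutes with \<open>mixture\<close>, so mixing two couplings mixes both
  marginals.\<close>

lemma couplings_mixture:
  assumes "\<pi> \<in> couplings m n" "\<pi>' \<in> couplings m' n'" "0 \<le> s" "s \<le> 1"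
  shows "mixture s \<pi> \<pi>' \<in> couplings (mixture s m m') (mixture s n n')"
proof -
  note c = couplingsD[OF assms(1)] couplingsD[OF assms(2)]
  have [simp]: "fst \<in> borel_measurable borel" "snd \<in> borel_measurable borel"
    by (intro borel_measurable_continuous_onI continuous_intros)+
  show ?thesis
    using c assms by (intro couplingsI prob_space_mixture) (auto simp: distr_mixture)
qed

lemma coupling_cost_mixture:
  fixes \<pi> :: "('a::euclidean_space \<times> 'a) measure"
  assumes "sets \<pi> = sets borel" "sets \<pi>' = sets borel"
  shows "coupling_cost (mixture s \<pi> \<pi>') = ennreal (1 - s) * coupling_cost \<pi> + ennreal s * coupling_cost \<pi>'"
  using assms
  by (intro nn_integral_mixture measurable_compose[OF _ measurable_ennreal]
      borel_measurable_continuous_onI continuous_intros)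

lemma converges_P2_mixture:
  assumes "converges_P2 M m" "converges_P2 M' m'" "0 \<le> s" "s \<le> 1"
  shows "converges_P2 (\<lambda>j. mixture s (M j) (M' j)) (mixture s m m')"
proof -
  obtain \<pi> c where 1: "\<And>j. \<pi> j \<in> couplings m (M j)" "\<And>j. coupling_cost (\<pi> j) \<le> ennreal (c j)"
    "\<And>j. 0 \<le> c j" "c \<longlonglongrightarrow> 0" by (rule converges_P2_couplings[OF assms(1)]) blast
  obtain \<pi>' c' where 2: "\<And>j. \<pi>' j \<in> couplings m' (M' j)" "\<And>j. coupling_cost (\<pi>' j) \<le> ennreal (c' j)"
    "\<And>j. 0 \<le> c' j" "c' \<longlonglongrightarrow> 0" by (rule converges_P2_couplings[OF assms(2)]) blast
  show ?thesis
  proof (rule converges_P2I)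
    show "mixture s (\<pi> j) (\<pi>' j) \<in> couplings (mixture s m m') (mixture s (M j) (M' j))" for j
      by (intro couplings_mixture 1 2 assms)
    show "coupling_cost (mixture s (\<pi> j) (\<pi>' j)) \<le> ennreal ((1 - s) * c j + s * c' j)" for j
    proof -
      have "coupling_cost (mixture s (\<pi> j) (\<pi>' j))
          = ennreal (1 - s) * coupling_cost (\<pi> j) + ennreal s * coupling_cost (\<pi>' j)"
        by (rule coupling_cost_mixture[OF couplingsD(2)[OF 1(1)] couplingsD(2)[OF 2(1)]])
      also have "\<dots> \<le> ennreal (1 - s) * ennreal (c j) + ennreal s * ennreal (c' j)"
        by (intro add_mono mult_left_mono 1(2) 2(2)) simp_all
      also have "\<dots> = ennreal ((1 - s) * c j + s * c' j)"
        using assms(3,4) 1(3)[of j] 2(3)[of j] by (subst ennreal_plus) (simp_all add: ennreal_mult)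
      finally show ?thesis .
    qed
    show "(\<lambda>j. (1 - s) * c j + s * c' j) \<longlonglongrightarrow> 0"
      using tendsto_add[OF tendsto_mult_left[OF 1(4), of "1 - s"] tendsto_mult_left[OF 2(4), of s]] by simp
    show "0 \<le> (1 - s) * c j + s * c' j" for j
      using 1(3)[of j] 2(3)[of j] assms(3,4) by simp
    show "mixture s (M j) (M' j) \<in> P2" for j
      using assms by (intro mixture_in_P2) (simp_all add: converges_P2_def)
    show "mixture s m m' \<in> P2"
      using assms by (intro mixture_in_P2) (simp_all add: converges_P2_def)
  qed
qed

lemma distr_pair_coupling:
  fixes f :: "'b \<Rightarrow> 'a::euclidean_space"
  assumes "prob_space M" and [measurable]: "f \<in> borel_measurable M" "g \<in> borel_measurable M"
  shows "distr M borel (\<lambda>x. (f x, g x)) \<in> couplings (distr M borel f) (distr M borel g)"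
    "coupling_cost (distr M borel (\<lambda>x. (f x, g x))) = (\<integral>\<^sup>+ x. ennreal ((dist (f x) (g x))\<^sup>2) \<partial>M)"
proof -
  have [measurable]: "fst \<in> borel_measurable (borel :: ('a \<times> 'a) measure)" "snd \<in> borel_measurable (borel :: ('a \<times> 'a) measure)"
    by (intro borel_measurable_continuous_onI continuous_intros)+
  have p: "(\<lambda>x. (f x, g x)) \<in> borel_measurable M" by measurable
  show "distr M borel (\<lambda>x. (f x, g x)) \<in> couplings (distr M borel f) (distr M borel g)"
    using p assms by (intro couplingsI) (auto simp: distr_distr o_def intro: prob_space.prob_space_distr)
  show "coupling_cost (distr M borel (\<lambda>x. (f x, g x))) = (\<integral>\<^sup>+ x. ennreal ((dist (f x) (g x))\<^sup>2) \<partial>M)"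
    using p by (subst nn_integral_distr) (auto intro!: measurable_compose[OF _ measurable_ennreal]
      borel_measurable_continuous_onI continuous_intros)
qed

lemma distr_id_borel: "sets m = sets borel \<Longrightarrow> distr m borel (\<lambda>x. x) = m"
  by (rule distr_id2) simp

lemma converges_P2_return:
  fixes z :: "'a::euclidean_space"
  assumes "Z \<longlonglongrightarrow> z"
  shows "converges_P2 (\<lambda>j. return borel (Z j)) (return borel z)"
proof (rule converges_P2I)
  let ?\<pi> = "\<lambda>j. distr (return borel z) borel (\<lambda>x. (z, Z j))"
  have d: "distr (return borel z) borel (\<lambda>x. w) = return borel w" for w :: 'a
    by (rule measure_eqI) (auto simp: emeasure_distr indicator_def split: if_splits)
  show "?\<pi> j \<in> couplings (return borel z) (return borel (Z j))" for j
    using distr_pair_coupling(1)[of "return borel z" "\<lambda>_. z" "\<lambda>_. Z j"] by (simp add: d prob_space_return)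
  show "coupling_cost (?\<pi> j) \<le> ennreal ((dist z (Z j))\<^sup>2)" for j
    using distr_pair_coupling(2)[of "return borel z" "\<lambda>_. z" "\<lambda>_. Z j"] by (simp add: prob_space_return nn_integral_return)
  show "(\<lambda>j. (dist z (Z j))\<^sup>2) \<longlonglongrightarrow> 0"
    using tendsto_power[OF tendsto_dist[OF tendsto_const[of z] assms], of 2] by simp
qed auto

text \<open>Couple \<open>x\<close> with \<open>f j x\<close>. The bound by 2 |x| dominates the
  squared displacement by 9 |x|^2, which is integrable; the factor 2 is the one delivered by
  approximation with simple functions.\<close>

lemma converges_P2_distr:
  fixes m :: "'a::euclidean_space measure" and f :: "nat \<Rightarrow> 'a \<Rightarrow> 'a"
  assumes m: "m \<in> P2" and [measurable]: "\<And>j. f j \<in> borel_measurable borel"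
    and le: "\<And>j x. norm (f j x) \<le> 2 * norm x" and lim: "\<And>x. (\<lambda>j. f j x) \<longlonglongrightarrow> x"
  shows "converges_P2 (\<lambda>j. distr m borel (f j)) m"
proof (rule converges_P2I)
  note P = P2D[OF m]
  note [measurable_cong] = P(2)
  let ?c = "\<lambda>j. LINT x|m. (dist x (f j x))\<^sup>2"
  show "distr m borel (f j) \<in> P2" for j
  proof -
    have "integrable m (\<lambda>x. (norm (f j x))\<^sup>2)"
    proof (rule Bochner_Integration.integrable_bound)
      show "integrable m (\<lambda>x. 4 * (norm x)\<^sup>2)" using P(4) by simp
      show "AE x in m. norm ((norm (f j x))\<^sup>2) \<le> norm (4 * (norm x)\<^sup>2)"
      proof (rule AE_I2)
        fix x show "norm ((norm (f j x))\<^sup>2) \<le> norm (4 * (norm x)\<^sup>2)"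
          using power_mono[OF le[of j x], of 2] by (simp add: power_mult_distrib)
      qed
    qed measurable
    then show ?thesis using P(1) by (auto simp: P2_def prob_space.prob_space_distr integrable_distr_eq)
  qed
  have bd: "(dist x (f j x))\<^sup>2 \<le> 9 * (norm x)\<^sup>2" for x j
  proof -
    have "dist x (f j x) \<le> norm x + norm (f j x)" by (simp add: dist_norm norm_triangle_ineq4)
    then have "dist x (f j x) \<le> 3 * norm x" using le[of j x] by simp
    from power_mono[OF this, of 2] show ?thesis by (simp add: power_mult_distrib)
  qed
  have int: "integrable m (\<lambda>x. (dist x (f j x))\<^sup>2)" for j
    by (rule Bochner_Integration.integrable_bound[of m "\<lambda>x. 9 * (norm x)\<^sup>2"]) (use P(4) bd in auto)
  show "distr m borel (\<lambda>x. (x, f j x)) \<in> couplings m (distr m borel (f j))" for j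
    using distr_pair_coupling(1)[of m "\<lambda>x. x" "f j"] P by (simp add: distr_id_borel)
  show "coupling_cost (distr m borel (\<lambda>x. (x, f j x))) \<le> ennreal (?c j)" for j
    using distr_pair_coupling(2)[of m "\<lambda>x. x" "f j"] P
    by (simp add: nn_integral_eq_integral[OF int])
  have "?c \<longlonglongrightarrow> (LINT x|m. 0)"
  proof (rule integral_dominated_convergence)
    show "integrable m (\<lambda>x. 9 * (norm x)\<^sup>2)" using P(4) by simp
    show "AE x in m. (\<lambda>j. (dist x (f j x))\<^sup>2) \<longlonglongrightarrow> 0"
    proof (rule AE_I2)
      fix x show "(\<lambda>j. (dist x (f j x))\<^sup>2) \<longlonglongrightarrow> 0"
        using tendsto_power[OF tendsto_dist[OF tendsto_const[of x] lim[of x]], of 2] by simp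
    qed
  qed (use bd in auto)
  then show "?c \<longlonglongrightarrow> 0" by simp
qed (use m in auto)

text \<open>Only the mass \<open>r j\<close> is transported, by the independent coupling, while the
  rest stays on the diagonal; the cost is \<open>r j\<close> times a bound on moments. Hence the
  \<open>m' j\<close> may vary freely as long as their second moments stay bounded.\<close>

lemma converges_P2_mixture_small:
  assumes m: "m \<in> P2" and m': "\<And>j. m' j \<in> P2" "\<And>j. second_moment (m' j) \<le> R"
    and r: "\<And>j. 0 \<le> r j" "\<And>j. r j \<le> 1" "r \<longlonglongrightarrow> 0"
  shows "converges_P2 (\<lambda>j. mixture (r j) m (m' j)) m"
proof (rule converges_P2I)
  note P = P2D[OF m]
  let ?d = "distr m borel (\<lambda>x. (x, x))"
  let ?K = "2 * second_moment m + 2 * R"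
  have K: "0 \<le> ?K"
    using second_moment_nonneg[of m] second_moment_nonneg[of "m' 0"] m'(2)[of 0] by linarith
  have "(\<lambda>x. x) \<in> borel_measurable m" unfolding measurable_borel_cong[OF P(2)] by simp
  then have d: "?d \<in> couplings m m" "coupling_cost ?d = 0"
    using distr_pair_coupling[of m "\<lambda>x. x" "\<lambda>x. x"] P by (simp_all add: distr_id_borel)
  show "mixture (r j) ?d (m \<Otimes>\<^sub>M m' j) \<in> couplings m (mixture (r j) m (m' j))" for j
    using couplings_mixture[OF d(1) pair_coupling[OF m m'(1)], of "r j"] r(1,2)[of j] P by simp
  show "coupling_cost (mixture (r j) ?d (m \<Otimes>\<^sub>M m' j)) \<le> ennreal (r j * ?K)" for j
  proof -
    have "coupling_cost (mixture (r j) ?d (m \<Otimes>\<^sub>M m' j)) = ennreal (r j) * coupling_cost (m \<Otimes>\<^sub>M m' j)"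
      using couplingsD(2)[OF d(1)] couplingsD(2)[OF pair_coupling[OF m m'(1)]]
      by (subst coupling_cost_mixture) (auto simp: d(2))
    also have "\<dots> \<le> ennreal (r j) * ennreal ?K"
      using m'(2)[of j]
      by (intro mult_left_mono order_trans[OF coupling_cost_le[OF pair_coupling[OF m m'(1)] m m'(1)]] ennreal_leI)
        auto
    also have "\<dots> = ennreal (r j * ?K)" by (intro ennreal_mult[symmetric] r K)
    finally show ?thesis .
  qed
  show "(\<lambda>j. r j * ?K) \<longlonglongrightarrow> 0" using tendsto_mult_right[OF r(3), of ?K] by simp
  show "0 \<le> r j * ?K" for j using r(1)[of j] K by simp
  show "mixture (r j) m (m' j) \<in> P2" for j by (intro mixture_in_P2 m m' r)
qed (fact m)

lemma converges_P2_const [simp]: "m \<in> P2 \<Longrightarrow> converges_P2 (\<lambda>_. m) m"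
  using converges_P2_mixture_small[of m "\<lambda>_. m" "second_moment m" "\<lambda>_. 0"] P2D(2)[of m] by simp

text \<open>The path is extended from \<open>mixture s m m'\<close> towards \<open>m'\<close> or towards \<open>m\<close>,
  according to the side on which \<open>S j\<close> lies.\<close>

lemma converges_P2_mixture_path:
  assumes m: "m \<in> P2" "m' \<in> P2" and S: "\<And>j. S j \<in> {0..1}" "s \<in> {0..1}" "S \<longlonglongrightarrow> s"
  shows "converges_P2 (\<lambda>j. mixture (S j) m m') (mixture s m m')"
proof -
  note P = P2D(2)[OF m(1)] P2D(2)[OF m(2)]
  \<comment> \<open>For \<open>s = 1\<close> the first branch reads 0/0, which is 0, as wanted; for
    \<open>s = 0\<close> the second branch is never entered.\<close>
  define r where "r j = (if s \<le> S j then (S j - s) / (1 - s) else (s - S j) / s)" for j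
  define n where "n j = (if s \<le> S j then m' else m)" for j
  have r: "0 \<le> r j" "r j \<le> 1" for j
    using S(1)[of j] S(2) by (auto simp: r_def divide_simps)
  have "r j \<le> \<bar>S j - s\<bar> * (1 / (1 - s) + 1 / s)" for j
  proof -
    have "r j = \<bar>S j - s\<bar> * (if s \<le> S j then 1 / (1 - s) else 1 / s)"
      by (simp add: r_def abs_if)
    also have "\<dots> \<le> \<bar>S j - s\<bar> * (1 / (1 - s) + 1 / s)"
      using S(2) by (intro mult_left_mono) auto
    finally show ?thesis .
  qed
  moreover have "(\<lambda>j. \<bar>S j - s\<bar> * (1 / (1 - s) + 1 / s)) \<longlonglongrightarrow> \<bar>s - s\<bar> * (1 / (1 - s) + 1 / s)"
    by (intro tendsto_intros S)
  ultimately have r0: "r \<longlonglongrightarrow> 0"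
    using r by (intro tendsto_sandwich[OF _ _ tendsto_const, of 0 r]) (auto intro!: always_eventually)
  have eq: "mixture (S j) m m' = mixture (r j) (mixture s m m') (n j)" for j
  proof (cases "s \<le> S j")
    case True
    have "r j * (1 - s) = S j - s"
      using True S(1)[of j] S(2) by (cases "s = 1") (auto simp: r_def)
    then have "(1 - r j) * s + r j * 1 = S j" by (simp add: algebra_simps)
    then show ?thesis
      using mixture_mixture[OF P, of "r j" s 1] r[of j] S(2) True P by (simp add: n_def)
  next
    case False
    have "r j * s = s - S j"
      using False S(1)[of j] S(2) by (cases "s = 0") (auto simp: r_def)
    then have "(1 - r j) * s + r j * 0 = S j" by (simp add: algebra_simps)
    then show ?thesis
      using mixture_mixture[OF P, of "r j" s 0] r[of j] S(2) False P by (simp add: n_def)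
  qed
  have n: "\<And>j. n j \<in> P2" "\<And>j. second_moment (n j) \<le> second_moment m + second_moment m'"
    using m by (auto simp: n_def second_moment_nonneg)
  show ?thesis
    unfolding eq using S(2) by (intro converges_P2_mixture_small[OF _ n r r0] mixture_in_P2 m) auto
qed

section \<open>Continuity and growth on Wasserstein space\<close>

lemma continuous_P2D:
  assumes F: "continuous_P2 k F" and M: "converges_P2 M m"
    and Y: "\<And>j. length (Y j) = k" "length y = k" "\<And>i. i < k \<Longrightarrow> (\<lambda>j. Y j ! i) \<longlonglongrightarrow> y ! i"
  shows "(\<lambda>j. F (M j) (Y j)) \<longlonglongrightarrow> F m y"
proof (rule tendstoI)
  fix e :: real assume "e > 0"
  then obtain d where d: "d > 0" "\<And>m' ys'. m' \<in> P2 \<Longrightarrow> length ys' = k \<Longrightarrow> W2 m m' < d \<Longrightarrow>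
    (\<forall>i<k. dist (y ! i) (ys' ! i) < d) \<Longrightarrow> \<bar>F m' ys' - F m y\<bar> < e"
    using F M Y(2) unfolding continuous_P2_def converges_P2_def by metis
  have "\<forall>\<^sub>F j in sequentially. W2 m (M j) < d"
    using M order_tendstoD(2)[of "\<lambda>j. W2 m (M j)" 0] d(1) by (simp add: converges_P2_def)
  moreover have "\<forall>\<^sub>F j in sequentially. \<forall>i\<in>{..<k}. dist (Y j ! i) (y ! i) < d"
    by (intro eventually_ball_finite ballI tendstoD Y d(1)) auto
  ultimately show "\<forall>\<^sub>F j in sequentially. dist (F (M j) (Y j)) (F m y) < e"
  proof eventually_elim
    case (elim j)
    then show ?case
      using d(2)[of "M j" "Y j"] M Y(1) by (auto simp: converges_P2_def dist_real_def dist_commute)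
  qed
qed

text \<open>If continuity fails, the radii 1/(j+1) in the negated definition yield a violating
  sequence, so sequences suffice as a test.\<close>

lemma continuous_P2I:
  assumes "\<And>M m Y y. converges_P2 M m \<Longrightarrow> (\<And>j. length (Y j) = k) \<Longrightarrow> length y = k \<Longrightarrow>
      (\<And>i. i < k \<Longrightarrow> (\<lambda>j. Y j ! i) \<longlonglongrightarrow> y ! i) \<Longrightarrow> (\<lambda>j. F (M j) (Y j)) \<longlonglongrightarrow> F m y"
  shows "continuous_P2 k F"
  unfolding continuous_P2_def
proof (intro ballI allI impI, rule ccontr)
  fix m ys and e :: real
  assume m: "m \<in> P2" and ys: "length ys = k" and e: "e > 0"
    and no: "\<not> (\<exists>\<delta>>0. \<forall>m'\<in>P2. \<forall>ys'. length ys' = k \<longrightarrow> W2 m m' < \<delta> \<longrightarrow>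
      (\<forall>i<k. dist (ys ! i) (ys' ! i) < \<delta>) \<longrightarrow> \<bar>F m' ys' - F m ys\<bar> < e)"
  have "\<exists>m' ys'. m' \<in> P2 \<and> length ys' = k \<and> W2 m m' < inverse (real (Suc j)) \<and>
      (\<forall>i<k. dist (ys ! i) (ys' ! i) < inverse (real (Suc j))) \<and> \<not> \<bar>F m' ys' - F m ys\<bar> < e" for j
  proof -
    have "inverse (real (Suc j)) > 0" by simp
    then show ?thesis using no by blast
  qed
  then obtain M Y where MY: "\<And>j. M j \<in> P2" "\<And>j. length (Y j) = k"
    "\<And>j. W2 m (M j) < inverse (real (Suc j))"
    "\<And>j i. i < k \<Longrightarrow> dist (ys ! i) (Y j ! i) < inverse (real (Suc j))"
    "\<And>j. \<not> \<bar>F (M j) (Y j) - F m ys\<bar> < e"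
    by metis
  have "(\<lambda>j. W2 m (M j)) \<longlonglongrightarrow> 0"
    by (rule tendsto_sandwich[OF _ _ tendsto_const LIMSEQ_inverse_real_of_nat])
      (intro always_eventually allI W2_nonneg less_imp_le[OF MY(3)])+
  then have M: "converges_P2 M m" using MY m by (simp add: converges_P2_def)
  have "(\<lambda>j. Y j ! i) \<longlonglongrightarrow> ys ! i" if "i < k" for i
  proof (subst tendsto_dist_iff, rule tendsto_sandwich[OF _ _ tendsto_const LIMSEQ_inverse_real_of_nat])
    show "\<forall>\<^sub>F j in sequentially. dist (Y j ! i) (ys ! i) \<le> inverse (real (Suc j))"
      unfolding dist_commute[of "Y _ ! i"] by (intro always_eventually allI less_imp_le MY(4) that)
  qed auto
  from assms[OF M MY(2) ys this] have "(\<lambda>j. F (M j) (Y j)) \<longlonglongrightarrow> F m ys" .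
  from tendstoD[OF this e] obtain j where "dist (F (M j) (Y j)) (F m ys) < e"
    by (auto simp: eventually_sequentially)
  with MY(5)[of j] show False by (simp add: dist_real_def)
qed

abbreviation growth :: "'a::euclidean_space list \<Rightarrow> real" where
  "growth ys \<equiv> prod_list (map (\<lambda>y. 1 + (norm y)\<^sup>2) ys)"

lemma growth_pos: "growth ys > 0"
  by (induction ys) (auto intro!: mult_pos_pos add_pos_nonneg)

lemma quadratic_growth_P2D:
  assumes "quadratic_growth_P2 k F"
  obtains C where "C \<ge> 0" "\<And>m ys. m \<in> P2 \<Longrightarrow> second_moment m \<le> R \<Longrightarrow> length ys = k \<Longrightarrow>
    \<bar>F m ys\<bar> \<le> C * growth ys"
proof -
  have "bounded_P2 {m \<in> P2. second_moment m \<le> R}" by (auto simp: bounded_P2_iff)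
  with assms obtain C where C: "\<forall>m\<in>{m \<in> P2. second_moment m \<le> R}. \<forall>ys. length ys = k \<longrightarrow>
    \<bar>F m ys\<bar> \<le> C * growth ys" unfolding quadratic_growth_P2_def by blast
  have "\<bar>F m ys\<bar> \<le> max C 0 * growth ys"
    if "m \<in> P2" "second_moment m \<le> R" "length ys = k" for m ys
  proof -
    have "\<bar>F m ys\<bar> \<le> C * growth ys" using C that by blast
    also have "\<dots> \<le> max C 0 * growth ys" using growth_pos[of ys] by (intro mult_right_mono) auto
    finally show ?thesis .
  qed
  then show thesis using that[of "max C 0"] by simp
qed

lemma quadratic_growth_P2I:
  fixes F :: "'a::euclidean_space measure \<Rightarrow> 'a list \<Rightarrow> real"
  assumes "\<And>R. \<exists>C. \<forall>m\<in>P2. second_moment m \<le> R \<longrightarrow> (\<forall>ys. length ys = k \<longrightarrow> \<bar>F m ys\<bar> \<le> C * growth ys)"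
  shows "quadratic_growth_P2 k F"
  unfolding quadratic_growth_P2_def bounded_P2_iff
proof safe
  fix K :: "'a measure set" and R assume K: "K \<subseteq> P2" "\<forall>m\<in>K. second_moment m \<le> R"
  obtain C where "\<forall>m\<in>P2. second_moment m \<le> R \<longrightarrow> (\<forall>ys. length ys = k \<longrightarrow> \<bar>F m ys\<bar> \<le> C * growth ys)"
    using assms by blast
  then show "\<exists>C. \<forall>m\<in>K. \<forall>ys. length ys = k \<longrightarrow> \<bar>F m ys\<bar> \<le> C * growth ys" using K by blast
qed

lemma tendsto_nth_append1:
  assumes "length ys = k" "h \<longlonglongrightarrow> z" "i < Suc k"
  shows "(\<lambda>j. (ys @ [h j]) ! i) \<longlonglongrightarrow> (ys @ [z]) ! i"
  using assms by (auto simp: nth_append less_Suc_eq)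

lemma slice_bound:
  assumes "quadratic_growth_P2 (Suc k) F" "length ys = k"
  obtains C where "C \<ge> 0" "\<And>m y. m \<in> P2 \<Longrightarrow> second_moment m \<le> R \<Longrightarrow>
    \<bar>F m (ys @ [y])\<bar> \<le> C * (1 + (norm y)\<^sup>2)"
proof -
  obtain C where C: "C \<ge> 0" "\<And>m ys. m \<in> P2 \<Longrightarrow> second_moment m \<le> R \<Longrightarrow> length ys = Suc k \<Longrightarrow>
    \<bar>F m ys\<bar> \<le> C * growth ys" using quadratic_growth_P2D[OF assms(1), of R] by blast
  show thesis
  proof (rule that[of "C * growth ys"])
    show "\<bar>F m (ys @ [y])\<bar> \<le> C * growth ys * (1 + (norm y)\<^sup>2)"
      if "m \<in> P2" "second_moment m \<le> R" for m y
      using C(2)[OF that, of "ys @ [y]"] assms(2) by (simp add: mult.assoc)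
  qed (use C(1) growth_pos[of ys] in auto)
qed

lemma slice_continuous:
  assumes "continuous_P2 (Suc k) F" "m \<in> P2" "length ys = k"
  shows "continuous_on UNIV (\<lambda>y. F m (ys @ [y]))"
proof (intro continuous_at_imp_continuous_on ballI continuous_at_sequentiallyI)
  fix y and u :: "nat \<Rightarrow> 'a" assume "u \<longlonglongrightarrow> y"
  then show "(\<lambda>n. F m (ys @ [u n])) \<longlonglongrightarrow> F m (ys @ [y])"
    using assms by (intro continuous_P2D[OF assms(1)] tendsto_nth_append1) auto
qed

lemma slice_borel:
  assumes "continuous_P2 (Suc k) F" "m \<in> P2" "length ys = k"
  shows "(\<lambda>y. F m (ys @ [y])) \<in> borel_measurable borel"
  using slice_continuous[OF assms] by (rule borel_measurable_continuous_onI)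

lemma slice_integrable:
  assumes "continuous_P2 (Suc k) F" "quadratic_growth_P2 (Suc k) F" "m \<in> P2" "n \<in> P2" "length ys = k"
  shows "integrable n (\<lambda>y. F m (ys @ [y]))"
proof -
  note P = P2D[OF assms(4)]
  interpret prob_space n by (rule P)
  obtain C where C: "C \<ge> 0" "\<And>m' y. m' \<in> P2 \<Longrightarrow> second_moment m' \<le> second_moment m \<Longrightarrow>
    \<bar>F m' (ys @ [y])\<bar> \<le> C * (1 + (norm y)\<^sup>2)"
    using slice_bound[OF assms(2,5), of "second_moment m"] by blast
  show ?thesis
  proof (rule Bochner_Integration.integrable_bound)
    show "integrable n (\<lambda>y. C * (1 + (norm y)\<^sup>2))" using P(4) by simp
    show "(\<lambda>y. F m (ys @ [y])) \<in> borel_measurable n"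
      unfolding measurable_borel_cong[OF P(2)] by (rule slice_borel[OF assms(1,3,5)])
    show "AE y in n. norm (F m (ys @ [y])) \<le> norm (C * (1 + (norm y)\<^sup>2))"
      using C(2)[OF assms(3) order_refl] C(1) by (simp add: abs_mult)
  qed
qed

lemma integral_slice_bound:
  assumes F: "continuous_P2 (Suc k) F" "quadratic_growth_P2 (Suc k) F" and ys: "length ys = k"
  obtains C where "C \<ge> 0" "\<And>m n. m \<in> P2 \<Longrightarrow> second_moment m \<le> R \<Longrightarrow> n \<in> P2 \<Longrightarrow>
    \<bar>LINT y|n. F m (ys @ [y])\<bar> \<le> C * (1 + second_moment n)"
proof -
  obtain C where C: "C \<ge> 0" "\<And>m' y. m' \<in> P2 \<Longrightarrow> second_moment m' \<le> R \<Longrightarrow>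
    \<bar>F m' (ys @ [y])\<bar> \<le> C * (1 + (norm y)\<^sup>2)"
    using slice_bound[OF F(2) ys, of R] by blast
  have "\<bar>LINT y|n. F m (ys @ [y])\<bar> \<le> C * (1 + second_moment n)"
    if m: "m \<in> P2" "second_moment m \<le> R" and n: "n \<in> P2" for m n
  proof -
    note P = P2D[OF n]
    interpret prob_space n by (rule P)
    note f = slice_integrable[OF F m(1) n ys]
    have "\<bar>LINT y|n. F m (ys @ [y])\<bar> \<le> (LINT y|n. \<bar>F m (ys @ [y])\<bar>)"
      by (rule integral_abs_bound)
    also have "\<dots> \<le> (LINT y|n. C * (1 + (norm y)\<^sup>2))"
      using P(4) by (intro integral_mono integrable_abs f C(2) m) simp
    also have "\<dots> = C * (1 + second_moment n)"
      using P(4) by (simp add: second_moment_def prob_space)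
    finally show ?thesis .
  qed
  then show thesis using that C(1) by blast
qed

text \<open>Dominated convergence with majorant C (1 + 4 |y|^2); second moments are bounded along a
  convergent sequence, which makes \<open>C\<close> uniform in \<open>j\<close>. Moving the
  integration variable by \<open>h j\<close> as well covers integrals against push-forwards of
  \<open>n\<close>.\<close>

lemma integral_slice_tendsto:
  fixes h :: "nat \<Rightarrow> 'a::euclidean_space \<Rightarrow> 'a"
  assumes F: "continuous_P2 (Suc k) F" "quadratic_growth_P2 (Suc k) F" and M: "converges_P2 M m"
    and n: "n \<in> P2" "length ys = k" and h: "\<And>j. h j \<in> borel_measurable borel"
    "\<And>j x. norm (h j x) \<le> 2 * norm x" "\<And>x. (\<lambda>j. h j x) \<longlonglongrightarrow> x"
  shows "(\<lambda>j. LINT y|n. F (M j) (ys @ [h j y])) \<longlonglongrightarrow> (LINT y|n. F m (ys @ [y]))"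
proof -
  note P = P2D[OF n(1)]
  interpret prob_space n by (rule P)
  have MP: "m \<in> P2" "M j \<in> P2" for j using M by (auto simp: converges_P2_def)
  obtain R where R: "\<And>j. second_moment (M j) \<le> R" using converges_P2_bounded[OF M] by blast
  obtain C where C: "C \<ge> 0" "\<And>m' y. m' \<in> P2 \<Longrightarrow> second_moment m' \<le> R \<Longrightarrow>
    \<bar>F m' (ys @ [y])\<bar> \<le> C * (1 + (norm y)\<^sup>2)"
    using slice_bound[OF F(2) n(2), of R] by blast
  show ?thesis
  proof (rule integral_dominated_convergence)
    show "(\<lambda>y. F m (ys @ [y])) \<in> borel_measurable n"
      unfolding measurable_borel_cong[OF P(2)] by (rule slice_borel[OF F(1) MP(1) n(2)])
    show "(\<lambda>y. F (M j) (ys @ [h j y])) \<in> borel_measurable n" for j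
      unfolding measurable_borel_cong[OF P(2)]
      by (rule measurable_compose[OF h(1) slice_borel[OF F(1) MP(2) n(2)]])
    show "integrable n (\<lambda>y. C * (1 + 4 * (norm y)\<^sup>2))" using P(4) by simp
    show "AE y in n. (\<lambda>j. F (M j) (ys @ [h j y])) \<longlonglongrightarrow> F m (ys @ [y])"
      using n(2) h(3) by (intro AE_I2 continuous_P2D[OF F(1) M] tendsto_nth_append1) auto
    show "AE y in n. norm (F (M j) (ys @ [h j y])) \<le> C * (1 + 4 * (norm y)\<^sup>2)" for j
    proof (rule AE_I2)
      fix y
      have "(norm (h j y))\<^sup>2 \<le> 4 * (norm y)\<^sup>2"
        using power_mono[OF h(2)[of j y], of 2] by (simp add: power_mult_distrib)
      then have "C * (1 + (norm (h j y))\<^sup>2) \<le> C * (1 + 4 * (norm y)\<^sup>2)"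
        using C(1) by (intro mult_left_mono) auto
      then show "norm (F (M j) (ys @ [h j y])) \<le> C * (1 + 4 * (norm y)\<^sup>2)"
        using C(2)[OF MP(2)[of j] R, of "h j y"] by simp
    qed
  qed
qed

section \<open>Derivatives along segments\<close>

text \<open>The integrand of the defining identity: when \<open>F\<close> is the linear functional
  derivative of \<open>G\<close>, it is the derivative at \<open>s\<close> of \<open>G\<close> along
  the segment from \<open>m\<close> to \<open>m'\<close>.\<close>

definition slope :: "('a::euclidean_space measure \<Rightarrow> 'a list \<Rightarrow> real) \<Rightarrow> 'a list \<Rightarrow>
    'a measure \<Rightarrow> 'a measure \<Rightarrow> real \<Rightarrow> real" where
  "slope F ys m m' s = (LINT y|m'. F (mixture s m m') (ys @ [y])) - (LINT y|m. F (mixture s m m') (ys @ [y]))"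

lemma slope_continuous:
  assumes F: "continuous_P2 (Suc k) F" "quadratic_growth_P2 (Suc k) F"
    and m: "m \<in> P2" "m' \<in> P2" "length ys = k"
  shows "continuous_on {0..1} (slope F ys m m')"
  unfolding continuous_on_sequentially
proof (intro allI ballI impI)
  fix S :: "nat \<Rightarrow> real" and s assume s: "s \<in> {0..1}" and S: "(\<forall>n. S n \<in> {0..1}) \<and> S \<longlonglongrightarrow> s"
  have c: "converges_P2 (\<lambda>j. mixture (S j) m m') (mixture s m m')"
    using S s by (intro converges_P2_mixture_path m) auto
  show "(slope F ys m m' \<circ> S) \<longlonglongrightarrow> slope F ys m m' s"
    unfolding slope_def o_def
    using integral_slice_tendsto[OF F c m(1,3), of "\<lambda>j x. x"] integral_slice_tendsto[OF F c m(2,3), of "\<lambda>j x. x"]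
    by (intro tendsto_diff) auto
qed

text \<open>The definition uses a Lebesgue integral, the calculus below the Henstock-Kurzweil
  \<open>integral\<close>; for the continuous \<open>slope\<close> they agree.\<close>

lemma slope_integral:
  assumes F: "continuous_P2 (Suc k) F" "quadratic_growth_P2 (Suc k) F"
    and m: "m \<in> P2" "m' \<in> P2" "length ys = k"
  shows "(LINT s:{0..1}|lborel. (LINT y|m'. F (mixture s m m') (ys @ [y])) - (LINT y|m. F (mixture s m m') (ys @ [y])))
    = integral {0..1} (slope F ys m m')"
  using set_borel_integral_eq_integral(2)[OF borel_integrable_atLeastAtMost'[OF slope_continuous[OF assms]]]
  by (simp add: slope_def)

lemma lin_fun_deriv_stepD:
  fixes F G :: "'a::euclidean_space measure \<Rightarrow> 'a list \<Rightarrow> real"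
  assumes "lin_fun_deriv_step k G F"
  shows "continuous_P2 (Suc k) F" "quadratic_growth_P2 (Suc k) F"
    "\<And>m ys. m \<in> P2 \<Longrightarrow> length ys = k \<Longrightarrow> F m (ys @ [0]) = 0"
    "\<And>m m' ys. m \<in> P2 \<Longrightarrow> m' \<in> P2 \<Longrightarrow> length ys = k \<Longrightarrow>
      G m' ys - G m ys = integral {0..1} (slope F ys m m')"
proof -
  show F: "continuous_P2 (Suc k) F" "quadratic_growth_P2 (Suc k) F"
    "\<And>m ys. m \<in> P2 \<Longrightarrow> length ys = k \<Longrightarrow> F m (ys @ [0]) = 0"
    using assms unfolding lin_fun_deriv_step_def by blast+
  fix m m' :: "'a measure" and ys :: "'a list"
  assume m: "m \<in> P2" "m' \<in> P2" "length ys = k"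
  then show "G m' ys - G m ys = integral {0..1} (slope F ys m m')"
    using assms unfolding lin_fun_deriv_step_def slope_integral[OF F(1,2) m, symmetric] by blast
qed

text \<open>As a signed measure, \<open>mixture h m m'\<close> minus \<open>m\<close> is h times the
  difference of \<open>m'\<close> and \<open>m\<close>; this is the chain rule for a shortened
  segment.\<close>

lemma slope_rescale:
  assumes F: "continuous_P2 (Suc k) F" "quadratic_growth_P2 (Suc k) F"
    and m: "m \<in> P2" "m' \<in> P2" "length ys = k" and h: "h \<in> {0..1}" "s \<in> {0..1}"
  shows "slope F ys m (mixture h m m') s = h * slope F ys m m' (s * h)"
proof -
  note P = P2D(2)[OF m(1)] P2D(2)[OF m(2)]
  have e: "mixture s m (mixture h m m') = mixture (s * h) m m'"
    using mixture_mixture[OF P, of s 0 h] h P by simp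
  have sh: "mixture (s * h) m m' \<in> P2" using h by (intro mixture_in_P2 m) (auto simp: mult_le_one)
  have "(LINT y|mixture h m m'. F (mixture (s * h) m m') (ys @ [y])) =
      (1 - h) * (LINT y|m. F (mixture (s * h) m m') (ys @ [y])) + h * (LINT y|m'. F (mixture (s * h) m m') (ys @ [y]))"
    using h slice_borel[OF F(1) sh m(3)] slice_integrable[OF F sh _ m(3)] m P
    by (intro integral_mixture(2)) auto
  then show ?thesis unfolding slope_def e by (simp add: algebra_simps)
qed

text \<open>After rescaling, the identity between \<open>m\<close> and \<open>mixture h m m'\<close>
  says that \<open>G\<close> along the segment is a primitive of the continuous function
  \<open>slope\<close>. At the end points the derivative is one-sided.\<close>

lemma lin_fun_deriv_step_has_derivative:
  assumes st: "lin_fun_deriv_step k G F" and m: "m \<in> P2" "m' \<in> P2" "length ys = k" and h: "h \<in> {0..1}"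
  shows "((\<lambda>h. G (mixture h m m') ys) has_real_derivative slope F ys m m' h) (at h within {0..1})"
proof -
  note S = lin_fun_deriv_stepD[OF st]
  note P = P2D(2)[OF m(1)] P2D(2)[OF m(2)]
  note c = slope_continuous[OF S(1,2) m]
  define \<Gamma> where "\<Gamma> x = integral {0..x} (slope F ys m m')" for x
  have d: "(\<Gamma> has_real_derivative slope F ys m m' t) (at t within {0..1})" if "t \<in> {0..1}" for t
    unfolding \<Gamma>_def by (rule integral_has_real_derivative[OF c that])
  have eq: "G (mixture h m m') ys = G m ys + \<Gamma> h" if h: "h \<in> {0..1}" for h
  proof -
    have "G (mixture h m m') ys - G m ys = integral {0..1} (slope F ys m (mixture h m m'))"
      using h m by (intro S(4)) auto
    also have "\<dots> = integral {0..1} (\<lambda>s. slope F ys m m' (s * h) * h)"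
      by (intro integral_cong) (simp add: slope_rescale[OF S(1,2) m h])
    \<comment> \<open>The substitution is made by differentiating \<open>\<Gamma> (s * h)\<close> in
      \<open>s\<close>, so that h = 0 is included.\<close>
    also have "\<dots> = \<Gamma> (1 * h) - \<Gamma> (0 * h)"
    proof (intro integral_unique fundamental_theorem_of_calculus)
      fix s :: real assume s: "s \<in> {0..1}"
      have sh: "s * h \<in> {0..1}" using s h by (auto simp: mult_le_one)
      have im: "(\<lambda>s. s * h) ` {0..1} \<subseteq> {0..1}" using h by (auto simp: mult_le_one)
      have "((\<lambda>s. \<Gamma> (s * h)) has_real_derivative slope F ys m m' (s * h) * h) (at s within {0..1})"
        by (rule DERIV_image_chain[unfolded o_def, OF DERIV_subset[OF d[OF sh] im]])
          (auto intro!: derivative_eq_intros)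
      then show "((\<lambda>s. \<Gamma> (s * h)) has_vector_derivative slope F ys m m' (s * h) * h) (at s within {0..1})"
        by (simp add: has_real_derivative_iff_has_vector_derivative)
    qed auto
    finally show ?thesis by (simp add: \<Gamma>_def)
  qed
  have "((\<lambda>h. G m ys + \<Gamma> h) has_real_derivative slope F ys m m' h) (at h within {0..1})"
    using d[OF h] by (auto intro!: derivative_eq_intros)
  then show ?thesis
    unfolding has_field_derivative_def by (rule has_derivative_transform[OF h, rotated]) (simp add: eq)
qed

lemma slope_0:
  "sets m = sets borel \<Longrightarrow> sets m' = sets borel \<Longrightarrow>
    slope F ys m m' 0 = (LINT y|m'. F m (ys @ [y])) - (LINT y|m. F m (ys @ [y]))"
  by (simp add: slope_def)

lemma slope_return_0:
  assumes "continuous_P2 (Suc k) F" "m \<in> P2" "length ys = k"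
  shows "slope F ys m (return borel z) 0 = F m (ys @ [z]) - (LINT y|m. F m (ys @ [y]))"
  using slice_borel[OF assms] P2D(2)[OF assms(2)] by (subst slope_0) auto

text \<open>The derivative of \<open>G\<close> from \<open>m\<close> towards the Dirac mass at
  \<open>z\<close> is \<open>F m (ys @ [z])\<close> minus a term free of \<open>z\<close>. Comparing
  \<open>z\<close> with 0 and using the normalisation recovers \<open>F\<close>.\<close>

lemma lin_fun_deriv_step_unique:
  assumes st: "lin_fun_deriv_step k G F" "lin_fun_deriv_step k G' F'"
    and eq: "\<And>m ys. m \<in> P2 \<Longrightarrow> length ys = k \<Longrightarrow> G m ys = G' m ys"
    and m: "m \<in> P2" "length ws = Suc k"
  shows "F m ws = F' m ws"
proof -
  note S = lin_fun_deriv_stepD[OF st(1)] and S' = lin_fun_deriv_stepD[OF st(2)]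
  obtain ys z where ws: "ws = ys @ [z]" using m(2) by (metis length_Suc_conv_rev)
  have ys: "length ys = k" using m(2) ws by simp
  have "slope F ys m (return borel z) 0 = slope F' ys m (return borel z) 0" for z
  proof (rule has_field_derivative_unique)
    let ?g = "\<lambda>h. G (mixture h m (return borel z)) ys"
    show "(?g has_real_derivative slope F ys m (return borel z) 0) (at 0 within {0..1})"
      by (rule lin_fun_deriv_step_has_derivative[OF st(1) m(1) _ ys]) auto
    have "((\<lambda>h. G' (mixture h m (return borel z)) ys) has_real_derivative slope F' ys m (return borel z) 0) (at 0 within {0..1})"
      by (rule lin_fun_deriv_step_has_derivative[OF st(2) m(1) _ ys]) auto
    then show "(?g has_real_derivative slope F' ys m (return borel z) 0) (at 0 within {0..1})"
      unfolding has_field_derivative_def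
      by (rule has_derivative_transform[rotated 2]) (use eq m ys in auto)
    show "at (0::real) within {0..1} \<noteq> bot" by (simp add: trivial_limit_within islimpt_Icc)
  qed
  from this[of z] this[of 0] show ?thesis
    using slope_return_0[OF S(1) m(1) ys] slope_return_0[OF S'(1) m(1) ys] S(3)[OF m(1) ys] S'(3)[OF m(1) ys]
    by (simp add: ws)
qed

lemma lin_fun_deriv_unique:
  "lin_fun_deriv p U F \<Longrightarrow> lin_fun_deriv p U F' \<Longrightarrow> m \<in> P2 \<Longrightarrow> length ys = p \<Longrightarrow> F m ys = F' m ys"
proof (induction p arbitrary: F F' m ys)
  case 0
  then show ?case by simp
next
  case (Suc p)
  then obtain G G' where "lin_fun_deriv p U G" "lin_fun_deriv_step p G F"
    "lin_fun_deriv p U G'" "lin_fun_deriv_step p G' F'" by auto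
  then show ?case using Suc.IH lin_fun_deriv_step_unique[of p G F G' F' m ys] Suc.prems by blast
qed

section \<open>Finitely supported measures\<close>

text \<open>\<open>A\<close> may be larger than the support: two measures can then share one
  \<open>A\<close>, and their difference becomes a single sum over it.\<close>

definition supported_on :: "'a::euclidean_space set \<Rightarrow> 'a measure \<Rightarrow> bool" where
  "supported_on A m \<longleftrightarrow> finite A \<and> m \<in> P2 \<and> (AE x in m. x \<in> A)"

lemma integral_supported_on:
  fixes f :: "'a::euclidean_space \<Rightarrow> real"
  assumes "supported_on A m" "f \<in> borel_measurable borel"
  shows "integral\<^sup>L m f = (\<Sum>a\<in>A. measure m {a} * f a)"
proof -
  have A: "finite A" "m \<in> P2" "AE x in m. x \<in> A" using assms by (auto simp: supported_on_def)
  note P = P2D[OF A(2)]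
  interpret prob_space m by (rule P)
  have sg: "{a} \<in> sets m" for a using P(2) by simp
  have "integral\<^sup>L m f = (LINT x|m. (\<Sum>a\<in>A. indicator {a} x * f a))"
  proof (rule integral_cong_AE)
    show "f \<in> borel_measurable m" unfolding measurable_borel_cong[OF P(2)] by fact
    show "(\<lambda>x. \<Sum>a\<in>A. indicator {a} x * f a) \<in> borel_measurable m"
      using sg by (intro borel_measurable_sum borel_measurable_times borel_measurable_indicator) auto
    show "AE x in m. f x = (\<Sum>a\<in>A. indicator {a} x * f a)"
      using A(3) by eventually_elim (use A(1) in \<open>simp add: indicator_def sum.delta' if_distrib cong: if_cong\<close>)
  qed
  also have "\<dots> = (\<Sum>a\<in>A. LINT x|m. indicator {a} x * f a)"
    using sg by (intro Bochner_Integration.integral_sum integrable_mult_left integrable_real_indicator) (auto simp: emeasure_eq_measure)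
  also have "\<dots> = (\<Sum>a\<in>A. measure m {a} * f a)"
    using sg P(3) by (simp add: measure_def)
  finally show ?thesis .
qed

lemma slope_supported_on:
  assumes "supported_on A m" "supported_on A m'" "continuous_P2 (Suc k) F" "length ys = k" "s \<in> {0..1}"
  shows "slope F ys m m' s = (\<Sum>a\<in>A. (measure m' {a} - measure m {a}) * F (mixture s m m') (ys @ [a]))"
proof -
  have "mixture s m m' \<in> P2" using assms by (intro mixture_in_P2) (auto simp: supported_on_def)
  from slice_borel[OF assms(3) this assms(4)] show ?thesis
    unfolding slope_def
    by (simp add: integral_supported_on[OF assms(1)] integral_supported_on[OF assms(2)]
        sum_subtractf[symmetric] left_diff_distrib)
qed

lemma supported_on_return: "finite A \<Longrightarrow> z \<in> A \<Longrightarrow> supported_on A (return borel z)"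
  unfolding supported_on_def
  by (subst AE_return) (auto simp: pred_def intro: borel_closed finite_imp_closed)

text \<open>Simple functions approximating the identity. The bound by 2 |x| gives domination of
  second moments and also forces \<open>h j 0 = 0\<close>.\<close>

lemma finite_approximation:
  obtains h :: "nat \<Rightarrow> 'a::euclidean_space \<Rightarrow> 'a" where
    "\<And>j. h j \<in> borel_measurable borel" "\<And>j x. norm (h j x) \<le> 2 * norm x"
    "\<And>x. (\<lambda>j. h j x) \<longlonglongrightarrow> x" "\<And>j. finite (range (h j))"
proof -
  obtain h :: "nat \<Rightarrow> 'a \<Rightarrow> 'a" where h: "\<And>i. simple_function borel (h i)" "\<And>x. (\<lambda>i. h i x) \<longlonglongrightarrow> x"
    "\<And>i x. dist (h i x) 0 \<le> 2 * dist x 0"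
    using borel_measurable_implies_sequence_metric[of "\<lambda>x::'a. x" borel 0] by auto
  show thesis
  proof (rule that[of h])
    show "finite (range (h j))" for j using simple_functionD(1)[OF h(1)[of j]] by simp
    show "h j \<in> borel_measurable borel" for j by (rule borel_measurable_simple_function[OF h(1)])
    show "norm (h j x) \<le> 2 * norm x" for j x using h(3)[of j x] by simp
  qed (rule h(2))
qed

lemma supported_on_distr:
  assumes "m \<in> P2" "h \<in> borel_measurable borel" "finite (range h)" "distr m borel h \<in> P2"
  shows "supported_on (range h) (distr m borel h)"
proof -
  have "h \<in> borel_measurable m" unfolding measurable_borel_cong[OF P2D(2)[OF assms(1)]] by fact
  moreover have "range h \<in> sets borel" using assms(3) by (intro borel_closed finite_imp_closed)
  ultimately show ?thesis using assms unfolding supported_on_def by (subst AE_distr_iff) auto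
qed

text \<open>Finitely supported measures are dense, so the defining identity of a linear functional
  derivative only needs to be checked on them.\<close>

lemma lin_fun_deriv_stepI:
  fixes F G :: "'a::euclidean_space measure \<Rightarrow> 'a list \<Rightarrow> real"
  assumes G: "continuous_P2 k G" and F: "continuous_P2 (Suc k) F" "quadratic_growth_P2 (Suc k) F"
    and "\<And>m ys. m \<in> P2 \<Longrightarrow> length ys = k \<Longrightarrow> F m (ys @ [0]) = 0"
    and id: "\<And>A m m' ys. supported_on A m \<Longrightarrow> supported_on A m' \<Longrightarrow> length ys = k \<Longrightarrow>
      G m' ys - G m ys = integral {0..1} (slope F ys m m')"
  shows "lin_fun_deriv_step k G F"
  unfolding lin_fun_deriv_step_def
proof (intro conjI ballI allI impI assms)
  fix m m' :: "'a measure" and ys :: "'a list"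
  assume m: "m \<in> P2" "m' \<in> P2" and ys: "length ys = k"
  note P = P2D(2)[OF m(1)] P2D(2)[OF m(2)]
  obtain h :: "nat \<Rightarrow> 'a \<Rightarrow> 'a" where h: "\<And>j. h j \<in> borel_measurable borel" "\<And>j x. norm (h j x) \<le> 2 * norm x"
    "\<And>x. (\<lambda>j. h j x) \<longlonglongrightarrow> x" and fin: "\<And>j. finite (range (h j))"
    using finite_approximation by blast
  \<comment> \<open>The same \<open>h j\<close> pushes both measures, so \<open>range (h j)\<close>
    is a common finite support.\<close>
  define M where "M j = distr m borel (h j)" for j
  define M' where "M' j = distr m' borel (h j)" for j
  have c: "converges_P2 M m" "converges_P2 M' m'"
    unfolding M_def M'_def by (intro converges_P2_distr m h)+
  have MP: "M j \<in> P2" "M' j \<in> P2" for j using c by (auto simp: converges_P2_def)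
  have sup: "supported_on (range (h j)) (M j)" "supported_on (range (h j)) (M' j)" for j
    using MP[of j] unfolding M_def M'_def by (intro supported_on_distr m h fin; simp)+
  obtain R1 R2 where R: "\<And>j. second_moment (M j) \<le> R1" "\<And>j. second_moment (M' j) \<le> R2"
    using converges_P2_bounded[OF c(1)] converges_P2_bounded[OF c(2)] by metis
  define S where "S j = slope F ys (M j) (M' j)" for j
  have mP: "mixture s (M j) (M' j) \<in> P2" if "s \<in> {0..1}" for s j using that MP by auto
  have S: "S j s = (LINT y|m'. F (mixture s (M j) (M' j)) (ys @ [h j y])) - (LINT y|m. F (mixture s (M j) (M' j)) (ys @ [h j y]))"
    if s: "s \<in> {0..1}" for j s
  proof -
    have "h j \<in> borel_measurable m" "h j \<in> borel_measurable m'"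
      unfolding measurable_borel_cong[OF P(1)] measurable_borel_cong[OF P(2)] by (fact h)+
    note d = integral_distr[OF this(1) slice_borel[OF F(1) mP[OF s, of j] ys]]
      integral_distr[OF this(2) slice_borel[OF F(1) mP[OF s, of j] ys]]
    show ?thesis unfolding S_def slope_def
      using d unfolding M_def[symmetric] M'_def[symmetric] by simp
  qed
  obtain C where C: "C \<ge> 0" "\<And>m n. m \<in> P2 \<Longrightarrow> second_moment m \<le> R1 + R2 \<Longrightarrow> n \<in> P2 \<Longrightarrow>
    \<bar>LINT y|n. F m (ys @ [y])\<bar> \<le> C * (1 + second_moment n)"
    using integral_slice_bound[OF F ys, of "R1 + R2"] by blast
  have b: "\<bar>S j s\<bar> \<le> C * (1 + R2) + C * (1 + R1)" if s: "s \<in> {0..1}" for s j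
  proof -
    have "second_moment (mixture s (M j) (M' j)) \<le> R1 + R2"
      using second_moment_mixture_le[OF MP[of j], of s] s R(1)[of j] R(2)[of j] by auto
    note C' = C(2)[OF mP[OF s] this]
    have "C * (1 + second_moment (M' j)) \<le> C * (1 + R2)" "C * (1 + second_moment (M j)) \<le> C * (1 + R1)"
      using R(1)[of j] R(2)[of j] C(1) by (auto intro: mult_left_mono)
    then show ?thesis
      using C'[OF MP(1)[of j]] C'[OF MP(2)[of j]] unfolding S_def slope_def by linarith
  qed
  have "(\<lambda>j. integral {0..1} (S j)) \<longlonglongrightarrow> integral {0..1} (slope F ys m m')"
  proof (rule dominated_convergence(2))
    show "S j integrable_on {0..1}" for j
      unfolding S_def by (intro integrable_continuous_real slope_continuous[OF F MP ys])
    show "(\<lambda>_. C * (1 + R2) + C * (1 + R1)) integrable_on {0..1::real}"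
      by (intro integrable_const_ivl)
    fix s :: real assume s: "s \<in> {0..1}"
    show "norm (S j s) \<le> C * (1 + R2) + C * (1 + R1)" for j
      using b[OF s] by simp
    have cm: "converges_P2 (\<lambda>j. mixture s (M j) (M' j)) (mixture s m m')"
      using s by (intro converges_P2_mixture c) auto
    show "(\<lambda>j. S j s) \<longlonglongrightarrow> slope F ys m m' s"
      unfolding S[OF s] slope_def
      by (intro tendsto_diff integral_slice_tendsto[OF F cm] m ys h)
  qed
  moreover have "(\<lambda>j. integral {0..1} (S j)) = (\<lambda>j. G (M' j) ys - G (M j) ys)"
    unfolding S_def using id[OF sup ys] by simp
  moreover have "(\<lambda>j. G (M' j) ys - G (M j) ys) \<longlonglongrightarrow> G m' ys - G m ys"
    by (intro tendsto_diff continuous_P2D[OF G] c) (simp_all add: ys)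
  ultimately have "G m' ys - G m ys = integral {0..1} (slope F ys m m')"
    using LIMSEQ_unique by fastforce
  then show "G m' ys - G m ys =
      (LINT s:{0..1}|lborel. (LINT y|m'. F (mixture s m m') (ys @ [y])) - (LINT y|m. F (mixture s m m') (ys @ [y])))"
    unfolding slope_integral[OF F m ys] .
qed

section \<open>Numerical differentiation\<close>

text \<open>Richardson extrapolation: combining the rule with its copy at half the step size
  cancels the error term of order \<open>n\<close>.\<close>

lemma numeric_differentiation_rule:
  assumes "n \<ge> 2"
  shows "\<exists>(N::nat) c t. (\<forall>i<N. 0 \<le> t i \<and> t i \<le> (1::real)) \<and>
    (\<forall>j<n. (\<Sum>i<N. c i * t i ^ j) = (if j = 1 then 1 else 0 :: real))"
  using assms
proof (induction n rule: nat_induct_at_least)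
  case base
  show ?case
  proof (intro exI conjI allI impI)
    \<comment> \<open>Nodes 0 and 1 with weights -1 and 1: the forward difference quotient.\<close>
    let ?c = "\<lambda>i::nat. if i = 0 then -1 else 1 :: real"
    show "0 \<le> real i" "real i \<le> 1" if "i < 2" for i using that by auto
    show "(\<Sum>i<2. ?c i * real i ^ j) = (if j = 1 then 1 else 0 :: real)" if "j < 2" for j
    proof -
      have "(\<Sum>i<2. ?c i * real i ^ j) = - (0 ^ j) + 1"
        unfolding numeral_2_eq_2 sum.lessThan_Suc by simp
      moreover have "j = 0 \<or> j = 1" using that by auto
      ultimately show ?thesis by (elim disjE) simp_all
    qed
  qed
next
  case (Suc n)
  from Suc.IH obtain N :: nat and c t :: "nat \<Rightarrow> real" where H: "(\<forall>i<N. 0 \<le> t i \<and> t i \<le> 1) \<and>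
    (\<forall>j<n. (\<Sum>i<N. c i * t i ^ j) = (if j = 1 then 1 else 0))"
    by (elim exE) (rule that)
  have t: "0 \<le> t i \<and> t i \<le> 1" if "i < N" for i
    using conjunct1[OF H] that by (elim allE[of _ i]) simp
  have mom: "(\<Sum>i<N. c i * t i ^ j) = (if j = 1 then 1 else 0)" if "j < n" for j
    by (rule conjunct2[OF H, rule_format, OF that])
  \<comment> \<open>The copy at half the step carries the weights 2 c i, so its j-th moment is
    multiplied by 2/2^j: by 1 for j = 1 and by \<open>q\<close> for j = n. The conditions \<alpha> +
    \<beta> = 1 and \<alpha> + \<beta> q = 0 fix the combination; they are solvable because n \<ge>
    2 makes q < 1.\<close>
  define q :: real where "q = 2 / 2 ^ n"
  have "(2::real) ^ 2 \<le> 2 ^ n" using Suc.hyps by (intro power_increasing) auto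
  then have "q < 1" by (simp add: q_def divide_less_eq)
  define \<beta> where "\<beta> = 1 / (1 - q)"
  define \<alpha> where "\<alpha> = - \<beta> * q"
  have "\<alpha> + \<beta> = \<beta> * (1 - q)" by (simp add: \<alpha>_def algebra_simps)
  then have ab: "\<alpha> + \<beta> = 1" using \<open>q < 1\<close> by (simp add: \<beta>_def)
  define c' where "c' i = (if i < N then \<alpha> * c i else 2 * \<beta> * c (i - N))" for i
  define t' where "t' i = (if i < N then t i else t (i - N) / 2)" for i
  have split: "(\<Sum>i<N + N. c' i * t' i ^ j) = (\<alpha> + \<beta> * (2 / 2 ^ j)) * (\<Sum>i<N. c i * t i ^ j)" for j
  proof -
    have "(\<Sum>i<N + N. c' i * t' i ^ j)
        = (\<Sum>i<N. c' i * t' i ^ j) + (\<Sum>i<N. c' (i + N) * t' (i + N) ^ j)"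
    proof -
      have "(\<Sum>i<N + M. f i) = (\<Sum>i<N. f i) + (\<Sum>i<M. f (i + N))" for f :: "nat \<Rightarrow> real" and M
        by (induction M) (auto simp: add.commute)
      then show ?thesis .
    qed
    also have "\<dots> = (\<Sum>i<N. \<alpha> * (c i * t i ^ j)) + (\<Sum>i<N. \<beta> * (2 / 2 ^ j) * (c i * t i ^ j))"
      by (rule arg_cong2[where f="(+)"]; rule sum.cong) (auto simp: c'_def t'_def power_divide)
    finally show ?thesis by (simp only: sum_distrib_left[symmetric] distrib_right)
  qed
  show ?case
  proof (rule exI[of _ "N + N"], rule exI[of _ c'], rule exI[of _ t'], intro conjI allI impI)
    have t': "0 \<le> t' i \<and> t' i \<le> 1" if "i < N + N" for i
    proof (cases "i < N")
      case True
      then show ?thesis using t[of i] by (auto simp: t'_def)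
    next
      case False
      then have "i - N < N" using that by simp
      from t[OF this] False show ?thesis by (auto simp: t'_def)
    qed
    then show "0 \<le> t' i" "t' i \<le> 1" if "i < N + N" for i using that by auto
    show "(\<Sum>i<N + N. c' i * t' i ^ j) = (if j = 1 then 1 else 0)" if "j < Suc n" for j
    proof (cases "j < n")
      case True
      then show ?thesis using ab unfolding split by (simp add: mom)
    next
      case False
      then have "j = n" using that by simp
      moreover have "\<alpha> + \<beta> * (2 / 2 ^ n) = 0" by (simp add: \<alpha>_def q_def)
      ultimately show ?thesis using Suc.hyps unfolding split by simp
    qed
  qed
qed

text \<open>The rule reproduces the linear coefficient of the polynomial exactly, so the other
  coefficients leave no trace in the error: only the remainder does, amplified by the sum of the |c
  i| and divided by \<open>e\<close>.\<close>

lemma numeric_differentiation_error: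
  fixes c t a :: "nat \<Rightarrow> real" and v :: "real \<Rightarrow> real"
  assumes n: "n \<ge> 2" and t: "\<And>i. i < N \<Longrightarrow> 0 \<le> t i \<and> t i \<le> 1"
    and mom: "\<And>j. j < n \<Longrightarrow> (\<Sum>i<N. c i * t i ^ j) = (if j = 1 then 1 else 0)"
    and v: "\<And>x. 0 \<le> x \<Longrightarrow> x \<le> e \<Longrightarrow> \<bar>v x - (\<Sum>j<n. a j * x ^ j)\<bar> \<le> R * x ^ n"
    and e: "0 < e" and R: "R \<ge> 0"
  shows "\<bar>(\<Sum>i<N. c i * v (t i * e)) / e - a 1\<bar> \<le> (\<Sum>i<N. \<bar>c i\<bar>) * R * e ^ (n - 1)"
proof -
  let ?P = "\<lambda>x. \<Sum>j<n. a j * x ^ j"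
  have te: "0 \<le> t i * e" "t i * e \<le> e" if "i < N" for i
    using t[OF that] e by (auto simp: mult_le_cancel_right1)
  have "(\<Sum>i<N. c i * ?P (t i * e)) = (\<Sum>j<n. a j * e ^ j * (\<Sum>i<N. c i * t i ^ j))"
    unfolding sum_distrib_left by (subst sum.swap) (simp add: power_mult_distrib mult_ac)
  also have "\<dots> = (\<Sum>j<n. if j = 1 then a 1 * e else 0)"
    by (intro sum.cong) (auto simp: mom)
  also have "\<dots> = a 1 * e" using n by simp
  finally have P: "(\<Sum>i<N. c i * ?P (t i * e)) = a 1 * e" .
  have "\<bar>\<Sum>i<N. c i * (v (t i * e) - ?P (t i * e))\<bar> \<le> (\<Sum>i<N. \<bar>c i\<bar> * (R * e ^ n))"
  proof (rule order_trans[OF sum_abs sum_mono])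
    fix i assume "i \<in> {..<N}"
    then have i: "i < N" by simp
    have "\<bar>v (t i * e) - ?P (t i * e)\<bar> \<le> R * (t i * e) ^ n" by (rule v[OF te[OF i]])
    also have "\<dots> \<le> R * e ^ n" using te[OF i] R by (intro mult_left_mono power_mono) auto
    finally show "\<bar>c i * (v (t i * e) - ?P (t i * e))\<bar> \<le> \<bar>c i\<bar> * (R * e ^ n)"
      unfolding abs_mult by (intro mult_left_mono) auto
  qed
  also have "\<dots> = (\<Sum>i<N. \<bar>c i\<bar>) * R * e ^ (n - 1) * e"
    using n by (cases n) (simp_all add: sum_distrib_right[symmetric])
  also have "(\<Sum>i<N. c i * (v (t i * e) - ?P (t i * e))) = (\<Sum>i<N. c i * v (t i * e)) - a 1 * e"
    using P by (simp add: right_diff_distrib sum_subtractf)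
  finally have "\<bar>(\<Sum>i<N. c i * v (t i * e)) - a 1 * e\<bar> / e \<le> (\<Sum>i<N. \<bar>c i\<bar>) * R * e ^ (n - 1)"
    using e by (simp add: divide_le_eq)
  moreover have "\<bar>(\<Sum>i<N. c i * v (t i * e)) - a 1 * e\<bar> / e = \<bar>(\<Sum>i<N. c i * v (t i * e)) / e - a 1\<bar>"
    using e by (simp add: abs_if field_simps)
  ultimately show ?thesis by simp
qed

lemma DERIV_affine_within:
  fixes f :: "real \<Rightarrow> real"
  assumes "(f has_real_derivative d) (at (a + c * x) within T)" "\<And>s. s \<in> S \<Longrightarrow> a + c * s \<in> T"
  shows "((\<lambda>s. f (a + c * s)) has_real_derivative d * c) (at x within S)"
proof -
  have "((\<lambda>s. a + c * s) has_real_derivative c) (at x within S)"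
    by (auto intro!: derivative_eq_intros)
  moreover have "(f has_real_derivative d) (at (a + c * x) within (\<lambda>s. a + c * s) ` S)"
    using assms by (intro DERIV_subset[OF assms(1)]) auto
  ultimately show ?thesis
    using DERIV_image_chain[of f d "\<lambda>s. a + c * s" x S c] by (simp add: o_def)
qed

text \<open>The rule is applied to the antiderivative \<open>J\<close> of \<open>f\<close>, which is known to be
  differentiable.\<close>

lemma numeric_differentiation_integral:
  fixes f \<gamma> :: "real \<Rightarrow> real" and c t :: "nat \<Rightarrow> real"
  assumes f: "continuous_on {0..1} f" and \<gamma>: "continuous_on {0..1} \<gamma>"
    and t: "\<And>i. i < N \<Longrightarrow> 0 \<le> t i \<and> t i \<le> 1"
    and mom: "(\<Sum>i<N. c i) = 0" "(\<Sum>i<N. c i * t i) = 1"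
    and bd: "\<And>h e. 0 \<le> h \<Longrightarrow> 0 < e \<Longrightarrow> h + e \<le> 1 \<Longrightarrow> \<bar>(\<Sum>i<N. c i * f (h + t i * e)) / e\<bar> \<le> W"
    and lim: "\<And>h e. 0 \<le> h \<Longrightarrow> (\<And>j. 0 < e j) \<Longrightarrow> (\<And>j. h + e j \<le> 1) \<Longrightarrow> e \<longlonglongrightarrow> 0 \<Longrightarrow>
      (\<lambda>j. (\<Sum>i<N. c i * f (h + t i * e j)) / e j) \<longlonglongrightarrow> \<gamma> h"
  shows "f 1 - f 0 = integral {0..1} \<gamma>"
proof -
  define J where "J x = integral {0..x} f" for x
  have J: "(J has_real_derivative f x) (at x within {0..1})" if "x \<in> {0..1}" for x
    unfolding J_def by (rule integral_has_real_derivative[OF f that])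
  have main: "f h - f 0 = integral {0..h} \<gamma>" if h: "0 \<le> h" "h < 1" for h
  proof -
    \<comment> \<open>These steps keep h + e j within [0, 1] and are positive because h < 1.\<close>
    define e where "e j = (1 - h) * inverse (real (Suc j))" for j
    have e0: "0 < e j" "e j \<le> 1 - h" for j
      using h mult_left_mono[of "inverse (real (Suc j))" 1 "1 - h"] by (auto simp: e_def inverse_le_1_iff)
    have "e \<longlonglongrightarrow> (1 - h) * 0" unfolding e_def by (intro tendsto_intros LIMSEQ_inverse_real_of_nat)
    then have elim: "e \<longlonglongrightarrow> 0" by simp
    have tt: "0 \<le> t i * e j" "t i * e j \<le> e j" if "i < N" for i j
      using t[OF that] e0(1)[of j] by (auto simp: mult_le_cancel_right1)
    have int: "((\<lambda>r. f (r + t i * e j)) has_integral J (h + t i * e j) - J (0 + t i * e j)) {0..h}"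
      if i: "i < N" for i j
    proof (rule fundamental_theorem_of_calculus)
      fix r assume r: "r \<in> {0..h}"
      have "((\<lambda>r. J (t i * e j + 1 * r)) has_real_derivative f (t i * e j + 1 * r) * 1) (at r within {0..h})"
        using r h tt[OF i, of j] e0(2)[of j] by (intro DERIV_affine_within[OF J]) auto
      then show "((\<lambda>r. J (r + t i * e j)) has_vector_derivative f (r + t i * e j)) (at r within {0..h})"
        by (simp add: has_real_derivative_iff_has_vector_derivative add.commute)
    qed (use h in auto)
    have int2: "((\<lambda>r. (\<Sum>i<N. c i * f (r + t i * e j)) / e j) has_integral
        (\<Sum>i<N. c i * (J (h + t i * e j) - J (t i * e j))) / e j) {0..h}" for j
      using int by (intro has_integral_divide has_integral_sum has_integral_mult_right) auto
    have "(\<lambda>j. integral {0..h} (\<lambda>r. (\<Sum>i<N. c i * f (r + t i * e j)) / e j)) \<longlonglongrightarrow> integral {0..h} \<gamma>"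
    proof (rule dominated_convergence(2))
      show "(\<lambda>r. (\<Sum>i<N. c i * f (r + t i * e j)) / e j) integrable_on {0..h}" for j
        using int2 by blast
      show "(\<lambda>_. W) integrable_on {0..h}" by (rule integrable_const_ivl)
      fix r assume r: "r \<in> {0..h}"
      show "norm ((\<Sum>i<N. c i * f (r + t i * e j)) / e j) \<le> W" for j
        using bd[of r "e j"] r e0[of j] by auto
      show "(\<lambda>j. (\<Sum>i<N. c i * f (r + t i * e j)) / e j) \<longlonglongrightarrow> \<gamma> r"
      proof (rule lim)
        show "r + e j \<le> 1" for j using r e0(2)[of j] by auto
      qed (use r e0 elim in auto)
    qed
    then have A: "(\<lambda>j. (\<Sum>i<N. c i * (J (h + t i * e j) - J (t i * e j))) / e j) \<longlonglongrightarrow> integral {0..h} \<gamma>"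
      unfolding integral_unique[OF int2] .
    \<comment> \<open>Difference quotients of \<open>J\<close> converge because \<open>J\<close> is
      differentiable. As the weights sum to 0 and have first moment 1, the rule applied to
      \<open>J\<close> at h, minus the rule at 0, tends to f h - f 0.\<close>
    have q: "(\<lambda>j. (J (x + t i * e j) - J x) / e j) \<longlonglongrightarrow> f x * t i" if i: "i < N" and x: "x \<in> {0..h}" for i x
    proof -
      have "t i * s \<le> 1 * s" "0 \<le> t i * s" if "0 \<le> s" for s
        using t[OF i] that by (intro mult_right_mono mult_nonneg_nonneg; simp)+
      then have "((\<lambda>s. J (x + t i * s)) has_real_derivative f x * t i) (at 0 within {0..1 - h})"
        using x h J[of x] by (intro DERIV_affine_within[of J "f x" x "t i" 0 "{0..1}"]) force+
      then have "((\<lambda>s. (J (x + t i * s) - J x) / s) \<longlongrightarrow> f x * t i) (at 0 within {0..1 - h})"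
        by (simp add: has_field_derivative_iff)
      moreover have "filterlim e (at 0 within {0..1 - h}) sequentially"
        unfolding filterlim_at using elim e0 less_imp_neq[OF e0(1)]
        by (intro conjI always_eventually allI) (auto simp: less_imp_le)
      ultimately show ?thesis by (rule filterlim_compose)
    qed
    have "(\<lambda>j. (\<Sum>i<N. c i * ((J (h + t i * e j) - J h) / e j - (J (0 + t i * e j) - J 0) / e j)))
        \<longlonglongrightarrow> (\<Sum>i<N. c i * (f h * t i - f 0 * t i))"
      using h by (intro tendsto_sum tendsto_mult_left tendsto_diff q) auto
    moreover have "(\<Sum>i<N. c i * (f h * t i - f 0 * t i)) = (\<Sum>i<N. c i * t i) * (f h - f 0)"
      unfolding sum_distrib_right by (intro sum.cong) (auto simp: algebra_simps)
    moreover have "(\<Sum>i<N. c i * ((J (h + t i * e j) - J h) / e j - (J (0 + t i * e j) - J 0) / e j))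
        = (\<Sum>i<N. c i * (J (h + t i * e j) - J (t i * e j))) / e j" for j
    proof -
      have "(\<Sum>i<N. c i * ((J (h + t i * e j) - J h) / e j - (J (0 + t i * e j) - J 0) / e j))
        = (\<Sum>i<N. c i * (J (h + t i * e j) - J (t i * e j)) / e j - c i * ((J h - J 0) / e j))"
        by (intro sum.cong) (auto simp: algebra_simps diff_divide_distrib add_divide_distrib)
      also have "\<dots> = (\<Sum>i<N. c i * (J (h + t i * e j) - J (t i * e j))) / e j - (\<Sum>i<N. c i) * ((J h - J 0) / e j)"
        by (simp add: sum_subtractf sum_divide_distrib sum_distrib_right)
      finally show ?thesis using mom by simp
    qed
    ultimately have "(\<lambda>j. (\<Sum>i<N. c i * (J (h + t i * e j) - J (t i * e j))) / e j) \<longlonglongrightarrow> f h - f 0"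
      using mom by simp
    from LIMSEQ_unique[OF this A] show ?thesis .
  qed
  \<comment> \<open>At h = 1 there is no room for a forward step; continuity of both sides carries
    the identity there.\<close>
  define u where "u j = 1 - inverse (real (Suc j))" for j
  have u: "0 \<le> u j" "u j < 1" for j by (auto simp: u_def field_simps)
  have "u \<longlonglongrightarrow> 1 - 0" unfolding u_def by (intro tendsto_intros LIMSEQ_inverse_real_of_nat)
  then have ul: "u \<longlonglongrightarrow> 1" by simp
  have uc: "(\<lambda>j. g (u j)) \<longlonglongrightarrow> g 1" if "continuous_on {0..1} g" for g :: "real \<Rightarrow> real"
    using continuous_on_tendsto_compose[OF that ul] u by (auto intro!: always_eventually less_imp_le)
  have "(\<lambda>j. f (u j) - f 0) \<longlonglongrightarrow> f 1 - f 0" by (intro tendsto_diff uc f tendsto_const)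
  moreover have "(\<lambda>j. integral {0..u j} \<gamma>) \<longlonglongrightarrow> integral {0..1} \<gamma>"
    by (intro uc indefinite_integral_continuous_1 integrable_continuous_real \<gamma>)
  ultimately show ?thesis using main[OF u] LIMSEQ_unique by simp
qed

section \<open>Taylor expansion along segments\<close>

abbreviation norm_prod :: "'a::real_normed_vector list \<Rightarrow> real" where
  "norm_prod ys \<equiv> prod_list (map norm ys)"

lemma norm_prod_nonneg: "0 \<le> norm_prod ys"
  by (induction ys) auto

text \<open>For finitely supported measures the pairings are finite sums, so the dependence of the
  Taylor coefficients on the spatial arguments is irrelevant.\<close>

lemma taylor_segment:
  fixes \<Phi> :: "nat \<Rightarrow> 'a::euclidean_space measure \<Rightarrow> 'a list \<Rightarrow> real"
  assumes "\<And>j. j < n \<Longrightarrow> lin_fun_deriv_step (k + j) (\<Phi> j) (\<Phi> (Suc j))"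
    and "\<And>m ws. m \<in> P2 \<Longrightarrow> length ws = k + n \<Longrightarrow> \<bar>\<Phi> n m ws\<bar> \<le> K * norm_prod ws"
    and sup: "supported_on A m" "supported_on A m'" and "length zs = k" and h: "h \<in> {0..1}" and K: "K \<ge> 0"
  defines "L \<equiv> \<Sum>a\<in>A. \<bar>measure m' {a} - measure m {a}\<bar> * norm a"
  shows "\<exists>a. (n \<ge> 1 \<longrightarrow> a 0 = \<Phi> 0 (mixture h m m') zs) \<and> (n \<ge> 2 \<longrightarrow> a 1 = slope (\<Phi> 1) zs m m' h) \<and>
    (\<forall>x. 0 \<le> x \<longrightarrow> h + x \<le> 1 \<longrightarrow>
      \<bar>\<Phi> 0 (mixture (h + x) m m') zs - (\<Sum>j<n. a j * x ^ j)\<bar> \<le> K * norm_prod zs * L ^ n * x ^ n)"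
  using assms(1,2,5)
proof (induction n arbitrary: k \<Phi> zs)
  case 0
  have "mixture (h + x) m m' \<in> P2" if "0 \<le> x" "h + x \<le> 1" for x
    using that h sup by (auto simp: supported_on_def)
  then show ?case using 0 by simp
next
  case (Suc n)
  have mP: "m \<in> P2" "m' \<in> P2" using sup by (auto simp: supported_on_def)
  have L: "0 \<le> L" unfolding L_def by (intro sum_nonneg) auto
  let ?w = "\<lambda>a. measure m' {a} - measure m {a}"
  \<comment> \<open>The induction hypothesis is applied to the shifted chain that starts at
    \<open>\<Phi> 1\<close>, with the additional point \<open>y\<close> and the same top
    order.\<close>
  have "\<exists>a. (n \<ge> 1 \<longrightarrow> a 0 = \<Phi> 1 (mixture h m m') (zs @ [y])) \<and>
    (\<forall>x. 0 \<le> x \<longrightarrow> h + x \<le> 1 \<longrightarrow>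
      \<bar>\<Phi> 1 (mixture (h + x) m m') (zs @ [y]) - (\<Sum>j<n. a j * x ^ j)\<bar> \<le> K * norm_prod (zs @ [y]) * L ^ n * x ^ n)"
    for y
  proof -
    have "\<exists>a. (n \<ge> 1 \<longrightarrow> a 0 = \<Phi> (Suc 0) (mixture h m m') (zs @ [y])) \<and>
      (n \<ge> 2 \<longrightarrow> a 1 = slope (\<Phi> (Suc 1)) (zs @ [y]) m m' h) \<and>
      (\<forall>x. 0 \<le> x \<longrightarrow> h + x \<le> 1 \<longrightarrow> \<bar>\<Phi> (Suc 0) (mixture (h + x) m m') (zs @ [y]) - (\<Sum>j<n. a j * x ^ j)\<bar>
        \<le> K * norm_prod (zs @ [y]) * L ^ n * x ^ n)"
    proof (rule Suc.IH)
      show "lin_fun_deriv_step (Suc k + j) (\<Phi> (Suc j)) (\<Phi> (Suc (Suc j)))" if "j < n" for j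
        using Suc.prems(1)[of "Suc j"] that by simp
      show "\<bar>\<Phi> (Suc n) m ws\<bar> \<le> K * norm_prod ws" if "m \<in> P2" "length ws = Suc k + n" for m ws
        using Suc.prems(2)[of m ws] that by simp
      show "length (zs @ [y]) = Suc k" using Suc.prems(3) by simp
    qed
    then show ?thesis unfolding One_nat_def by (elim exE conjE) (intro exI conjI)
  qed
  then have "\<forall>y. \<exists>a. (n \<ge> 1 \<longrightarrow> a 0 = \<Phi> 1 (mixture h m m') (zs @ [y])) \<and>
    (\<forall>x. 0 \<le> x \<longrightarrow> h + x \<le> 1 \<longrightarrow>
      \<bar>\<Phi> 1 (mixture (h + x) m m') (zs @ [y]) - (\<Sum>j<n. a j * x ^ j)\<bar> \<le> K * norm_prod (zs @ [y]) * L ^ n * x ^ n)"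
    by (rule allI)
  from choice[OF this] obtain a where a0: "\<forall>y. (n \<ge> 1 \<longrightarrow> a y 0 = \<Phi> 1 (mixture h m m') (zs @ [y])) \<and>
    (\<forall>x. 0 \<le> x \<longrightarrow> h + x \<le> 1 \<longrightarrow>
      \<bar>\<Phi> 1 (mixture (h + x) m m') (zs @ [y]) - (\<Sum>j<n. a y j * x ^ j)\<bar> \<le> K * norm_prod (zs @ [y]) * L ^ n * x ^ n)"
    by (rule exE)
  have a: "n \<ge> 1 \<Longrightarrow> a y 0 = \<Phi> 1 (mixture h m m') (zs @ [y])"
    "0 \<le> x \<Longrightarrow> h + x \<le> 1 \<Longrightarrow>
      \<bar>\<Phi> 1 (mixture (h + x) m m') (zs @ [y]) - (\<Sum>j<n. a y j * x ^ j)\<bar> \<le> K * norm_prod (zs @ [y]) * L ^ n * x ^ n"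
    for y x
    using a0[rule_format, of y] by blast+
  have step: "lin_fun_deriv_step k (\<Phi> 0) (\<Phi> 1)" using Suc.prems(1)[of 0] by simp
  note S = lin_fun_deriv_stepD[OF step]
  \<comment> \<open>Termwise integration: the derivative of \<open>\<Phi> 0\<close> along the
    segment is the weighted sum of \<open>\<Phi> 1\<close> over \<open>A\<close>, expanded with the
    coefficients \<open>a y i\<close>.\<close>
  define b where "b j = (case j of 0 \<Rightarrow> \<Phi> 0 (mixture h m m') zs | Suc i \<Rightarrow> (\<Sum>y\<in>A. ?w y * a y i) / real (Suc i))" for j
  have sl: "slope (\<Phi> 1) zs m m' s = (\<Sum>y\<in>A. ?w y * \<Phi> 1 (mixture s m m') (zs @ [y]))" if "s \<in> {0..1}" for s
    by (rule slope_supported_on[OF sup S(1) Suc.prems(3) that])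
  define f where "f x = \<Phi> 0 (mixture (h + x) m m') zs - (\<Sum>j<Suc n. b j * x ^ j)" for x
  define f' where "f' x = slope (\<Phi> 1) zs m m' (h + x) - (\<Sum>j<n. (\<Sum>y\<in>A. ?w y * a y j) * x ^ j)" for x
  have der: "(f has_real_derivative f' x) (at x within {0..1 - h})" if x: "x \<in> {0..1 - h}" for x
  proof -
    have "((\<lambda>x. \<Phi> 0 (mixture (h + 1 * x) m m') zs) has_real_derivative slope (\<Phi> 1) zs m m' (h + 1 * x) * 1) (at x within {0..1 - h})"
      by (rule DERIV_affine_within[OF lin_fun_deriv_step_has_derivative[OF step mP Suc.prems(3)]])
        (use x h in auto)
    then have 1: "((\<lambda>x. \<Phi> 0 (mixture (h + x) m m') zs) has_real_derivative slope (\<Phi> 1) zs m m' (h + x)) (at x within {0..1 - h})"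
      by simp
    have 2: "((\<lambda>x. b (Suc j) * x ^ Suc j) has_real_derivative (\<Sum>y\<in>A. ?w y * a y j) * x ^ j) (at x within {0..1 - h})" for j
    proof -
      have "((\<lambda>x. b (Suc j) * x ^ Suc j) has_real_derivative b (Suc j) * (real (Suc j) * x ^ j)) (at x within {0..1 - h})"
        by (auto intro!: derivative_eq_intros simp del: power_Suc)
      then show ?thesis by (simp add: b_def del: power_Suc of_nat_Suc)
    qed
    have "((\<lambda>x. \<Phi> 0 (mixture (h + x) m m') zs - (b 0 + (\<Sum>j<n. b (Suc j) * x ^ Suc j))) has_real_derivative
        slope (\<Phi> 1) zs m m' (h + x) - (0 + (\<Sum>j<n. (\<Sum>y\<in>A. ?w y * a y j) * x ^ j))) (at x within {0..1 - h})"
      by (intro DERIV_diff DERIV_add DERIV_const DERIV_sum 1 2)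
    then show ?thesis unfolding f_def f'_def sum.lessThan_Suc_shift by simp
  qed
  have f'_bd: "\<bar>f' x\<bar> \<le> K * norm_prod zs * L ^ Suc n * x ^ n" if x: "x \<in> {0..1 - h}" for x
  proof -
    have "f' x = (\<Sum>y\<in>A. ?w y * (\<Phi> 1 (mixture (h + x) m m') (zs @ [y]) - (\<Sum>j<n. a y j * x ^ j)))"
      unfolding f'_def using x h
      by (subst sl) (auto simp: right_diff_distrib sum_subtractf sum_distrib_left sum_distrib_right mult.assoc
          intro: sum.swap)
    also have "\<bar>\<dots>\<bar> \<le> (\<Sum>y\<in>A. \<bar>?w y\<bar> * (K * norm_prod (zs @ [y]) * L ^ n * x ^ n))"
    proof (rule order_trans[OF sum_abs sum_mono])
      fix y
      show "\<bar>?w y * (\<Phi> 1 (mixture (h + x) m m') (zs @ [y]) - (\<Sum>j<n. a y j * x ^ j))\<bar>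
          \<le> \<bar>?w y\<bar> * (K * norm_prod (zs @ [y]) * L ^ n * x ^ n)"
        unfolding abs_mult using x by (intro mult_left_mono a(2)) auto
    qed
    \<comment> \<open>\<open>norm_prod (zs @ [y])\<close> contributes |y|, which summed against the
      weights yields one more factor \<open>L\<close>.\<close>
    also have "\<dots> = K * norm_prod zs * L ^ Suc n * x ^ n"
      by (simp add: L_def sum_distrib_left sum_distrib_right mult_ac)
    finally show ?thesis .
  qed
  have KL: "0 \<le> K * norm_prod zs * L ^ Suc n" using K norm_prod_nonneg[of zs] L by simp
  show ?case
  proof (intro exI[of _ b] conjI impI allI)
    show "b 0 = \<Phi> 0 (mixture h m m') zs" by (simp add: b_def)
    assume "2 \<le> Suc n"
    then have "b 1 = (\<Sum>y\<in>A. ?w y * \<Phi> 1 (mixture h m m') (zs @ [y]))" using a(1) by (simp add: b_def)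
    then show "b 1 = slope (\<Phi> 1) zs m m' h" using sl[OF h] by simp
  next
    fix x assume x: "0 \<le> x" "h + x \<le> 1"
    \<comment> \<open>The mean value inequality is enough here; it forgoes the factor 1/n! of the
      classical remainder.\<close>
    have "norm (f x - f 0) \<le> (K * norm_prod zs * L ^ Suc n * x ^ n) * norm (x - 0)"
    proof (rule field_differentiable_bound)
      show "(f has_field_derivative f' s) (at s within {0..x})" if "s \<in> {0..x}" for s
        using der[of s] that x by (auto intro: DERIV_subset)
      show "norm (f' s) \<le> K * norm_prod zs * L ^ Suc n * x ^ n" if s: "s \<in> {0..x}" for s
      proof -
        have "norm (f' s) \<le> K * norm_prod zs * L ^ Suc n * s ^ n" using f'_bd[of s] s x by auto
        also have "\<dots> \<le> K * norm_prod zs * L ^ Suc n * x ^ n"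
          using s by (intro mult_left_mono power_mono KL) auto
        finally show ?thesis .
      qed
    qed (use x in auto)
    moreover have "f 0 = 0" unfolding f_def sum.lessThan_Suc_shift by (simp add: b_def)
    ultimately show "\<bar>\<Phi> 0 (mixture (h + x) m m') zs - (\<Sum>j<Suc n. b j * x ^ j)\<bar> \<le>
        K * norm_prod zs * L ^ Suc n * x ^ Suc n"
      using x by (simp add: f_def mult_ac)
  qed
qed

section \<open>First moments\<close>

definition first_moment :: "'a::euclidean_space measure \<Rightarrow> real" where
  "first_moment m = (LINT x|m. norm x)"

lemma first_moment_nonneg: "0 \<le> first_moment m"
  by (simp add: first_moment_def)

lemma first_moment_return [simp]: "first_moment (return borel z) = norm z"
  by (simp add: first_moment_def)

lemma le_one_plus_square: "x \<le> 1 + (x::real)\<^sup>2"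
  using zero_le_power2[of "x - 1"] zero_le_power2[of x]
  by (cases "x \<ge> 0") (simp_all add: power2_diff add_increasing2)

lemma integrable_norm_P2:
  assumes "m \<in> P2"
  shows "integrable m norm"
proof -
  note P = P2D[OF assms]
  interpret prob_space m by (rule P)
  show ?thesis
  proof (rule Bochner_Integration.integrable_bound)
    show "integrable m (\<lambda>x. 1 + (norm x)\<^sup>2)" using P(4) by simp
    show "norm \<in> borel_measurable m" unfolding measurable_borel_cong[OF P(2)] by simp
    show "AE x in m. norm (norm x) \<le> norm (1 + (norm x)\<^sup>2)"
      using le_one_plus_square by simp
  qed
qed

lemma first_moment_le:
  assumes "m \<in> P2"
  shows "first_moment m \<le> 1 + second_moment m"
proof -
  note P = P2D[OF assms]
  interpret prob_space m by (rule P)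
  have "first_moment m \<le> (LINT x|m. 1 + (norm x)\<^sup>2)"
    unfolding first_moment_def
  proof (rule integral_mono[OF integrable_norm_P2[OF assms]])
    show "integrable m (\<lambda>x. 1 + (norm x)\<^sup>2)" using P(4) by simp
    show "norm x \<le> 1 + (norm x)\<^sup>2" for x :: 'a by (rule le_one_plus_square)
  qed
  then show ?thesis using P(4) by (simp add: second_moment_def prob_space)
qed

text \<open>The weights depend on \<open>A\<close>, first moments do not; estimates in terms of the
  latter survive the passage to general measures.\<close>

lemma supported_on_weights_le:
  assumes "supported_on A m" "supported_on A m'"
  shows "(\<Sum>a\<in>A. \<bar>measure m' {a} - measure m {a}\<bar> * norm a) \<le> first_moment m' + first_moment m"
proof -
  have "(\<Sum>a\<in>A. \<bar>measure m' {a} - measure m {a}\<bar> * norm a)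
      \<le> (\<Sum>a\<in>A. measure m' {a} * norm a + measure m {a} * norm a)"
  proof (rule sum_mono)
    fix a
    have "\<bar>measure m' {a} - measure m {a}\<bar> \<le> measure m' {a} + measure m {a}"
      using measure_nonneg[of m "{a}"] measure_nonneg[of m' "{a}"] by linarith
    from mult_right_mono[OF this norm_ge_zero[of a]]
    show "\<bar>measure m' {a} - measure m {a}\<bar> * norm a \<le> measure m' {a} * norm a + measure m {a} * norm a"
      by (simp add: distrib_right)
  qed
  also have "\<dots> = first_moment m' + first_moment m"
    by (simp add: first_moment_def integral_supported_on[OF assms(1)] integral_supported_on[OF assms(2)] sum.distrib)
  finally show ?thesis .
qed

text \<open>Continuity of \<open>G\<close> is not among the assumptions: at order 0 it is a
  component of an L-derivative at a fixed point. The derivative \<open>F\<close> supplies what is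
  needed, because the slope from \<open>m\<close> to its push-forward, written as integrals over
  \<open>m\<close>, tends to 0 boundedly.\<close>

lemma lin_fun_deriv_step_tendsto_distr:
  fixes h :: "nat \<Rightarrow> 'a::euclidean_space \<Rightarrow> 'a"
  assumes st: "lin_fun_deriv_step k G F" and m: "m \<in> P2" and ys: "length ys = k"
    and h: "\<And>j. h j \<in> borel_measurable borel" "\<And>j x. norm (h j x) \<le> 2 * norm x" "\<And>x. (\<lambda>j. h j x) \<longlonglongrightarrow> x"
  shows "(\<lambda>j. G (distr m borel (h j)) ys) \<longlonglongrightarrow> G m ys"
proof -
  note S = lin_fun_deriv_stepD[OF st]
  note P = P2D[OF m]
  define M where "M j = distr m borel (h j)" for j
  have c: "converges_P2 M m" unfolding M_def by (intro converges_P2_distr m h)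
  then have MP: "M j \<in> P2" for j by (auto simp: converges_P2_def)
  obtain R where R: "\<And>j. second_moment (M j) \<le> R" "second_moment m \<le> R"
    using converges_P2_bounded[OF c] by blast
  obtain C where C: "C \<ge> 0" "\<And>m n. m \<in> P2 \<Longrightarrow> second_moment m \<le> R + R \<Longrightarrow> n \<in> P2 \<Longrightarrow>
    \<bar>LINT y|n. F m (ys @ [y])\<bar> \<le> C * (1 + second_moment n)"
    using integral_slice_bound[OF S(1,2) ys, of "R + R"] by blast
  have mP: "mixture s m (M j) \<in> P2" if "s \<in> {0..1}" for s j using that MP m by auto
  have "(\<lambda>j. integral {0..1} (slope F ys m (M j))) \<longlonglongrightarrow> integral {0..1} (\<lambda>_ :: real. 0 :: real)"
  proof (rule dominated_convergence(2))
    show "slope F ys m (M j) integrable_on {0..1}" for j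
      by (intro integrable_continuous_real slope_continuous[OF S(1,2) m MP ys])
    show "(\<lambda>_. C * (1 + R) + C * (1 + R)) integrable_on {0..1::real}"
      by (intro integrable_const_ivl)
    fix s :: real assume s: "s \<in> {0..1}"
    show "norm (slope F ys m (M j) s) \<le> C * (1 + R) + C * (1 + R)" for j
    proof -
      have "second_moment (mixture s m (M j)) \<le> R + R"
        using second_moment_mixture_le[OF m MP[of j], of s] s R(1)[of j] R(2) by auto
      note C' = C(2)[OF mP[OF s] this]
      have "C * (1 + second_moment (M j)) \<le> C * (1 + R)" "C * (1 + second_moment m) \<le> C * (1 + R)"
        using R(1)[of j] R(2) C(1) by (auto intro: mult_left_mono)
      then show ?thesis using C'[OF MP[of j]] C'[OF m] unfolding slope_def real_norm_def by linarith
    qed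
    have "converges_P2 (\<lambda>j. mixture s m (M j)) (mixture s m m)"
      using s by (intro converges_P2_mixture c converges_P2_const m) auto
    then have cm: "converges_P2 (\<lambda>j. mixture s m (M j)) m" using s P by simp
    have "(LINT y|M j. F (mixture s m (M j)) (ys @ [y])) = (LINT y|m. F (mixture s m (M j)) (ys @ [h j y]))" for j
    proof -
      have "h j \<in> borel_measurable m" unfolding measurable_borel_cong[OF P(2)] by (rule h)
      from integral_distr[OF this slice_borel[OF S(1) mP[OF s, of j] ys]]
      show ?thesis by (simp add: M_def)
    qed
    then have "slope F ys m (M j) s
        = (LINT y|m. F (mixture s m (M j)) (ys @ [h j y])) - (LINT y|m. F (mixture s m (M j)) (ys @ [y]))" for j
      by (simp add: slope_def)
    moreover have "(\<lambda>j. (LINT y|m. F (mixture s m (M j)) (ys @ [h j y])) - (LINT y|m. F (mixture s m (M j)) (ys @ [y])))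
        \<longlonglongrightarrow> (LINT y|m. F m (ys @ [y])) - (LINT y|m. F m (ys @ [y]))"
      using integral_slice_tendsto[OF S(1,2) cm m ys h]
        integral_slice_tendsto[OF S(1,2) cm m ys, of "\<lambda>_ x. x"] by (intro tendsto_diff) auto
    ultimately show "(\<lambda>j. slope F ys m (M j) s) \<longlonglongrightarrow> 0" by simp
  qed
  then have "(\<lambda>j. (G (M j) ys - G m ys) + G m ys) \<longlonglongrightarrow> 0 + G m ys"
    unfolding S(4)[OF m MP ys, symmetric] by (intro tendsto_add tendsto_const) simp
  then show ?thesis by (simp add: M_def)
qed

section \<open>Numerical differentiation along segments\<close>

text \<open>The rule along the segments towards the Dirac masses at \<open>z\<close> and at 0. In
  the difference the integral against \<open>m\<close> cancels, which leaves an approximation of the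
  derivative normalised at \<open>z = 0\<close>.\<close>

definition diff_quotient :: "nat \<Rightarrow> (nat \<Rightarrow> real) \<Rightarrow> (nat \<Rightarrow> real) \<Rightarrow>
    ('a::euclidean_space measure \<Rightarrow> 'a list \<Rightarrow> real) \<Rightarrow> real \<Rightarrow> 'a measure \<Rightarrow> 'a list \<Rightarrow> 'a \<Rightarrow> real" where
  "diff_quotient N c t G e m ys z =
    (\<Sum>i<N. c i * (G (mixture (t i * e) m (return borel z)) ys - G (mixture (t i * e) m (return borel 0)) ys)) / e"

text \<open>In the expansion of \<open>taylor_segment\<close> the coefficient of order 1 is the
  slope, which the rule extracts. Replacing the weights on \<open>A\<close> by first moments makes
  the bound independent of the support.\<close>

lemma numeric_segment:
  fixes \<Phi> :: "nat \<Rightarrow> 'a::euclidean_space measure \<Rightarrow> 'a list \<Rightarrow> real" and c t :: "nat \<Rightarrow> real"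
  assumes \<Phi>: "\<And>j. j < n \<Longrightarrow> lin_fun_deriv_step (k + j) (\<Phi> j) (\<Phi> (Suc j))"
    "\<And>m ws. m \<in> P2 \<Longrightarrow> length ws = k + n \<Longrightarrow> \<bar>\<Phi> n m ws\<bar> \<le> K * norm_prod ws" and K: "K \<ge> 0"
    and n: "n \<ge> 2" and t: "\<And>i. i < N \<Longrightarrow> 0 \<le> t i \<and> t i \<le> 1"
    and mom: "\<And>j. j < n \<Longrightarrow> (\<Sum>i<N. c i * t i ^ j) = (if j = 1 then 1 else 0)"
    and sup: "supported_on A m" "supported_on A m'" and zs: "length zs = k"
    and h: "0 \<le> h" "0 < e" "h + e \<le> 1"
  shows "\<bar>(\<Sum>i<N. c i * \<Phi> 0 (mixture (h + t i * e) m m') zs) / e - slope (\<Phi> 1) zs m m' h\<bar>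
    \<le> (\<Sum>i<N. \<bar>c i\<bar>) * (K * norm_prod zs * (first_moment m' + first_moment m) ^ n) * e ^ (n - 1)"
proof -
  define L where "L = (\<Sum>a\<in>A. \<bar>measure m' {a} - measure m {a}\<bar> * norm a)"
  have L: "0 \<le> L" "L \<le> first_moment m' + first_moment m"
    unfolding L_def by (auto intro!: sum_nonneg supported_on_weights_le sup)
  have h01: "h \<in> {0..1}" using h by auto
  have "\<exists>a. (n \<ge> 1 \<longrightarrow> a 0 = \<Phi> 0 (mixture h m m') zs) \<and> (n \<ge> 2 \<longrightarrow> a 1 = slope (\<Phi> 1) zs m m' h) \<and>
    (\<forall>x. 0 \<le> x \<longrightarrow> h + x \<le> 1 \<longrightarrow>
      \<bar>\<Phi> 0 (mixture (h + x) m m') zs - (\<Sum>j<n. a j * x ^ j)\<bar> \<le> K * norm_prod zs * L ^ n * x ^ n)"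
    unfolding L_def by (rule taylor_segment[OF \<Phi> sup zs h01 K])
  then obtain a where a: "a 1 = slope (\<Phi> 1) zs m m' h"
    and bd: "\<And>x. 0 \<le> x \<Longrightarrow> h + x \<le> 1 \<Longrightarrow>
      \<bar>\<Phi> 0 (mixture (h + x) m m') zs - (\<Sum>j<n. a j * x ^ j)\<bar> \<le> K * norm_prod zs * L ^ n * x ^ n"
    using n by blast
  have R: "0 \<le> K * norm_prod zs * L ^ n" using K L norm_prod_nonneg[of zs] by simp
  have bd': "\<bar>\<Phi> 0 (mixture (h + x) m m') zs - (\<Sum>j<n. a j * x ^ j)\<bar> \<le> K * norm_prod zs * L ^ n * x ^ n"
    if "0 \<le> x" "x \<le> e" for x
    using that h by (intro bd) auto
  have "\<bar>(\<Sum>i<N. c i * \<Phi> 0 (mixture (h + t i * e) m m') zs) / e - a 1\<bar>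
      \<le> (\<Sum>i<N. \<bar>c i\<bar>) * (K * norm_prod zs * L ^ n) * e ^ (n - 1)"
    by (rule numeric_differentiation_error[where v = "\<lambda>x. \<Phi> 0 (mixture (h + x) m m') zs" and n = n and a = a
      and e = e and R = "K * norm_prod zs * L ^ n" and c = c and t = t and N = N])
      (fact n t mom bd' h(2) R)+
  also have "\<dots> \<le> (\<Sum>i<N. \<bar>c i\<bar>) * (K * norm_prod zs * (first_moment m' + first_moment m) ^ n) * e ^ (n - 1)"
    using L K h norm_prod_nonneg[of zs]
    by (intro mult_right_mono mult_left_mono power_mono sum_nonneg mult_nonneg_nonneg) auto
  finally show ?thesis unfolding a .
qed

text \<open>For finitely supported measures this is the difference of two instances of
  \<open>numeric_segment\<close> at h = 0, hence the factor 2. In general \<open>m\<close> is pushed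
  by \<open>h j\<close>, and \<open>z\<close> with it, so that the Dirac masses involved live on
  \<open>range (h j)\<close>. The base 2 |z| + 1 + 4 \<open>second_moment m\<close> bounds the sum
  of the two first moments.\<close>

lemma diff_quotient_error:
  fixes \<Phi> :: "nat \<Rightarrow> 'a::euclidean_space measure \<Rightarrow> 'a list \<Rightarrow> real"
  assumes \<Phi>: "\<And>j. j < n \<Longrightarrow> lin_fun_deriv_step (k + j) (\<Phi> j) (\<Phi> (Suc j))"
    "\<And>m ws. m \<in> P2 \<Longrightarrow> length ws = k + n \<Longrightarrow> \<bar>\<Phi> n m ws\<bar> \<le> K * norm_prod ws" and K: "K \<ge> 0"
    and n: "n \<ge> 2" and t: "\<And>i. i < N \<Longrightarrow> 0 \<le> t i \<and> t i \<le> 1"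
    and mom: "\<And>j. j < n \<Longrightarrow> (\<Sum>i<N. c i * t i ^ j) = (if j = 1 then 1 else 0)"
    and m: "m \<in> P2" and zs: "length zs = k" and e: "0 < e" "e \<le> 1"
  shows "\<bar>diff_quotient N c t (\<Phi> 0) e m zs z - \<Phi> 1 m (zs @ [z])\<bar>
    \<le> 2 * (\<Sum>i<N. \<bar>c i\<bar>) * K * norm_prod zs * (2 * norm z + 1 + 4 * second_moment m) ^ n * e ^ (n - 1)"
    (is "_ \<le> ?B")
proof -
  note P = P2D[OF m]
  have st: "lin_fun_deriv_step k (\<Phi> 0) (\<Phi> 1)" using \<Phi>(1)[of 0] n by simp
  note S = lin_fun_deriv_stepD[OF st]
  obtain h :: "nat \<Rightarrow> 'a \<Rightarrow> 'a" where h: "\<And>j. h j \<in> borel_measurable borel" "\<And>j x. norm (h j x) \<le> 2 * norm x"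
    "\<And>x. (\<lambda>j. h j x) \<longlonglongrightarrow> x" and fin: "\<And>j. finite (range (h j))"
    using finite_approximation by blast
  define M where "M j = distr m borel (h j)" for j
  have c: "converges_P2 M m" unfolding M_def by (intro converges_P2_distr m h)
  then have MP: "M j \<in> P2" for j by (auto simp: converges_P2_def)
  have h0: "h j 0 = 0" for j using h(2)[of j 0] by simp
  have sup: "supported_on (range (h j)) (M j)" "supported_on (range (h j)) (return borel (h j y))" for j y
    using MP[of j] fin[of j] unfolding M_def
    by (intro supported_on_distr m h supported_on_return; simp)+
  have hm: "h j \<in> borel_measurable m" for j unfolding measurable_borel_cong[OF P(2)] by (rule h)
  have mM: "second_moment (M j) \<le> 4 * second_moment m" for j
  proof -
    have le: "(norm (h j x))\<^sup>2 \<le> 4 * (norm x)\<^sup>2" for x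
      using power_mono[OF h(2)[of j x], of 2] by (simp add: power_mult_distrib)
    have i: "integrable m (\<lambda>x. 4 * (norm x)\<^sup>2)" using P(4) by simp
    have "second_moment (M j) = (LINT x|m. (norm (h j x))\<^sup>2)"
      unfolding M_def second_moment_def by (rule integral_distr[OF hm]) simp
    also have "\<dots> \<le> (LINT x|m. 4 * (norm x)\<^sup>2)"
    proof (rule integral_mono[OF _ i le])
      have "(\<lambda>x. (norm (h j x))\<^sup>2) \<in> borel_measurable m"
        using measurable_compose[OF hm, of "\<lambda>x. (norm x)\<^sup>2" borel] by simp
      then show "integrable m (\<lambda>x. (norm (h j x))\<^sup>2)"
        using le by (intro Bochner_Integration.integrable_bound[OF i]) auto
    qed
    finally show ?thesis by (simp add: second_moment_def)
  qed
  let ?Cs = "\<Sum>i<N. \<bar>c i\<bar>"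
  have half: "\<bar>(\<Sum>i<N. c i * \<Phi> 0 (mixture (t i * e) (M j) (return borel (h j y))) zs) / e
      - slope (\<Phi> 1) zs (M j) (return borel (h j y)) 0\<bar>
      \<le> ?Cs * (K * norm_prod zs * (2 * norm z + 1 + 4 * second_moment m) ^ n) * e ^ (n - 1)"
    if y: "norm y \<le> norm z" for j y
  proof -
    have "\<bar>(\<Sum>i<N. c i * \<Phi> 0 (mixture (0 + t i * e) (M j) (return borel (h j y))) zs) / e
      - slope (\<Phi> 1) zs (M j) (return borel (h j y)) 0\<bar>
      \<le> ?Cs * (K * norm_prod zs * (first_moment (return borel (h j y)) + first_moment (M j)) ^ n) * e ^ (n - 1)"
      by (rule numeric_segment[OF \<Phi> K n t mom sup zs]) (use e in auto)
    also have "\<dots> \<le> ?Cs * (K * norm_prod zs * (2 * norm z + 1 + 4 * second_moment m) ^ n) * e ^ (n - 1)"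
      using first_moment_le[OF MP[of j]] mM[of j] h(2)[of j y] y K e norm_prod_nonneg[of zs] first_moment_nonneg[of "M j"]
      by (intro mult_right_mono mult_left_mono power_mono sum_nonneg mult_nonneg_nonneg) auto
    finally show ?thesis by simp
  qed
  have bj: "\<bar>diff_quotient N c t (\<Phi> 0) e (M j) zs (h j z) - \<Phi> 1 (M j) (zs @ [h j z])\<bar> \<le> ?B" for j
  proof -
    have "diff_quotient N c t (\<Phi> 0) e (M j) zs (h j z) - \<Phi> 1 (M j) (zs @ [h j z])
      = ((\<Sum>i<N. c i * \<Phi> 0 (mixture (t i * e) (M j) (return borel (h j z))) zs) / e
          - slope (\<Phi> 1) zs (M j) (return borel (h j z)) 0)
      - ((\<Sum>i<N. c i * \<Phi> 0 (mixture (t i * e) (M j) (return borel (h j 0))) zs) / e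
          - slope (\<Phi> 1) zs (M j) (return borel (h j 0)) 0)"
      using S(3)[OF MP[of j] zs] unfolding slope_return_0[OF S(1) MP zs] h0
      by (simp add: diff_quotient_def right_diff_distrib sum_subtractf diff_divide_distrib)
    then show ?thesis using half[of z j] half[of 0 j] by (simp add: mult_ac)
  qed
  \<comment> \<open>The approximating mixtures are push-forwards of the original mixtures, so
    \<open>lin_fun_deriv_step_tendsto_distr\<close> applies to them.\<close>
  have dm: "mixture s (M j) (return borel (h j y)) = distr (mixture s m (return borel y)) borel (h j)" for s j y
    unfolding M_def using P(2) by (subst distr_mixture) (auto simp: h distr_return)
  have te: "0 \<le> t i * e" "t i * e \<le> 1" if "i < N" for i
    using t[OF that] e by (auto intro: mult_le_one)
  have lim0: "(\<lambda>j. \<Phi> 0 (mixture (t i * e) (M j) (return borel (h j y))) zs)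
      \<longlonglongrightarrow> \<Phi> 0 (mixture (t i * e) m (return borel y)) zs" if "i < N" for i y
    unfolding dm using te[OF that] m by (intro lin_fun_deriv_step_tendsto_distr[OF st _ zs h]) auto
  have "(\<lambda>j. diff_quotient N c t (\<Phi> 0) e (M j) zs (h j z)) \<longlonglongrightarrow> diff_quotient N c t (\<Phi> 0) e m zs z"
    unfolding diff_quotient_def using e lim0[of _ z] lim0[of _ 0]
    by (intro tendsto_divide tendsto_sum tendsto_mult tendsto_const tendsto_diff) (auto simp: h0)
  moreover have "(\<lambda>j. \<Phi> 1 (M j) (zs @ [h j z])) \<longlonglongrightarrow> \<Phi> 1 m (zs @ [z])"
    using zs h(3) by (intro continuous_P2D[OF S(1) c] tendsto_nth_append1) auto
  ultimately have "(\<lambda>j. \<bar>diff_quotient N c t (\<Phi> 0) e (M j) zs (h j z) - \<Phi> 1 (M j) (zs @ [h j z])\<bar>)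
      \<longlonglongrightarrow> \<bar>diff_quotient N c t (\<Phi> 0) e m zs z - \<Phi> 1 m (zs @ [z])\<bar>"
    by (intro tendsto_rabs tendsto_diff)
  then show ?thesis by (rule LIMSEQ_le_const2) (use bj in auto)
qed

section \<open>Gradients\<close>

text \<open>A Frechet derivative written through its components on \<open>Basis\<close>, to match
  the components of the iterated L-derivative.\<close>

definition has_gradient :: "('a::euclidean_space \<Rightarrow> real) \<Rightarrow> ('a \<Rightarrow> real) \<Rightarrow> 'a \<Rightarrow> bool" where
  "has_gradient f g y \<longleftrightarrow> (f has_derivative (\<lambda>h. \<Sum>b\<in>Basis. (h \<bullet> b) * g b)) (at y)"

lemma has_gradient_diff:
  assumes "has_gradient f g y" "has_gradient f' g' y"
  shows "has_gradient (\<lambda>y. f y - f' y) (\<lambda>b. g b - g' b) y"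
  using has_derivative_diff[OF assms[unfolded has_gradient_def]]
  by (simp add: has_gradient_def right_diff_distrib sum_subtractf)

lemma has_gradient_cmult:
  assumes "has_gradient f g y"
  shows "has_gradient (\<lambda>y. c * f y) (\<lambda>b. c * g b) y"
  using has_derivative_mult_right[OF assms[unfolded has_gradient_def], of c]
  by (simp add: has_gradient_def sum_distrib_left mult_ac)

lemma has_gradient_divide:
  assumes "has_gradient f g y"
  shows "has_gradient (\<lambda>y. f y / c) (\<lambda>b. g b / c) y"
  using has_gradient_cmult[OF assms, of "inverse c"] by (simp add: divide_inverse mult.commute)

lemma has_gradient_sum:
  assumes "\<And>i. i \<in> I \<Longrightarrow> has_gradient (f i) (g i) y"
  shows "has_gradient (\<lambda>y. \<Sum>i\<in>I. f i y) (\<lambda>b. \<Sum>i\<in>I. g i b) y"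
proof -
  have "((\<lambda>y. \<Sum>i\<in>I. f i y) has_derivative (\<lambda>h. \<Sum>i\<in>I. \<Sum>b\<in>Basis. (h \<bullet> b) * g i b)) (at y)"
    using assms unfolding has_gradient_def by (rule has_derivative_sum)
  moreover have "(\<lambda>h. \<Sum>i\<in>I. \<Sum>b\<in>Basis. (h \<bullet> b) * g i b) = (\<lambda>h. \<Sum>b\<in>Basis. (h \<bullet> b) * (\<Sum>i\<in>I. g i b))"
    unfolding sum_distrib_left by (intro ext sum.swap)
  ultimately show ?thesis by (simp add: has_gradient_def)
qed

text \<open>Estimating each component separately costs the dimension; this is the source of its
  powers in the final constant.\<close>

lemma gradient_component_le:
  fixes h :: "'a::euclidean_space" and R :: real
  assumes "\<And>b. b \<in> Basis \<Longrightarrow> \<bar>g b\<bar> \<le> R"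
  shows "\<bar>\<Sum>b\<in>Basis. (h \<bullet> b) * g b\<bar> \<le> DIM('a) * R * norm h"
proof -
  have "\<bar>\<Sum>b\<in>Basis. (h \<bullet> b) * g b\<bar> \<le> (\<Sum>b\<in>(Basis::'a set). norm h * R)"
    by (intro order_trans[OF sum_abs sum_mono])
      (auto simp: abs_mult intro!: mult_mono Basis_le_norm assms)
  then show ?thesis by (simp add: mult_ac)
qed

lemma has_gradient_bound:
  fixes f :: "'a::euclidean_space \<Rightarrow> real" and R :: real
  assumes "\<And>y. has_gradient f (\<lambda>b. g b y) y" "\<And>b y. b \<in> Basis \<Longrightarrow> \<bar>g b y\<bar> \<le> R"
  shows "\<bar>f y - f x\<bar> \<le> DIM('a) * R * norm (y - x)"
proof -
  have "norm (f y - f x) \<le> (DIM('a) * R) * norm (y - x)"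
  proof (rule differentiable_bound[of UNIV])
    show "(f has_derivative (\<lambda>h. \<Sum>b\<in>Basis. (h \<bullet> b) * g b z)) (at z within UNIV)" for z
      using assms(1) by (simp add: has_gradient_def)
    show "onorm (\<lambda>h. \<Sum>b\<in>Basis. (h \<bullet> b) * g b z) \<le> DIM('a) * R" for z
    proof (rule onorm_le)
      show "norm (\<Sum>b\<in>Basis. (h \<bullet> b) * g b z) \<le> DIM('a) * R * norm h" for h
        using gradient_component_le[of "\<lambda>b. g b z" R h] assms(2) by simp
    qed
  qed auto
  then show ?thesis by simp
qed

lemma has_gradient_line_integral:
  fixes f :: "'a::euclidean_space \<Rightarrow> real"
  assumes "\<And>y. has_gradient f (\<lambda>b. g b y) y"
  shows "((\<lambda>\<tau>. \<Sum>b\<in>Basis. (y \<bullet> b) * g b (\<tau> *\<^sub>R y)) has_integral f y - f 0) {0..1}"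
proof -
  have "((\<lambda>\<tau>. \<Sum>b\<in>Basis. (y \<bullet> b) * g b (\<tau> *\<^sub>R y)) has_integral f (1 *\<^sub>R y) - f (0 *\<^sub>R y)) {0..1::real}"
  proof (rule fundamental_theorem_of_calculus)
    fix \<tau> :: real
    have "((\<lambda>\<tau>. \<tau> *\<^sub>R y) has_derivative (\<lambda>h. h *\<^sub>R y)) (at \<tau> within {0..1})"
      by (auto intro!: derivative_eq_intros)
    moreover have "(f has_derivative (\<lambda>h. \<Sum>b\<in>Basis. (h \<bullet> b) * g b (\<tau> *\<^sub>R y))) (at (\<tau> *\<^sub>R y))"
      using assms by (simp add: has_gradient_def)
    ultimately have "((\<lambda>\<tau>. f (\<tau> *\<^sub>R y)) has_derivative (\<lambda>h. \<Sum>b\<in>Basis. ((h *\<^sub>R y) \<bullet> b) * g b (\<tau> *\<^sub>R y))) (at \<tau> within {0..1})"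
      by (rule has_derivative_compose)
    then show "((\<lambda>\<tau>. f (\<tau> *\<^sub>R y)) has_vector_derivative (\<Sum>b\<in>Basis. (y \<bullet> b) * g b (\<tau> *\<^sub>R y))) (at \<tau> within {0..1})"
      by (simp add: has_vector_derivative_def sum_distrib_left mult_ac)
  qed auto
  then show ?thesis by simp
qed

lemma tendsto_norm_prod:
  assumes "\<And>j. length (Y j) = k" "length y = k" "\<And>i. i < k \<Longrightarrow> (\<lambda>j. Y j ! i) \<longlonglongrightarrow> y ! i"
  shows "(\<lambda>j. norm_prod (Y j)) \<longlonglongrightarrow> norm_prod y"
proof -
  have e: "norm_prod xs = (\<Prod>i<k. norm (xs ! i))" if "length xs = k" for xs :: "'a list"
    using that by (subst prod.list_conv_set_nth) (auto simp: atLeast0LessThan)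
  show ?thesis
    unfolding e[OF assms(1)] e[OF assms(2)] by (intro tendsto_prod tendsto_norm assms(3)) auto
qed

text \<open>Interchange of two limits: \<open>q e\<close> is within W e of \<open>f\<close>,
  uniformly in \<open>j\<close>, so convergence in \<open>j\<close> at each fixed \<open>e\<close>
  is inherited by \<open>f\<close>.\<close>

lemma tendsto_uniform_approximation:
  fixes f :: "nat \<Rightarrow> real"
  assumes "\<And>e. 0 < e \<Longrightarrow> e \<le> 1 \<Longrightarrow> (\<lambda>j. q e j) \<longlonglongrightarrow> q' e"
    and W: "\<And>e j. 0 < e \<Longrightarrow> e \<le> 1 \<Longrightarrow> \<bar>q e j - f j\<bar> \<le> W * e" "\<And>e. 0 < e \<Longrightarrow> e \<le> 1 \<Longrightarrow> \<bar>q' e - l\<bar> \<le> W * e"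
  shows "f \<longlonglongrightarrow> l"
proof (rule tendstoI)
  fix r :: real assume r: "r > 0"
  have W0: "0 \<le> W" using W(2)[of 1] by simp
  define e where "e = min 1 (r / (4 * (W + 1)))"
  have e: "0 < e" "e \<le> 1" using r W0 by (auto simp: e_def)
  have "W * e \<le> W * (r / (4 * (W + 1)))" using W0 by (intro mult_left_mono) (auto simp: e_def)
  also have "\<dots> \<le> r / 4" using W0 r by (simp add: field_simps)
  finally have We: "W * e \<le> r / 4" .
  have "r / 4 > 0" using r by simp
  from tendstoD[OF assms(1)[OF e] this] show "\<forall>\<^sub>F j in sequentially. dist (f j) l < r"
  proof eventually_elim
    case (elim j)
    then show ?case using W(1)[OF e, of j] W(2)[OF e] We unfolding dist_real_def by linarith
  qed
qed

lemma tendsto_bounded_above: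
  fixes f :: "nat \<Rightarrow> real"
  assumes "f \<longlonglongrightarrow> l"
  obtains B where "\<And>j. f j \<le> B"
proof -
  have "Bseq f" using assms convergentI convergent_imp_Bseq by blast
  then obtain B where "\<And>j. norm (f j) \<le> B" by (rule BseqE) blast
  then have "f j \<le> B" for j using abs_le_D1[of "f j" B] by simp
  then show thesis by (rule that)
qed

text \<open>The first point is the one in which the antiderivative is taken, the last one the point
  added by the new linear functional derivative.\<close>

lemma list_decompose:
  assumes "length ws = Suc (Suc k)"
  obtains y zs z where "ws = y # zs @ [z]" "length zs = k"
  using assms by (metis length_Suc_conv length_Suc_conv_rev)

lemma list_decompose_hd:
  assumes "length ws = Suc (Suc k)"
  shows "ws = hd ws # butlast (tl ws) @ [last ws]" "length (butlast (tl ws)) = k"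
proof -
  obtain y zs z where "ws = y # zs @ [z]" "length zs = k" using list_decompose[OF assms] by blast
  then show "ws = hd ws # butlast (tl ws) @ [last ws]" "length (butlast (tl ws)) = k" by simp_all
qed

section \<open>Antiderivatives in the first spatial argument\<close>

lemma norm_prod_le_growth: "norm_prod ys \<le> growth ys"
proof (induction ys)
  case (Cons y ys)
  then show ?case using le_one_plus_square[of "norm y"] norm_prod_nonneg[of ys] by (auto intro!: mult_mono)
qed simp

definition step_size :: "nat \<Rightarrow> real" where "step_size j = inverse (real (Suc j))"

lemma step_size: "0 < step_size j" "step_size j \<le> 1" "step_size \<longlonglongrightarrow> 0"
  unfolding step_size_def using LIMSEQ_inverse_real_of_nat by (auto simp: inverse_le_1_iff)

text \<open>\<open>G\<close> is the linear functional derivative of order \<open>k + 1\<close>, and \<open>\<Phi> b y j\<close> that of order \<open>k + j\<close> of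
  the \<open>b\<close>-component of the L-derivative at the fixed point \<open>y\<close>, so that \<open>n\<close> orders are missing.
  No regularity of \<open>\<Phi> b y\<close> in \<open>y\<close> is available.\<close>

locale antiderivative =
  fixes k n :: nat and K :: real
    and G :: "'a::euclidean_space measure \<Rightarrow> 'a list \<Rightarrow> real"
    and \<Phi> :: "'a \<Rightarrow> 'a \<Rightarrow> nat \<Rightarrow> 'a measure \<Rightarrow> 'a list \<Rightarrow> real"
  assumes continuous_G: "continuous_P2 (Suc k) G" and growth_G: "quadratic_growth_P2 (Suc k) G"
    and G_0: "\<And>m zs. m \<in> P2 \<Longrightarrow> length zs = k \<Longrightarrow> G m (0 # zs) = 0"
    and gradient_G: "\<And>m zs y. m \<in> P2 \<Longrightarrow> length zs = k \<Longrightarrow>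
      has_gradient (\<lambda>y. G m (y # zs)) (\<lambda>b. \<Phi> b y 0 m zs) y"
    and steps: "\<And>b y j. b \<in> Basis \<Longrightarrow> j < n \<Longrightarrow> lin_fun_deriv_step (k + j) (\<Phi> b y j) (\<Phi> b y (Suc j))"
    and bound: "\<And>b y m ws. b \<in> Basis \<Longrightarrow> m \<in> P2 \<Longrightarrow> length ws = k + n \<Longrightarrow> \<bar>\<Phi> b y n m ws\<bar> \<le> K * norm_prod ws"
    and K: "K \<ge> 0"
begin

lemma step_first: "n \<ge> 1 \<Longrightarrow> b \<in> Basis \<Longrightarrow> lin_fun_deriv_step k (\<Phi> b y 0) (\<Phi> b y 1)"
  using steps[of b 0 y] by simp

end

text \<open>At least two orders are missing. The rule is exact below degree \<open>n\<close>, and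
  since n \<ge> 2 its error vanishes as the step tends to 0, uniformly in \<open>y\<close>.\<close>

locale antiderivative_smooth = antiderivative k n K G \<Phi>
  for k n K and G :: "'a::euclidean_space measure \<Rightarrow> 'a list \<Rightarrow> real" and \<Phi> +
  fixes N :: nat and c t :: "nat \<Rightarrow> real"
  assumes n: "n \<ge> 2" and t: "\<And>i. i < N \<Longrightarrow> 0 \<le> t i \<and> t i \<le> 1"
    and moments: "\<And>j. j < n \<Longrightarrow> (\<Sum>i<N. c i * t i ^ j) = (if j = 1 then 1 else 0)"
begin

abbreviation "Cs \<equiv> \<Sum>i<N. \<bar>c i\<bar>"

lemma Cs: "0 \<le> Cs" by (intro sum_nonneg) auto

lemma te: "i < N \<Longrightarrow> 0 < e \<Longrightarrow> e \<le> 1 \<Longrightarrow> 0 \<le> t i * e \<and> t i * e \<le> 1"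
  using t[of i] by (auto intro: mult_le_one)

text \<open>Free of \<open>b\<close> and \<open>y\<close>: all uniformity in \<open>y\<close> rests
  on this.\<close>

definition error_bound :: "'a measure \<Rightarrow> 'a list \<Rightarrow> 'a \<Rightarrow> real" where
  "error_bound m zs z = 2 * Cs * K * norm_prod zs * (2 * norm z + 1 + 4 * second_moment m) ^ n"

lemma error_bound_nonneg: "0 \<le> error_bound m zs z"
  unfolding error_bound_def using Cs K norm_prod_nonneg[of zs] second_moment_nonneg[of m] by simp

lemma diff_quotient_\<Phi>_error:
  assumes "b \<in> Basis" "m \<in> P2" "length zs = k" "0 < e" "e \<le> 1"
  shows "\<bar>diff_quotient N c t (\<Phi> b y 0) e m zs z - \<Phi> b y 1 m (zs @ [z])\<bar> \<le> error_bound m zs z * e ^ (n - 1)"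
  unfolding error_bound_def
  by (rule diff_quotient_error[where k = k and \<Phi> = "\<Phi> b y"])
    (fact steps[OF assms(1)] bound[OF assms(1)] K n t moments assms(2-5))+

text \<open>The rule is applied to the antiderivative \<open>G\<close> itself; the gradient in
  \<open>y\<close> is then the rule applied to the components \<open>\<Phi> b y 0\<close>.\<close>

definition Q :: "real \<Rightarrow> 'a measure \<Rightarrow> 'a list \<Rightarrow> 'a \<Rightarrow> 'a \<Rightarrow> real" where
  "Q e m zs z y = diff_quotient N c t G e m (y # zs) z"

lemma Q_0: "m \<in> P2 \<Longrightarrow> length zs = k \<Longrightarrow> 0 < e \<Longrightarrow> e \<le> 1 \<Longrightarrow> Q e m zs z 0 = 0"
  unfolding Q_def diff_quotient_def using te
  by (auto simp: G_0 mixture_in_P2 intro!: sum.neutral)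

lemma gradient_Q:
  assumes "m \<in> P2" "length zs = k" "0 < e" "e \<le> 1"
  shows "has_gradient (Q e m zs z) (\<lambda>b. diff_quotient N c t (\<Phi> b y 0) e m zs z) y"
  unfolding Q_def diff_quotient_def using te[OF _ assms(3,4)] assms
  by (intro has_gradient_divide has_gradient_sum has_gradient_cmult has_gradient_diff gradient_G mixture_in_P2) auto

lemma step_size_power: "(\<lambda>j. step_size j ^ (n - 1)) \<longlonglongrightarrow> 0"
  using tendsto_power[OF step_size(3), of "n - 1"] n by (simp add: power_0_left)

text \<open>These functions vanish at y = 0 and their gradients converge uniformly in
  \<open>y\<close>; hence they converge, and the limit has the limiting gradient. Uniformity takes
  the place of regularity of \<open>\<Phi> b y 1\<close> in \<open>y\<close>.\<close>

lemma Q_converges: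
  assumes m: "m \<in> P2" "length zs = k"
  shows "\<exists>g. \<forall>y. (\<lambda>j. Q (step_size j) m zs z y) \<longlonglongrightarrow> g y \<and> has_gradient g (\<lambda>b. \<Phi> b y 1 m (zs @ [z])) y"
proof -
  have "\<exists>g. \<forall>y\<in>UNIV. (\<lambda>j. Q (step_size j) m zs z y) \<longlonglongrightarrow> g y \<and>
      (g has_derivative (\<lambda>h. \<Sum>b\<in>Basis. (h \<bullet> b) * \<Phi> b y 1 m (zs @ [z]))) (at y within UNIV)"
  proof (rule has_derivative_sequence)
    show "(Q (step_size j) m zs z has_derivative
        (\<lambda>h. \<Sum>b\<in>Basis. (h \<bullet> b) * diff_quotient N c t (\<Phi> b y 0) (step_size j) m zs z)) (at y within UNIV)" for j y
      using gradient_Q[OF m step_size(1,2)] by (simp add: has_gradient_def)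
    have "(\<lambda>j. DIM('a) * (error_bound m zs z * step_size j ^ (n - 1))) \<longlonglongrightarrow> DIM('a) * (error_bound m zs z * 0)"
      by (intro tendsto_intros step_size_power)
    then have lim: "(\<lambda>j. DIM('a) * (error_bound m zs z * step_size j ^ (n - 1))) \<longlonglongrightarrow> 0" by simp
    show "\<forall>\<^sub>F j in sequentially. \<forall>y\<in>UNIV. \<forall>h. norm ((\<Sum>b\<in>Basis. (h \<bullet> b) * diff_quotient N c t (\<Phi> b y 0) (step_size j) m zs z)
        - (\<Sum>b\<in>Basis. (h \<bullet> b) * \<Phi> b y 1 m (zs @ [z]))) \<le> e * norm h" if e: "e > 0" for e
      using order_tendstoD(2)[OF lim e]
    proof eventually_elim
      case (elim j)
      show ?case
      proof (intro ballI allI)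
        fix y h
        have "\<bar>\<Sum>b\<in>Basis. (h \<bullet> b) * (diff_quotient N c t (\<Phi> b y 0) (step_size j) m zs z - \<Phi> b y 1 m (zs @ [z]))\<bar>
            \<le> DIM('a) * (error_bound m zs z * step_size j ^ (n - 1)) * norm h"
          by (rule gradient_component_le) (intro diff_quotient_\<Phi>_error m step_size(1,2))
        also have "\<dots> \<le> e * norm h" using elim by (intro mult_right_mono) auto
        finally show "norm ((\<Sum>b\<in>Basis. (h \<bullet> b) * diff_quotient N c t (\<Phi> b y 0) (step_size j) m zs z)
          - (\<Sum>b\<in>Basis. (h \<bullet> b) * \<Phi> b y 1 m (zs @ [z]))) \<le> e * norm h"
          by (simp add: right_diff_distrib sum_subtractf)
      qed
    qed
    show "(\<lambda>j. Q (step_size j) m zs z 0) \<longlonglongrightarrow> 0" using Q_0[OF m step_size(1,2)] by simp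
  qed auto
  then show ?thesis by (simp add: has_gradient_def)
qed

definition F :: "'a measure \<Rightarrow> 'a list \<Rightarrow> 'a \<Rightarrow> 'a \<Rightarrow> real" where
  "F m zs z y = lim (\<lambda>j. Q (step_size j) m zs z y)"

lemma Q_tendsto_F:
  assumes "m \<in> P2" "length zs = k"
  shows "(\<lambda>j. Q (step_size j) m zs z y) \<longlonglongrightarrow> F m zs z y"
    "has_gradient (F m zs z) (\<lambda>b. \<Phi> b y 1 m (zs @ [z])) y"
proof -
  obtain g where g: "\<And>y. (\<lambda>j. Q (step_size j) m zs z y) \<longlonglongrightarrow> g y"
    "\<And>y. has_gradient g (\<lambda>b. \<Phi> b y 1 m (zs @ [z])) y"
    using Q_converges[OF assms, of z] by blast
  have "F m zs z = g" unfolding F_def using limI[OF g(1)] by (intro ext) simp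
  then show "(\<lambda>j. Q (step_size j) m zs z y) \<longlonglongrightarrow> F m zs z y"
    "has_gradient (F m zs z) (\<lambda>b. \<Phi> b y 1 m (zs @ [z])) y"
    using g by auto
qed

lemma F_0: "m \<in> P2 \<Longrightarrow> length zs = k \<Longrightarrow> F m zs z 0 = 0"
  using Q_tendsto_F(1)[of m zs z 0] Q_0[OF _ _ step_size(1,2)] by (simp add: LIMSEQ_const_iff)

lemma F_normalised: "F m zs 0 y = 0"
  unfolding F_def Q_def diff_quotient_def by (simp add: limI)

text \<open>The gradient of the difference is bounded by the error of the rule, and the difference
  vanishes at y = 0.\<close>

lemma Q_F_error:
  assumes m: "m \<in> P2" "length zs = k" and e: "0 < e" "e \<le> 1"
  shows "\<bar>Q e m zs z y - F m zs z y\<bar> \<le> DIM('a) * (error_bound m zs z * e ^ (n - 1)) * norm y"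
proof -
  have "\<bar>(Q e m zs z y - F m zs z y) - (Q e m zs z 0 - F m zs z 0)\<bar>
      \<le> DIM('a) * (error_bound m zs z * e ^ (n - 1)) * norm (y - 0)"
    by (rule has_gradient_bound[where f = "\<lambda>y. Q e m zs z y - F m zs z y" and g = "\<lambda>b y. diff_quotient N c t (\<Phi> b y 0) e m zs z - \<Phi> b y 1 m (zs @ [z])"])
      (intro has_gradient_diff gradient_Q Q_tendsto_F diff_quotient_\<Phi>_error assms; assumption)+
  then show ?thesis using F_0[OF m] Q_0[OF m e] by simp
qed

definition G' :: "'a measure \<Rightarrow> 'a list \<Rightarrow> real" where
  "G' m ws = F m (butlast (tl ws)) (last ws) (hd ws)"

lemma G'_eq: "G' m (y # zs @ [z]) = F m zs z y"
  by (simp add: G'_def butlast_append)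

lemma gradient_G': "m \<in> P2 \<Longrightarrow> length zs = k \<Longrightarrow>
    has_gradient (\<lambda>y. G' m (y # zs @ [z])) (\<lambda>b. \<Phi> b y 1 m (zs @ [z])) y"
  using Q_tendsto_F(2)[of m zs z y] by (simp add: G'_eq)

text \<open>For fixed \<open>e\<close> the quotient \<open>Q e\<close> inherits continuity from
  \<open>G\<close>. Its distance to \<open>F\<close> is at most a constant times \<open>e\<close>
  along a convergent sequence, so the two limits may be exchanged.\<close>

lemma continuous_G': "continuous_P2 (Suc (Suc k)) G'"
proof (rule continuous_P2I)
  fix M :: "nat \<Rightarrow> 'a measure" and m and Y :: "nat \<Rightarrow> 'a list" and ws
  assume M: "converges_P2 M m" and Y: "\<And>j. length (Y j) = Suc (Suc k)" "length ws = Suc (Suc k)"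
    and lim: "\<And>i. i < Suc (Suc k) \<Longrightarrow> (\<lambda>j. Y j ! i) \<longlonglongrightarrow> ws ! i"
  define y Z z where "y j = hd (Y j)" and "Z j = butlast (tl (Y j))" and "z j = last (Y j)" for j
  have Yj: "Y j = y j # Z j @ [z j]" "length (Z j) = k" for j
    unfolding y_def Z_def z_def by (rule list_decompose_hd[OF Y(1)])+
  obtain y0 Z0 z0 where ws: "ws = y0 # Z0 @ [z0]" "length Z0 = k" using list_decompose[OF Y(2)] by blast
  have yl: "y \<longlonglongrightarrow> y0" using lim[of 0] by (simp add: Yj ws)
  have Zl: "(\<lambda>j. Z j ! i) \<longlonglongrightarrow> Z0 ! i" if "i < k" for i
    using lim[of "Suc i"] that by (simp add: Yj ws nth_append)
  have zl: "z \<longlonglongrightarrow> z0" using lim[of "Suc k"] by (simp add: Yj ws nth_append)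
  have MP: "M j \<in> P2" "m \<in> P2" for j using M by (auto simp: converges_P2_def)
  obtain R where R: "\<And>j. second_moment (M j) \<le> R" "second_moment m \<le> R"
    using converges_P2_bounded[OF M] by blast
  define E where "E Z z y = DIM('a) * (2 * Cs * K * norm_prod Z * (2 * norm z + 1 + 4 * R) ^ n) * norm y" for Z :: "'a list" and z y :: 'a
  have E: "\<bar>Q e m' Z z y - F m' Z z y\<bar> \<le> E Z z y * e"
    if m': "m' \<in> P2" "second_moment m' \<le> R" and Z: "length Z = k" and e: "0 < e" "e \<le> 1" for m' Z z y e
  proof -
    have "error_bound m' Z z \<le> 2 * Cs * K * norm_prod Z * (2 * norm z + 1 + 4 * R) ^ n"
      unfolding error_bound_def using Cs K norm_prod_nonneg[of Z] m'(2) second_moment_nonneg[of m']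
      by (intro mult_left_mono power_mono) auto
    \<comment> \<open>As n \<ge> 2, the exponent n - 1 is at least 1, and the error is at most
      linear in \<open>e\<close>.\<close>
    moreover have "e ^ (n - 1) \<le> e" using power_decreasing[of 1 "n - 1" e] n e by simp
    moreover have "0 \<le> 2 * Cs * K * norm_prod Z * (2 * norm z + 1 + 4 * R) ^ n"
      using calculation(1) error_bound_nonneg[of m' Z z] by linarith
    ultimately have "error_bound m' Z z * e ^ (n - 1) \<le> (2 * Cs * K * norm_prod Z * (2 * norm z + 1 + 4 * R) ^ n) * e"
      using e by (intro mult_mono) auto
    then have "DIM('a) * (error_bound m' Z z * e ^ (n - 1)) * norm y
        \<le> DIM('a) * ((2 * Cs * K * norm_prod Z * (2 * norm z + 1 + 4 * R) ^ n) * e) * norm y"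
      by (intro mult_right_mono mult_left_mono) auto
    then show ?thesis using Q_F_error[OF m'(1) Z e, of z y] by (simp add: E_def mult_ac)
  qed
  have El: "(\<lambda>j. E (Z j) (z j) (y j)) \<longlonglongrightarrow> E Z0 z0 y0"
    unfolding E_def by (intro tendsto_intros tendsto_norm_prod[OF Yj(2) ws(2) Zl] zl yl)
  obtain W where W: "\<And>j. E (Z j) (z j) (y j) \<le> W"
    by (rule tendsto_bounded_above[OF El]) (rule that)
  have "(\<lambda>j. F (M j) (Z j) (z j) (y j)) \<longlonglongrightarrow> F m Z0 z0 y0"
  proof (rule tendsto_uniform_approximation)
    fix e :: real assume e: "0 < e" "e \<le> 1"
    have cm: "(\<lambda>j. G (mixture (t i * e) (M j) (return borel (v j))) (y j # Z j))
        \<longlonglongrightarrow> G (mixture (t i * e) m (return borel v0)) (y0 # Z0)" if "i < N" "v \<longlonglongrightarrow> v0" for i v v0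
    proof (rule continuous_P2D[OF continuous_G])
      show "converges_P2 (\<lambda>j. mixture (t i * e) (M j) (return borel (v j))) (mixture (t i * e) m (return borel v0))"
        using te[OF that(1) e] by (intro converges_P2_mixture M converges_P2_return that) auto
      show "(\<lambda>j. (y j # Z j) ! i') \<longlonglongrightarrow> (y0 # Z0) ! i'" if "i' < Suc k" for i'
        using that yl Zl by (cases i') auto
    qed (use Yj ws in auto)
    show "(\<lambda>j. Q e (M j) (Z j) (z j) (y j)) \<longlonglongrightarrow> Q e m Z0 z0 y0"
      unfolding Q_def diff_quotient_def using e
      by (intro tendsto_divide tendsto_sum tendsto_mult tendsto_const tendsto_diff cm zl) auto
    show "\<bar>Q e (M j) (Z j) (z j) (y j) - F (M j) (Z j) (z j) (y j)\<bar> \<le> max W (E Z0 z0 y0) * e" for j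
      by (rule order_trans[OF E[OF MP(1) R(1) Yj(2) e]], rule mult_right_mono)
        (use W[of j] e in auto)
    show "\<bar>Q e m Z0 z0 y0 - F m Z0 z0 y0\<bar> \<le> max W (E Z0 z0 y0) * e"
      by (rule order_trans[OF E[OF MP(2) R(2) ws(2) e]], rule mult_right_mono) (use e in auto)
  qed
  then show "(\<lambda>j. G' (M j) (Y j)) \<longlonglongrightarrow> G' m ws" by (simp add: Yj(1) ws(1) G'_eq)
qed

text \<open>The step size is \<open>1 / (1 + |z|\<^sup>2)\<close>, which keeps the second moments of the mixtures bounded;
  the error is still controlled, because \<open>n \<le> 2 (n - 1)\<close>.\<close>

lemma growth_G': "quadratic_growth_P2 (Suc (Suc k)) G'"
proof (rule quadratic_growth_P2I)
  fix R
  obtain C where C: "C \<ge> 0" "\<And>m ys. m \<in> P2 \<Longrightarrow> second_moment m \<le> R + 1 \<Longrightarrow> length ys = Suc k \<Longrightarrow>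
    \<bar>G m ys\<bar> \<le> C * growth ys" using quadratic_growth_P2D[OF growth_G, of "R + 1"] by blast
  \<comment> \<open>The first summand bounds \<open>Q e\<close>, where division by \<open>e\<close>
    produces the quadratic growth in \<open>z\<close>; the second bounds the distance from
    \<open>Q e\<close> to \<open>F\<close>.\<close>
  define B where "B = 2 * Cs * C + DIM('a) * (2 * Cs * K * ((3 + 4 * R) ^ n * 2 ^ (n - 1)))"
  have "\<bar>G' m ws\<bar> \<le> B * growth ws"
    if m: "m \<in> P2" "second_moment m \<le> R" and l: "length ws = Suc (Suc k)" for m ws
  proof -
    have R0: "0 \<le> R" using second_moment_nonneg[of m] m(2) by linarith
    obtain y zs z where ws: "ws = y # zs @ [z]" "length zs = k" using list_decompose[OF l] by blast
    define q where "q = 1 + (norm z)\<^sup>2"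
    have q: "q \<ge> 1" by (simp add: q_def)
    define e where "e = 1 / q"
    have e: "0 < e" "e \<le> 1" using q by (auto simp: e_def)
    have ez: "e * (norm z)\<^sup>2 \<le> 1" by (simp add: e_def q_def add_pos_nonneg divide_le_eq)
    have Gz: "\<bar>G (mixture (t i * e) m (return borel x)) (y # zs)\<bar> \<le> C * growth (y # zs)"
      if i: "i < N" and x: "e * (norm x)\<^sup>2 \<le> 1" for i x
    proof (rule C(2))
      have "t i * (e * (norm x)\<^sup>2) \<le> 1"
        by (rule mult_le_one) (use t[OF i] x e in \<open>simp_all del: mult_le_0_iff\<close>)
      moreover have "(1 - t i * e) * second_moment m \<le> 1 * R"
        using te[OF i e] m(2) second_moment_nonneg[of m] by (intro mult_mono) auto
      ultimately show "second_moment (mixture (t i * e) m (return borel x)) \<le> R + 1"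
        using te[OF i e] m(1) by (subst second_moment_mixture) (auto simp: mult.assoc)
    qed (use te[OF i e] m ws in auto)
    have "\<bar>Q e m zs z y\<bar> \<le> 2 * Cs * C * growth (y # zs) * q"
    proof -
      have "\<bar>\<Sum>i<N. c i * (G (mixture (t i * e) m (return borel z)) (y # zs) - G (mixture (t i * e) m (return borel 0)) (y # zs))\<bar>
          \<le> (\<Sum>i<N. \<bar>c i\<bar> * (2 * (C * growth (y # zs))))"
      proof (rule order_trans[OF sum_abs sum_mono])
        fix i assume "i \<in> {..<N}"
        then have "\<bar>G (mixture (t i * e) m (return borel z)) (y # zs) - G (mixture (t i * e) m (return borel 0)) (y # zs)\<bar>
            \<le> 2 * (C * growth (y # zs))"
          using Gz[of i z] Gz[of i 0] ez by simp
        then show "\<bar>c i * (G (mixture (t i * e) m (return borel z)) (y # zs) - G (mixture (t i * e) m (return borel 0)) (y # zs))\<bar>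
            \<le> \<bar>c i\<bar> * (2 * (C * growth (y # zs)))"
          unfolding abs_mult by (intro mult_left_mono) auto
      qed
      also have "\<dots> = 2 * Cs * C * growth (y # zs)" by (simp add: sum_distrib_right[symmetric])
      finally show ?thesis
        unfolding Q_def diff_quotient_def e_def using q by (simp add: abs_mult mult_right_mono)
    qed
    moreover have "DIM('a) * (error_bound m zs z * e ^ (n - 1)) * norm y
        \<le> DIM('a) * (2 * Cs * K * ((3 + 4 * R) ^ n * 2 ^ (n - 1))) * growth (y # zs) * q"
    proof -
      have p1: "(1 + norm z) ^ n \<le> 2 ^ (n - 1) * q ^ (n - 1)"
      proof -
        \<comment> \<open>Here n \<le> 2 (n - 1) enters; then (1 + |z|)^2 \<le> 2 q brings in the
          powers of \<open>q\<close> that \<open>e ^ (n - 1)\<close> cancels.\<close>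
        have "(1 + norm z) ^ n \<le> (1 + norm z) ^ (2 * (n - 1))" using n by (intro power_increasing) auto
        also have "\<dots> = ((1 + norm z)\<^sup>2) ^ (n - 1)" by (rule power_mult)
        also have "\<dots> \<le> (2 * q) ^ (n - 1)"
          using zero_le_power2[of "norm z - 1"] by (intro power_mono) (auto simp: q_def power2_sum power2_diff)
        finally show ?thesis by (simp add: power_mult_distrib)
      qed
      have "0 \<le> R * norm z" using R0 by simp
      moreover have "(3 + 4 * R) * (1 + norm z) = 3 + 3 * norm z + 4 * R + 4 * (R * norm z)"
        by (simp add: algebra_simps)
      ultimately have "2 * norm z + 1 + 4 * second_moment m \<le> (3 + 4 * R) * (1 + norm z)"
        using m(2) norm_ge_zero[of z] by linarith
      then have "(2 * norm z + 1 + 4 * second_moment m) ^ n \<le> ((3 + 4 * R) * (1 + norm z)) ^ n"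
        using second_moment_nonneg[of m] by (intro power_mono) auto
      also have "\<dots> \<le> (3 + 4 * R) ^ n * (2 ^ (n - 1) * q ^ (n - 1))"
        unfolding power_mult_distrib using R0 p1 by (intro mult_left_mono) auto
      finally have "(2 * norm z + 1 + 4 * second_moment m) ^ n * e ^ (n - 1)
          \<le> (3 + 4 * R) ^ n * (2 ^ (n - 1) * q ^ (n - 1)) * e ^ (n - 1)"
        using e by (intro mult_right_mono) auto
      also have "\<dots> = (3 + 4 * R) ^ n * 2 ^ (n - 1)"
        using q by (simp add: e_def power_divide)
      finally have p2: "(2 * norm z + 1 + 4 * second_moment m) ^ n * e ^ (n - 1) \<le> (3 + 4 * R) ^ n * 2 ^ (n - 1)" .
      have "norm_prod zs * norm y \<le> growth (y # zs)"
        using norm_prod_le_growth[of "y # zs"] by (simp add: mult.commute)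
      also have "\<dots> \<le> growth (y # zs) * q"
        using mult_left_mono[OF q, of "growth (y # zs)"] growth_pos[of "y # zs"] by simp
      finally have p3: "norm_prod zs * norm y \<le> growth (y # zs) * q" .
      have "((2 * norm z + 1 + 4 * second_moment m) ^ n * e ^ (n - 1)) * (norm_prod zs * norm y)
          \<le> ((3 + 4 * R) ^ n * 2 ^ (n - 1)) * (growth (y # zs) * q)"
        using R0 norm_prod_nonneg[of zs] by (intro mult_mono[OF p2 p3]) auto
      from mult_left_mono[OF this, of "DIM('a) * (2 * Cs * K)"] show ?thesis
        using Cs K by (simp add: error_bound_def mult_ac)
    qed
    ultimately have "\<bar>F m zs z y\<bar> \<le> B * (growth (y # zs) * q)"
      using Q_F_error[OF m(1) ws(2) e, of z y] by (simp add: B_def algebra_simps)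
    then show ?thesis by (simp add: ws(1) G'_eq q_def)
  qed
  then show "\<exists>C. \<forall>m\<in>P2. second_moment m \<le> R \<longrightarrow> (\<forall>ws. length ws = Suc (Suc k) \<longrightarrow> \<bar>G' m ws\<bar> \<le> C * growth ws)"
    by blast
qed

text \<open>Finite support turns the slope of \<open>G'\<close> into a finite sum, which can be
  differentiated in \<open>y\<close>. Each gradient component of the difference is then an instance
  of \<open>numeric_segment\<close>, and the difference vanishes at y = 0.\<close>

lemma segment_error:
  assumes sup: "supported_on A m" "supported_on A m'" and zs: "length zs = k"
    and h: "0 \<le> h" "0 < e" "h + e \<le> 1"
  shows "\<bar>(\<Sum>i<N. c i * G (mixture (h + t i * e) m m') (y # zs)) / e - slope G' (y # zs) m m' h\<bar>
    \<le> DIM('a) * (Cs * (K * norm_prod zs * (first_moment m' + first_moment m) ^ n) * e ^ (n - 1)) * norm y"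
proof -
  have mP: "m \<in> P2" "m' \<in> P2" using sup by (auto simp: supported_on_def)
  have hh: "h \<in> {0..1}" using h by auto
  have mh: "mixture h m m' \<in> P2" using hh mP by auto
  have mt: "mixture (h + t i * e) m m' \<in> P2" if "i < N" for i
  proof -
    have "0 \<le> t i * e" "t i * e \<le> 1 * e"
      using t[OF that] h by (intro mult_nonneg_nonneg mult_right_mono; simp)+
    then have "0 \<le> h + t i * e" "h + t i * e \<le> 1" using h by linarith+
    then show ?thesis by (intro mixture_in_P2 mP)
  qed
  let ?w = "\<lambda>a. measure m' {a} - measure m {a}"
  define d where "d y = (\<Sum>i<N. c i * G (mixture (h + t i * e) m m') (y # zs)) / e
    - (\<Sum>a\<in>A. ?w a * G' (mixture h m m') (y # zs @ [a]))" for y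
  have sl: "slope G' (y # zs) m m' h = (\<Sum>a\<in>A. ?w a * G' (mixture h m m') (y # zs @ [a]))" for y
    using slope_supported_on[OF sup continuous_G' _ hh, of "y # zs"] zs by simp
  have d0: "d 0 = 0"
    unfolding d_def G'_eq using zs mt mh by (simp add: G_0 F_0)
  have grad: "has_gradient d (\<lambda>b. (\<Sum>i<N. c i * \<Phi> b y 0 (mixture (h + t i * e) m m') zs) / e
    - (\<Sum>a\<in>A. ?w a * \<Phi> b y 1 (mixture h m m') (zs @ [a]))) y" for y
    unfolding d_def using mt mh zs
    by (intro has_gradient_diff has_gradient_divide has_gradient_sum has_gradient_cmult gradient_G gradient_G') auto
  have comp: "\<bar>(\<Sum>i<N. c i * \<Phi> b y 0 (mixture (h + t i * e) m m') zs) / e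
    - (\<Sum>a\<in>A. ?w a * \<Phi> b y 1 (mixture h m m') (zs @ [a]))\<bar>
    \<le> Cs * (K * norm_prod zs * (first_moment m' + first_moment m) ^ n) * e ^ (n - 1)" if b: "b \<in> Basis" for b y
  proof -
    have n1: "n \<ge> 1" using n by simp
    note S = lin_fun_deriv_stepD[OF step_first[OF n1 b]]
    have "\<bar>(\<Sum>i<N. c i * \<Phi> b y 0 (mixture (h + t i * e) m m') zs) / e - slope (\<Phi> b y 1) zs m m' h\<bar>
      \<le> Cs * (K * norm_prod zs * (first_moment m' + first_moment m) ^ n) * e ^ (n - 1)"
      by (rule numeric_segment[where k = k and \<Phi> = "\<Phi> b y"])
        (fact steps[OF b] bound[OF b] K n t moments sup zs h)+
    then show ?thesis unfolding slope_supported_on[OF sup S(1) zs hh] .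
  qed
  have "\<bar>d y - d 0\<bar> \<le> DIM('a) * (Cs * (K * norm_prod zs * (first_moment m' + first_moment m) ^ n) * e ^ (n - 1)) * norm (y - 0)"
    by (rule has_gradient_bound[OF grad comp])
  then show ?thesis unfolding sl d0 by (simp add: d_def)
qed

text \<open>By \<open>segment_error\<close>, the rule applied to \<open>G\<close> along a segment of
  finitely supported measures converges uniformly to the slope of \<open>G'\<close>;
  \<open>numeric_differentiation_integral\<close> integrates this back to increments of
  \<open>G\<close>.\<close>

lemma step_G': "lin_fun_deriv_step (Suc k) G G'"
proof (rule lin_fun_deriv_stepI[OF continuous_G continuous_G' growth_G'])
  fix m :: "'a measure" and ys :: "'a list" assume "length ys = Suc k"
  then obtain y zs where "ys = y # zs" by (cases ys) auto
  then show "G' m (ys @ [0]) = 0" by (simp add: G'_eq F_normalised)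
next
  fix A and m m' :: "'a measure" and ys :: "'a list"
  assume sup: "supported_on A m" "supported_on A m'" and l: "length ys = Suc k"
  then obtain y zs where ys: "ys = y # zs" "length zs = k" by (cases ys) auto
  have mP: "m \<in> P2" "m' \<in> P2" using sup by (auto simp: supported_on_def)
  define f where "f h = G (mixture h m m') ys" for h
  have \<gamma>: "continuous_on {0..1} (slope G' ys m m')"
    by (rule slope_continuous[OF continuous_G' growth_G' mP l])
  obtain B where "\<forall>x\<in>slope G' ys m m' ` {0..1}. norm x \<le> B"
    using compact_imp_bounded[OF compact_continuous_image[OF \<gamma> compact_Icc]] unfolding bounded_iff by blast
  then have B: "\<bar>slope G' ys m m' h\<bar> \<le> B" if "h \<in> {0..1}" for h using that by simp
  define W where "W = DIM('a) * (Cs * (K * norm_prod zs * (first_moment m' + first_moment m) ^ n)) * norm y"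
  have W0: "0 \<le> W"
    unfolding W_def using Cs K norm_prod_nonneg[of zs] first_moment_nonneg[of m] first_moment_nonneg[of m'] by simp
  have err: "\<bar>(\<Sum>i<N. c i * f (h + t i * e)) / e - slope G' ys m m' h\<bar> \<le> W * e ^ (n - 1)"
    if h: "0 \<le> h" "0 < e" "h + e \<le> 1" for h e
    using segment_error[OF sup ys(2) h, of y] unfolding f_def ys(1) W_def by (simp add: mult_ac)
  have "f 1 - f 0 = integral {0..1} (slope G' ys m m')"
  proof (rule numeric_differentiation_integral[OF _ \<gamma> t])
    show "continuous_on {0..1} f"
      unfolding continuous_on_sequentially o_def f_def using l
      by (intro allI ballI impI continuous_P2D[OF continuous_G] converges_P2_mixture_path mP) auto
    show "(\<Sum>i<N. c i) = 0" "(\<Sum>i<N. c i * t i) = 1" using moments[of 0] moments[of 1] n by simp_all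
    show "\<bar>(\<Sum>i<N. c i * f (h + t i * e)) / e\<bar> \<le> W + B" if h: "0 \<le> h" "0 < e" "h + e \<le> 1" for h e
    proof -
      have "W * e ^ (n - 1) \<le> W * 1" using h W0 by (intro mult_left_mono power_le_one) auto
      then show ?thesis using err[OF h] B[of h] h by auto
    qed
    show "(\<lambda>j. (\<Sum>i<N. c i * f (h + t i * e j)) / e j) \<longlonglongrightarrow> slope G' ys m m' h"
      if h: "0 \<le> h" and e: "\<And>j. 0 < e j" "\<And>j. h + e j \<le> 1" and elim: "e \<longlonglongrightarrow> 0" for h and e :: "nat \<Rightarrow> real"
    proof -
      have "(\<lambda>j. W * e j ^ (n - 1)) \<longlonglongrightarrow> W * 0 ^ (n - 1)" by (intro tendsto_intros elim)
      then have "(\<lambda>j. W * e j ^ (n - 1)) \<longlonglongrightarrow> 0" using n by (simp add: power_0_left)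
      then have "(\<lambda>j. (\<Sum>i<N. c i * f (h + t i * e j)) / e j - slope G' ys m m' h) \<longlonglongrightarrow> 0"
        by (rule Lim_null_comparison[rotated]) (use err[OF h e] in auto)
      then show ?thesis by (rule LIM_zero_cancel)
    qed
  qed
  then show "G m' ys - G m ys = integral {0..1} (slope G' ys m m')"
    unfolding f_def using P2D(2)[OF mP(1)] P2D(2)[OF mP(2)] by simp
qed

text \<open>One order is gained and one fewer is missing: \<open>G'\<close> with the shifted
  families is again in the initial situation, which drives the induction.\<close>

lemma antiderivative_G': "antiderivative (Suc k) (n - 1) K G' (\<lambda>b y j. \<Phi> b y (Suc j))"
proof
  show "continuous_P2 (Suc (Suc k)) G'" "quadratic_growth_P2 (Suc (Suc k)) G'"
    by (fact continuous_G' growth_G')+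
  fix m :: "'a measure" and zs' :: "'a list" and y :: 'a assume m: "m \<in> P2" and "length zs' = Suc k"
  then obtain zs z where zs: "zs' = zs @ [z]" "length zs = k" by (metis length_Suc_conv_rev)
  show "G' m (0 # zs') = 0" using F_0[OF m zs(2)] by (simp add: zs(1) G'_eq)
  show "has_gradient (\<lambda>y. G' m (y # zs')) (\<lambda>b. \<Phi> b y (Suc 0) m zs') y"
    using gradient_G'[OF m zs(2)] by (simp add: zs(1))
next
  fix b y :: 'a and j assume "b \<in> Basis" "j < n - 1"
  then show "lin_fun_deriv_step (Suc k + j) (\<Phi> b y (Suc j)) (\<Phi> b y (Suc (Suc j)))"
    using steps[of b "Suc j" y] by simp
next
  fix b y :: 'a and m :: "'a measure" and ws :: "'a list"
  assume "b \<in> Basis" "m \<in> P2" "length ws = Suc k + (n - 1)"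
  then show "\<bar>\<Phi> b y (Suc (n - 1)) m ws\<bar> \<le> K * norm_prod ws" using bound[of b m ws y] n by simp
qed (fact K)

end

section \<open>The top order\<close>

lemma slope_bound:
  assumes st: "lin_fun_deriv_step k V F" and K: "\<And>m ws. m \<in> P2 \<Longrightarrow> length ws = Suc k \<Longrightarrow> \<bar>F m ws\<bar> \<le> K * norm_prod ws"
    and m: "m \<in> P2" "m' \<in> P2" "length zs = k" and s: "s \<in> {0..1}"
  shows "\<bar>slope F zs m m' s\<bar> \<le> K * norm_prod zs * (first_moment m' + first_moment m)"
proof -
  note S = lin_fun_deriv_stepD[OF st]
  have mP: "mixture s m m' \<in> P2" using m s by auto
  have "\<bar>LINT y|n. F (mixture s m m') (zs @ [y])\<bar> \<le> K * norm_prod zs * first_moment n" if n: "n \<in> P2" for n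
  proof -
    have "\<bar>LINT y|n. F (mixture s m m') (zs @ [y])\<bar> \<le> (LINT y|n. \<bar>F (mixture s m m') (zs @ [y])\<bar>)"
      by (rule integral_abs_bound)
    also have "\<dots> \<le> (LINT y|n. K * norm_prod zs * norm y)"
    proof (rule integral_mono)
      show "integrable n (\<lambda>y. \<bar>F (mixture s m m') (zs @ [y])\<bar>)"
        by (intro integrable_abs slice_integrable[OF S(1,2) mP n m(3)])
      show "integrable n (\<lambda>y. K * norm_prod zs * norm y)"
        using integrable_norm_P2[OF n] by simp
      show "\<bar>F (mixture s m m') (zs @ [y])\<bar> \<le> K * norm_prod zs * norm y" for y
        using K[OF mP, of "zs @ [y]"] m(3) by (simp add: mult.assoc)
    qed
    finally show ?thesis by (simp add: first_moment_def)
  qed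
  from this[OF m(1)] this[OF m(2)] show ?thesis unfolding slope_def by (simp add: distrib_left)
qed

lemma segment_quotient_tendsto:
  assumes st: "lin_fun_deriv_step k V F" and m: "m \<in> P2" "m' \<in> P2" "length zs = k"
    and h: "0 \<le> h" and e: "\<And>j. 0 < e j" "\<And>j. h + e j \<le> 1" "e \<longlonglongrightarrow> 0"
  shows "(\<lambda>j. (V (mixture (h + e j) m m') zs - V (mixture h m m') zs) / e j) \<longlonglongrightarrow> slope F zs m m' h"
proof -
  have "h \<in> {0..1}" using h e(1,2)[of 0] by auto
  from lin_fun_deriv_step_has_derivative[OF st m this]
  have "((\<lambda>x. (V (mixture x m m') zs - V (mixture h m m') zs) / (x - h)) \<longlongrightarrow> slope F zs m m' h) (at h within {0..1})"
    by (simp add: has_field_derivative_iff)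
  moreover have "filterlim (\<lambda>j. h + e j) (at h within {0..1}) sequentially"
  proof -
    have "(\<lambda>j. h + e j) \<longlonglongrightarrow> h + 0" by (intro tendsto_intros e)
    moreover have "h + e j \<in> {0..1}" "h + e j \<noteq> h" for j using h e(1,2)[of j] by auto
    ultimately show ?thesis unfolding filterlim_at by (auto intro: always_eventually)
  qed
  ultimately have "(\<lambda>j. (V (mixture (h + e j) m m') zs - V (mixture h m m') zs) / (h + e j - h)) \<longlonglongrightarrow> slope F zs m m' h"
    by (rule filterlim_compose)
  then show ?thesis by simp
qed

lemma segment_quotient_bound:
  assumes st: "lin_fun_deriv_step k V F" and K: "\<And>m ws. m \<in> P2 \<Longrightarrow> length ws = Suc k \<Longrightarrow> \<bar>F m ws\<bar> \<le> K * norm_prod ws"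
    and m: "m \<in> P2" "m' \<in> P2" "length zs = k" and h: "0 \<le> h" "0 < e" "h + e \<le> 1"
  shows "\<bar>(V (mixture (h + e) m m') zs - V (mixture h m m') zs) / e\<bar> \<le> K * norm_prod zs * (first_moment m' + first_moment m)"
proof -
  have "norm (V (mixture (h + e) m m') zs - V (mixture h m m') zs)
      \<le> (K * norm_prod zs * (first_moment m' + first_moment m)) * norm (h + e - h)"
  proof (rule field_differentiable_bound[of "{0..1}"])
    show "((\<lambda>h. V (mixture h m m') zs) has_real_derivative slope F zs m m' s) (at s within {0..1})" if "s \<in> {0..1}" for s
      by (rule lin_fun_deriv_step_has_derivative[OF st m that])
    show "norm (slope F zs m m' s) \<le> K * norm_prod zs * (first_moment m' + first_moment m)" if "s \<in> {0..1}" for s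
      using slope_bound[OF st K m that] by simp
  qed (use h in auto)
  then show ?thesis using h by (simp add: divide_le_eq)
qed

text \<open>With one order missing, the error of a rule stays bounded without tending to 0. Plain
  forward quotients are used, whose gradients converge pointwise and boundedly.\<close>

locale antiderivative_last = antiderivative k 1 K G \<Phi>
  for k K and G :: "'a::euclidean_space measure \<Rightarrow> 'a list \<Rightarrow> real" and \<Phi>
begin

lemma step1: "b \<in> Basis \<Longrightarrow> lin_fun_deriv_step k (\<Phi> b y 0) (\<Phi> b y 1)"
  using step_first by simp

lemma bound1: "b \<in> Basis \<Longrightarrow> m \<in> P2 \<Longrightarrow> length ws = Suc k \<Longrightarrow> \<bar>\<Phi> b y 1 m ws\<bar> \<le> K * norm_prod ws"
  using bound by simp

definition quotient :: "'a measure \<Rightarrow> 'a measure \<Rightarrow> 'a list \<Rightarrow> real \<Rightarrow> real \<Rightarrow> 'a \<Rightarrow> real" where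
  "quotient m m' zs h e y = (G (mixture (h + e) m m') (y # zs) - G (mixture h m m') (y # zs)) / e"

lemma gradient_quotient:
  assumes "m \<in> P2" "m' \<in> P2" "length zs = k" "0 \<le> h" "0 < e" "h + e \<le> 1"
  shows "has_gradient (quotient m m' zs h e)
    (\<lambda>b. (\<Phi> b y 0 (mixture (h + e) m m') zs - \<Phi> b y 0 (mixture h m m') zs) / e) y"
  unfolding quotient_def using assms
  by (intro has_gradient_divide has_gradient_diff gradient_G mixture_in_P2) auto

lemma quotient_0:
  assumes "m \<in> P2" "m' \<in> P2" "length zs = k" "0 \<le> h" "0 < e" "h + e \<le> 1"
  shows "quotient m m' zs h e 0 = 0"
  unfolding quotient_def using assms by (auto simp: G_0 mixture_in_P2)

lemma quotient_lipschitz: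
  assumes "m \<in> P2" "m' \<in> P2" "length zs = k" "0 \<le> h" "0 < e" "h + e \<le> 1"
  shows "\<bar>quotient m m' zs h e y - quotient m m' zs h e x\<bar>
    \<le> DIM('a) * (K * norm_prod zs * (first_moment m' + first_moment m)) * norm (y - x)"
  by (rule has_gradient_bound[OF gradient_quotient[OF assms] segment_quotient_bound[OF step1 bound1 assms]])

text \<open>The Henstock-Kurzweil integral is used because a gradient is integrable along segments
  without any measurability assumption.\<close>

lemma quotient_tendsto:
  assumes m: "m \<in> P2" "m' \<in> P2" "length zs = k"
    and h: "0 \<le> h" and e: "\<And>j. 0 < e j" "\<And>j. h + e j \<le> 1" "e \<longlonglongrightarrow> 0"
  shows "(\<lambda>\<tau>. \<Sum>b\<in>Basis. (y \<bullet> b) * slope (\<Phi> b (\<tau> *\<^sub>R y) 1) zs m m' h) integrable_on {0..1}"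
    "(\<lambda>j. quotient m m' zs h (e j) y) \<longlonglongrightarrow> integral {0..1} (\<lambda>\<tau>. \<Sum>b\<in>Basis. (y \<bullet> b) * slope (\<Phi> b (\<tau> *\<^sub>R y) 1) zs m m' h)"
proof -
  define q where "q j \<tau> = (\<Sum>b\<in>Basis. (y \<bullet> b) * ((\<Phi> b (\<tau> *\<^sub>R y) 0 (mixture (h + e j) m m') zs
    - \<Phi> b (\<tau> *\<^sub>R y) 0 (mixture h m m') zs) / e j))" for j and \<tau> :: real
  have int: "(q j has_integral quotient m m' zs h (e j) y) {0..1}" for j
  proof -
    have g: "has_gradient (quotient m m' zs h (e j))
      (\<lambda>b. (\<Phi> b x 0 (mixture (h + e j) m m') zs - \<Phi> b x 0 (mixture h m m') zs) / e j) x" for x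
      by (rule gradient_quotient[OF m h e(1,2)])
    show ?thesis
      using has_gradient_line_integral[OF g, of y] quotient_0[OF m h e(1)[of j] e(2)[of j]]
      unfolding q_def[abs_def] by simp
  qed
  let ?B = "DIM('a) * (K * norm_prod zs * (first_moment m' + first_moment m)) * norm y"
  have 1: "q j integrable_on {0..1}" for j using int by blast
  have 2: "(\<lambda>_::real. ?B) integrable_on {0..1}" by (rule integrable_const_ivl)
  have 3: "norm (q j \<tau>) \<le> ?B" for j \<tau>
    unfolding q_def real_norm_def
    by (rule gradient_component_le) (rule segment_quotient_bound[OF step1 bound1 m h e(1,2)])
  have 4: "(\<lambda>j. q j \<tau>) \<longlonglongrightarrow> (\<Sum>b\<in>Basis. (y \<bullet> b) * slope (\<Phi> b (\<tau> *\<^sub>R y) 1) zs m m' h)" for \<tau>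
    unfolding q_def by (intro tendsto_sum tendsto_mult_left segment_quotient_tendsto[OF step1 m h e])
  note dc = dominated_convergence[of q "{0..1}", OF 1 2 3 4]
  show "(\<lambda>\<tau>. \<Sum>b\<in>Basis. (y \<bullet> b) * slope (\<Phi> b (\<tau> *\<^sub>R y) 1) zs m m' h) integrable_on {0..1}"
    by (rule dc(1))
  show "(\<lambda>j. quotient m m' zs h (e j) y) \<longlonglongrightarrow> integral {0..1} (\<lambda>\<tau>. \<Sum>b\<in>Basis. (y \<bullet> b) * slope (\<Phi> b (\<tau> *\<^sub>R y) 1) zs m m' h)"
    using dc(2) by (simp add: integral_unique[OF int])
qed

text \<open>The line integral, along the segment from 0 to the first point, of the field with
  components \<open>\<Phi> b _ 1 m (tl ws)\<close>. It is not claimed that the result has this field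
  as gradient, so regularity in the first point has to come from difference quotients.\<close>

definition G' :: "'a measure \<Rightarrow> 'a list \<Rightarrow> real" where
  "G' m ws = integral {0..1} (\<lambda>\<tau>. \<Sum>b\<in>Basis. (hd ws \<bullet> b) * \<Phi> b (\<tau> *\<^sub>R hd ws) 1 m (tl ws))"

lemma G'_eq: "G' m (y # vs) = integral {0..1} (\<lambda>\<tau>. \<Sum>b\<in>Basis. (y \<bullet> b) * \<Phi> b (\<tau> *\<^sub>R y) 1 m vs)"
  by (simp add: G'_def)

lemma slope_return_diff:
  assumes "b \<in> Basis" "m \<in> P2" "length zs = k"
  shows "slope (\<Phi> b y 1) zs m (return borel z) 0 - slope (\<Phi> b y 1) zs m (return borel 0) 0 = \<Phi> b y 1 m (zs @ [z])"
proof -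
  note S = lin_fun_deriv_stepD[OF step1[OF assms(1)]]
  show ?thesis using S(3)[OF assms(2,3)] unfolding slope_return_0[OF S(1) assms(2,3)] by simp
qed

text \<open>Subtracting the quotients towards the Dirac masses at \<open>z\<close> and at 0 removes
  the integral against \<open>m\<close>. This exhibits \<open>G'\<close> as a limit of difference
  quotients of \<open>G\<close>.\<close>

lemma G'_limit:
  assumes m: "m \<in> P2" "length zs = k"
  shows "(\<lambda>\<tau>. \<Sum>b\<in>Basis. (y \<bullet> b) * \<Phi> b (\<tau> *\<^sub>R y) 1 m (zs @ [z])) integrable_on {0..1}"
    "(\<lambda>j. quotient m (return borel z) zs 0 (step_size j) y - quotient m (return borel 0) zs 0 (step_size j) y)
      \<longlonglongrightarrow> G' m (y # zs @ [z])"
proof -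
  have "0 + step_size j \<le> 1" for j using step_size(2)[of j] by simp
  note q = quotient_tendsto[OF m(1) return_in_P2 m(2) order_refl step_size(1) this step_size(3)]
  have eq: "(\<lambda>\<tau>. \<Sum>b\<in>Basis. (y \<bullet> b) * \<Phi> b (\<tau> *\<^sub>R y) 1 m (zs @ [z])) =
    (\<lambda>\<tau>. (\<Sum>b\<in>Basis. (y \<bullet> b) * slope (\<Phi> b (\<tau> *\<^sub>R y) 1) zs m (return borel z) 0)
      - (\<Sum>b\<in>Basis. (y \<bullet> b) * slope (\<Phi> b (\<tau> *\<^sub>R y) 1) zs m (return borel 0) 0))"
    unfolding sum_subtractf[symmetric] right_diff_distrib[symmetric]
    by (intro ext sum.cong refl) (simp only: slope_return_diff[OF _ m])
  show "(\<lambda>\<tau>. \<Sum>b\<in>Basis. (y \<bullet> b) * \<Phi> b (\<tau> *\<^sub>R y) 1 m (zs @ [z])) integrable_on {0..1}"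
    unfolding eq by (intro integrable_diff q(1))
  show "(\<lambda>j. quotient m (return borel z) zs 0 (step_size j) y - quotient m (return borel 0) zs 0 (step_size j) y)
      \<longlonglongrightarrow> G' m (y # zs @ [z])"
    unfolding G'_eq eq by (subst Henstock_Kurzweil_Integration.integral_diff[OF q(1) q(1)]) (intro tendsto_diff q(2))
qed

lemma G'_integrable:
  assumes "m \<in> P2" "length vs = Suc k"
  shows "(\<lambda>\<tau>. \<Sum>b\<in>Basis. (y \<bullet> b) * \<Phi> b (\<tau> *\<^sub>R y) 1 m vs) integrable_on {0..1}"
proof -
  obtain zs z where "vs = zs @ [z]" "length zs = k" using assms(2) by (metis length_Suc_conv_rev)
  then show ?thesis using G'_limit(1)[OF assms(1)] by simp
qed

lemma integrand_bound:
  assumes "m \<in> P2" "length vs = Suc k"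
  shows "\<bar>\<Sum>b\<in>Basis. (y \<bullet> b) * \<Phi> b x 1 m vs\<bar> \<le> DIM('a) * (K * norm_prod vs) * norm y"
  by (rule gradient_component_le) (rule bound1[OF _ assms])

lemma G'_bound:
  assumes "m \<in> P2" "length ws = Suc (Suc k)"
  shows "\<bar>G' m ws\<bar> \<le> DIM('a) * K * norm_prod ws"
proof -
  obtain y vs where ws: "ws = y # vs" "length vs = Suc k" using assms(2) by (cases ws) auto
  have "norm (integral {0..1} (\<lambda>\<tau>. \<Sum>b\<in>Basis. (y \<bullet> b) * \<Phi> b (\<tau> *\<^sub>R y) 1 m vs))
      \<le> integral {0..1::real} (\<lambda>_. DIM('a) * (K * norm_prod vs) * norm y)"
    using integrand_bound[OF assms(1) ws(2)]
    by (intro integral_norm_bound_integral G'_integrable[OF assms(1) ws(2)] integrable_const_ivl) auto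
  then show ?thesis by (simp add: ws(1) G'_eq mult_ac)
qed

text \<open>Inherited from the difference quotients, whose Lipschitz constants do not depend on the
  step. The quotient towards \<open>z\<close> contributes |z| and one first moment of
  \<open>m\<close>, the one towards 0 another first moment.\<close>

lemma G'_lipschitz:
  assumes m: "m \<in> P2" "length zs = k"
  shows "\<bar>G' m (y # zs @ [z]) - G' m (x # zs @ [z])\<bar>
    \<le> DIM('a) * (K * norm_prod zs * (norm z + 2 * first_moment m)) * norm (y - x)"
proof (rule LIMSEQ_le_const2)
  let ?q = "\<lambda>z j y. quotient m (return borel z) zs 0 (step_size j) y"
  show "(\<lambda>j. \<bar>(?q z j y - ?q 0 j y) - (?q z j x - ?q 0 j x)\<bar>) \<longlonglongrightarrow> \<bar>G' m (y # zs @ [z]) - G' m (x # zs @ [z])\<bar>"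
    by (intro tendsto_rabs tendsto_diff[of "\<lambda>j. ?q z j y - ?q 0 j y"] G'_limit m)
  have "\<bar>(?q z j y - ?q 0 j y) - (?q z j x - ?q 0 j x)\<bar>
      \<le> DIM('a) * (K * norm_prod zs * (norm z + 2 * first_moment m)) * norm (y - x)" for j
  proof -
    have "\<bar>?q z j y - ?q z j x\<bar> \<le> DIM('a) * (K * norm_prod zs * (norm z + first_moment m)) * norm (y - x)" for z
      using quotient_lipschitz[OF m(1) return_in_P2 m(2) order_refl step_size(1), of j z y x] step_size(2)[of j] by simp
    from this[of z] this[of 0] have "\<bar>(?q z j y - ?q 0 j y) - (?q z j x - ?q 0 j x)\<bar>
      \<le> DIM('a) * (K * norm_prod zs * (norm z + first_moment m)) * norm (y - x)
        + DIM('a) * (K * norm_prod zs * (norm (0::'a) + first_moment m)) * norm (y - x)" by linarith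
    then show ?thesis by (simp add: algebra_simps)
  qed
  then show "\<exists>N. \<forall>j\<ge>N. \<bar>(?q z j y - ?q 0 j y) - (?q z j x - ?q 0 j x)\<bar>
      \<le> DIM('a) * (K * norm_prod zs * (norm z + 2 * first_moment m)) * norm (y - x)" by blast
qed

text \<open>With the first point frozen at its limit, the path of integration is fixed and dominated
  convergence applies; the Lipschitz estimate then moves the first point.\<close>

lemma continuous_G': "continuous_P2 (Suc (Suc k)) G'"
proof (rule continuous_P2I)
  fix M :: "nat \<Rightarrow> 'a measure" and m and Y :: "nat \<Rightarrow> 'a list" and ws
  assume M: "converges_P2 M m" and Y: "\<And>j. length (Y j) = Suc (Suc k)" "length ws = Suc (Suc k)"
    and lim: "\<And>i. i < Suc (Suc k) \<Longrightarrow> (\<lambda>j. Y j ! i) \<longlonglongrightarrow> ws ! i"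
  define y Z z where "y j = hd (Y j)" and "Z j = butlast (tl (Y j))" and "z j = last (Y j)" for j
  have Yj: "Y j = y j # Z j @ [z j]" "length (Z j) = k" for j
    unfolding y_def Z_def z_def by (rule list_decompose_hd[OF Y(1)])+
  obtain y0 Z0 z0 where ws: "ws = y0 # Z0 @ [z0]" "length Z0 = k" using list_decompose[OF Y(2)] by blast
  have yl: "y \<longlonglongrightarrow> y0" using lim[of 0] by (simp add: Yj ws)
  have Zl: "(\<lambda>j. Z j ! i) \<longlonglongrightarrow> Z0 ! i" if "i < k" for i
    using lim[of "Suc i"] that by (simp add: Yj ws nth_append)
  have zl: "z \<longlonglongrightarrow> z0" using lim[of "Suc k"] by (simp add: Yj ws nth_append)
  have vl: "(\<lambda>j. (Z j @ [z j]) ! i) \<longlonglongrightarrow> (Z0 @ [z0]) ! i" if "i < Suc k" for i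
    using lim[of "Suc i"] that by (simp add: Yj ws)
  have MP: "M j \<in> P2" "m \<in> P2" for j using M by (auto simp: converges_P2_def)
  obtain R where R: "\<And>j. second_moment (M j) \<le> R" "second_moment m \<le> R"
    using converges_P2_bounded[OF M] by blast
  have "(\<lambda>j. G' (M j) (y0 # Z j @ [z j])) \<longlonglongrightarrow> G' m (y0 # Z0 @ [z0])"
  proof -
    have nl: "(\<lambda>j. norm_prod (Z j @ [z j])) \<longlonglongrightarrow> norm_prod (Z0 @ [z0])"
      by (rule tendsto_norm_prod[OF _ _ vl]) (simp_all add: Yj ws)
    obtain B where B: "\<And>j. norm_prod (Z j @ [z j]) \<le> B"
      by (rule tendsto_bounded_above[OF nl]) (rule that)
    show ?thesis
      unfolding G'_eq
    proof (rule dominated_convergence(2))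
      show "(\<lambda>\<tau>. \<Sum>b\<in>Basis. (y0 \<bullet> b) * \<Phi> b (\<tau> *\<^sub>R y0) 1 (M j) (Z j @ [z j])) integrable_on {0..1}" for j
        by (rule G'_integrable[OF MP(1)]) (simp add: Yj)
      show "(\<lambda>_. DIM('a) * (K * B) * norm y0) integrable_on {0..1::real}" by (rule integrable_const_ivl)
      fix \<tau> :: real
      show "norm (\<Sum>b\<in>Basis. (y0 \<bullet> b) * \<Phi> b (\<tau> *\<^sub>R y0) 1 (M j) (Z j @ [z j])) \<le> DIM('a) * (K * B) * norm y0" for j
      proof -
        have "\<bar>\<Sum>b\<in>Basis. (y0 \<bullet> b) * \<Phi> b (\<tau> *\<^sub>R y0) 1 (M j) (Z j @ [z j])\<bar>
            \<le> DIM('a) * (K * norm_prod (Z j @ [z j])) * norm y0"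
          by (rule integrand_bound[OF MP(1)]) (simp add: Yj)
        also have "\<dots> \<le> DIM('a) * (K * B) * norm y0"
          by (intro mult_right_mono mult_left_mono B K) auto
        finally show ?thesis by simp
      qed
      show "(\<lambda>j. \<Sum>b\<in>Basis. (y0 \<bullet> b) * \<Phi> b (\<tau> *\<^sub>R y0) 1 (M j) (Z j @ [z j]))
          \<longlonglongrightarrow> (\<Sum>b\<in>Basis. (y0 \<bullet> b) * \<Phi> b (\<tau> *\<^sub>R y0) 1 m (Z0 @ [z0]))"
      proof (intro tendsto_sum tendsto_mult_left)
        fix b :: 'a assume "b \<in> Basis"
        from continuous_P2D[OF lin_fun_deriv_stepD(1)[OF step1[OF this]] M _ _ vl]
        show "(\<lambda>j. \<Phi> b (\<tau> *\<^sub>R y0) 1 (M j) (Z j @ [z j])) \<longlonglongrightarrow> \<Phi> b (\<tau> *\<^sub>R y0) 1 m (Z0 @ [z0])"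
          by (simp add: Yj ws)
      qed
    qed
  qed
  moreover have "(\<lambda>j. G' (M j) (y j # Z j @ [z j]) - G' (M j) (y0 # Z j @ [z j])) \<longlonglongrightarrow> 0"
  proof (rule Lim_null_comparison)
    have "(\<lambda>j. DIM('a) * (K * norm_prod (Z j) * (norm (z j) + 2 * (1 + R))) * norm (y j - y0))
      \<longlonglongrightarrow> DIM('a) * (K * norm_prod Z0 * (norm z0 + 2 * (1 + R))) * norm (y0 - y0)"
      by (intro tendsto_intros tendsto_norm_prod[OF Yj(2) ws(2) Zl] zl yl)
    then show "(\<lambda>j. DIM('a) * (K * norm_prod (Z j) * (norm (z j) + 2 * (1 + R))) * norm (y j - y0)) \<longlonglongrightarrow> 0"
      by simp
    show "\<forall>\<^sub>F j in sequentially. norm (G' (M j) (y j # Z j @ [z j]) - G' (M j) (y0 # Z j @ [z j]))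
        \<le> DIM('a) * (K * norm_prod (Z j) * (norm (z j) + 2 * (1 + R))) * norm (y j - y0)"
    proof (intro always_eventually allI)
      fix j
      have "first_moment (M j) \<le> 1 + R" using first_moment_le[OF MP(1)[of j]] R(1)[of j] by linarith
      then have "DIM('a) * (K * norm_prod (Z j) * (norm (z j) + 2 * first_moment (M j))) * norm (y j - y0)
        \<le> DIM('a) * (K * norm_prod (Z j) * (norm (z j) + 2 * (1 + R))) * norm (y j - y0)"
        using K norm_prod_nonneg[of "Z j"] by (intro mult_right_mono mult_left_mono) auto
      from order_trans[OF G'_lipschitz[OF MP(1)[of j] Yj(2)[of j], of "y j" "z j" y0] this]
      show "norm (G' (M j) (y j # Z j @ [z j]) - G' (M j) (y0 # Z j @ [z j]))
        \<le> DIM('a) * (K * norm_prod (Z j) * (norm (z j) + 2 * (1 + R))) * norm (y j - y0)"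
        by simp
    qed
  qed
  ultimately have "(\<lambda>j. G' (M j) (y0 # Z j @ [z j]) + (G' (M j) (y j # Z j @ [z j]) - G' (M j) (y0 # Z j @ [z j])))
      \<longlonglongrightarrow> G' m (y0 # Z0 @ [z0]) + 0" by (rule tendsto_add)
  then show "(\<lambda>j. G' (M j) (Y j)) \<longlonglongrightarrow> G' m ws" by (simp add: Yj(1) ws(1))
qed

lemma growth_G': "quadratic_growth_P2 (Suc (Suc k)) G'"
proof (rule quadratic_growth_P2I, intro exI ballI impI allI)
  fix m :: "'a measure" and ws :: "'a list" assume "m \<in> P2" "length ws = Suc (Suc k)"
  from G'_bound[OF this] have "\<bar>G' m ws\<bar> \<le> DIM('a) * K * norm_prod ws" .
  also have "\<dots> \<le> DIM('a) * K * growth ws"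
    using K by (intro mult_left_mono norm_prod_le_growth) auto
  finally show "\<bar>G' m ws\<bar> \<le> DIM('a) * K * growth ws" .
qed

lemma step_G': "lin_fun_deriv_step (Suc k) G G'"
proof (rule lin_fun_deriv_stepI[OF continuous_G continuous_G' growth_G'])
  fix m :: "'a measure" and ys :: "'a list" assume m: "m \<in> P2" "length ys = Suc k"
  \<comment> \<open>\<open>norm_prod\<close> contains the factor |0|, so the bound includes the
    normalisation.\<close>
  have "\<bar>G' m (ys @ [0])\<bar> \<le> DIM('a) * K * norm_prod (ys @ [0])" using m by (intro G'_bound) auto
  then show "G' m (ys @ [0]) = 0" by simp
next
  fix A and m m' :: "'a measure" and ys :: "'a list"
  assume sup: "supported_on A m" "supported_on A m'" and l: "length ys = Suc k"
  then obtain y zs where ys: "ys = y # zs" "length zs = k" by (cases ys) auto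
  have mP: "m \<in> P2" "m' \<in> P2" using sup by (auto simp: supported_on_def)
  define f where "f h = G (mixture h m m') ys" for h
  \<comment> \<open>With nodes 0 and 1 these weights give the forward quotient.\<close>
  define c where "c i = (if i = 0 then -1 else 1 :: real)" for i :: nat
  have quot: "(\<Sum>i<2. c i * f (h + real i * e)) / e = quotient m m' zs h e y" for h e
    unfolding numeral_2_eq_2 sum.lessThan_Suc by (simp add: c_def f_def quotient_def ys)
  have \<gamma>: "continuous_on {0..1} (slope G' ys m m')"
    by (rule slope_continuous[OF continuous_G' growth_G' mP l])
  let ?w = "\<lambda>a. measure m' {a} - measure m {a}"
  \<comment> \<open>On a finite support the sum over \<open>A\<close> and the line integral commute,
    which identifies the slope of \<open>G'\<close> with the limit in
    \<open>quotient_tendsto\<close>.\<close>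
  have sl: "slope G' ys m m' h = integral {0..1} (\<lambda>\<tau>. \<Sum>b\<in>Basis. (y \<bullet> b) * slope (\<Phi> b (\<tau> *\<^sub>R y) 1) zs m m' h)"
    if h: "h \<in> {0..1}" for h
  proof -
    have mh: "mixture h m m' \<in> P2" using h mP by auto
    have S: "slope (\<Phi> b x 1) zs m m' h = (\<Sum>a\<in>A. ?w a * \<Phi> b x 1 (mixture h m m') (zs @ [a]))" if "b \<in> Basis" for b x
      by (rule slope_supported_on[OF sup lin_fun_deriv_stepD(1)[OF step1[OF that]] ys(2) h])
    have "slope G' ys m m' h = (\<Sum>a\<in>A. ?w a * G' (mixture h m m') (ys @ [a]))"
      by (rule slope_supported_on[OF sup continuous_G' l h])
    also have "\<dots> = (\<Sum>a\<in>A. integral {0..1} (\<lambda>\<tau>. ?w a * (\<Sum>b\<in>Basis. (y \<bullet> b) * \<Phi> b (\<tau> *\<^sub>R y) 1 (mixture h m m') (zs @ [a]))))"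
      by (simp add: ys(1) G'_eq)
    also have "\<dots> = integral {0..1} (\<lambda>\<tau>. \<Sum>a\<in>A. ?w a * (\<Sum>b\<in>Basis. (y \<bullet> b) * \<Phi> b (\<tau> *\<^sub>R y) 1 (mixture h m m') (zs @ [a])))"
      using sup ys(2)
      by (intro Henstock_Kurzweil_Integration.integral_sum[symmetric] integrable_on_mult_right G'_integrable[OF mh]) (auto simp: supported_on_def)
    also have "(\<lambda>\<tau>. \<Sum>a\<in>A. ?w a * (\<Sum>b\<in>Basis. (y \<bullet> b) * \<Phi> b (\<tau> *\<^sub>R y) 1 (mixture h m m') (zs @ [a])))
        = (\<lambda>\<tau>. \<Sum>b\<in>Basis. (y \<bullet> b) * slope (\<Phi> b (\<tau> *\<^sub>R y) 1) zs m m' h)"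
    proof
      fix \<tau> :: real
      have "(\<Sum>a\<in>A. ?w a * (\<Sum>b\<in>Basis. (y \<bullet> b) * \<Phi> b (\<tau> *\<^sub>R y) 1 (mixture h m m') (zs @ [a])))
          = (\<Sum>b\<in>Basis. \<Sum>a\<in>A. (y \<bullet> b) * (?w a * \<Phi> b (\<tau> *\<^sub>R y) 1 (mixture h m m') (zs @ [a])))"
        unfolding sum_distrib_left by (subst sum.swap) (simp only: mult.left_commute)
      also have "\<dots> = (\<Sum>b\<in>Basis. (y \<bullet> b) * slope (\<Phi> b (\<tau> *\<^sub>R y) 1) zs m m' h)"
        by (intro sum.cong refl) (simp only: S sum_distrib_left)
      finally show "(\<Sum>a\<in>A. ?w a * (\<Sum>b\<in>Basis. (y \<bullet> b) * \<Phi> b (\<tau> *\<^sub>R y) 1 (mixture h m m') (zs @ [a])))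
          = (\<Sum>b\<in>Basis. (y \<bullet> b) * slope (\<Phi> b (\<tau> *\<^sub>R y) 1) zs m m' h)" .
    qed
    finally show ?thesis .
  qed
  have "f 1 - f 0 = integral {0..1} (slope G' ys m m')"
  proof (rule numeric_differentiation_integral[OF _ \<gamma>, where N = 2 and c = c and t = real])
    show "continuous_on {0..1} f"
      unfolding continuous_on_sequentially o_def f_def using l
      by (intro allI ballI impI continuous_P2D[OF continuous_G] converges_P2_mixture_path mP) auto
    show "(\<Sum>i<2. c i) = 0" "(\<Sum>i<2. c i * real i) = 1"
      unfolding numeral_2_eq_2 sum.lessThan_Suc by (simp_all add: c_def)
    show "\<bar>(\<Sum>i<2. c i * f (h + real i * e)) / e\<bar>
        \<le> DIM('a) * (K * norm_prod zs * (first_moment m' + first_moment m)) * norm y"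
      if h: "0 \<le> h" "0 < e" "h + e \<le> 1" for h e
      using quotient_lipschitz[OF mP ys(2) h, of y 0] quotient_0[OF mP ys(2) h] unfolding quot by simp
    show "(\<lambda>j. (\<Sum>i<2. c i * f (h + real i * e j)) / e j) \<longlonglongrightarrow> slope G' ys m m' h"
      if h: "0 \<le> h" and e: "\<And>j. 0 < e j" "\<And>j. h + e j \<le> 1" "e \<longlonglongrightarrow> 0" for h and e :: "nat \<Rightarrow> real"
    proof -
      have hh: "h \<in> {0..1}" using h e(1,2)[of 0] by auto
      show ?thesis unfolding quot sl[OF hh] by (rule quotient_tendsto(2)[OF mP ys(2) h e])
    qed
  qed auto
  then show "G m' ys - G m ys = integral {0..1} (slope G' ys m m')"
    unfolding f_def using P2D(2)[OF mP(1)] P2D(2)[OF mP(2)] by simp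
qed

end

section \<open>Existence of the linear functional derivatives\<close>

text \<open>Each smooth step trades a missing order for a gained one with the same \<open>K\<close>;
  the bound on the top derivative, and its factor, come from the last step alone.\<close>

lemma antiderivative_chain:
  fixes G :: "'a::euclidean_space measure \<Rightarrow> 'a list \<Rightarrow> real" and K :: real
  assumes "n \<ge> 1" "antiderivative k n K G \<Phi>"
  shows "\<exists>\<Psi>. \<Psi> 0 = G \<and> (\<forall>j<n. lin_fun_deriv_step (Suc k + j) (\<Psi> j) (\<Psi> (Suc j))) \<and>
    (\<forall>m\<in>P2. \<forall>ws. length ws = Suc k + n \<longrightarrow> \<bar>\<Psi> n m ws\<bar> \<le> DIM('a) * K * norm_prod ws)"
  using assms
proof (induction n arbitrary: k G \<Phi> rule: nat_induct_at_least)
  case base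
  then interpret antiderivative_last k K G \<Phi> by (simp add: antiderivative_last_def)
  show ?case
    by (rule exI[of _ "case_nat G (\<lambda>_. G')"]) (auto simp: step_G' G'_bound)
next
  case (Suc n)
  have "2 \<le> Suc n" using Suc.hyps by simp
  from numeric_differentiation_rule[OF this]
  obtain N :: nat and c t :: "nat \<Rightarrow> real" where r: "(\<forall>i<N. 0 \<le> t i \<and> t i \<le> 1) \<and>
    (\<forall>j<Suc n. (\<Sum>i<N. c i * t i ^ j) = (if j = 1 then 1 else 0))"
    by (elim exE) (rule that)
  interpret antiderivative_smooth k "Suc n" K G \<Phi> N c t
    using Suc.prems Suc.hyps r by (simp add: antiderivative_smooth_def antiderivative_smooth_axioms_def)
  have "antiderivative (Suc k) n K G' (\<lambda>b y j. \<Phi> b y (Suc j))" using antiderivative_G' by simp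
  from Suc.IH[OF this] obtain \<Psi> where \<Psi>: "\<Psi> 0 = G'"
    "\<And>j. j < n \<Longrightarrow> lin_fun_deriv_step (Suc (Suc k) + j) (\<Psi> j) (\<Psi> (Suc j))"
    "\<And>m ws. m \<in> P2 \<Longrightarrow> length ws = Suc (Suc k) + n \<Longrightarrow> \<bar>\<Psi> n m ws\<bar> \<le> DIM('a) * K * norm_prod ws"
    by blast
  show ?case
  proof (intro exI[of _ "case_nat G \<Psi>"] conjI allI impI ballI)
    show "lin_fun_deriv_step (Suc k + j) (case_nat G \<Psi> j) (case_nat G \<Psi> (Suc j))" if "j < Suc n" for j
      using that step_G' \<Psi>(1) \<Psi>(2)[of "j - 1"] by (cases j) auto
    show "\<bar>case_nat G \<Psi> (Suc n) m ws\<bar> \<le> DIM('a) * K * norm_prod ws"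
      if "m \<in> P2" "length ws = Suc k + Suc n" for m ws
      using \<Psi>(3)[of m ws] that by simp
  qed simp
qed

text \<open>The recursion of \<^const>\<open>iterated_L_deriv\<close> removes the last differentiation; here the first
  one is split off.\<close>

lemma iterated_L_deriv_first:
  fixes U :: "'a::euclidean_space measure \<Rightarrow> real"
  assumes "iterated_L_deriv (Suc p) U D"
  shows "\<exists>E. has_L_deriv U E \<and>
    (\<forall>b\<in>Basis. \<forall>y. iterated_L_deriv p (\<lambda>m. E m y \<bullet> b) (\<lambda>bs m ys. D (b # bs) m (y # ys)))"
  using assms
proof (induction p arbitrary: D)
  case 0
  then obtain G E where G: "\<forall>m\<in>P2. G [] m [] = U m" and E: "has_L_deriv (\<lambda>m. G [] m []) E"
    "\<forall>b\<in>Basis. \<forall>m\<in>P2. \<forall>y. D [b] m [y] = E m y \<bullet> b"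
    by (auto simp: tensor_index_def)
  have "has_L_deriv U E" using E(1) G by (auto simp: has_L_deriv_def)
  then show ?case using E(2) by auto
next
  case (Suc p)
  from Suc.prems obtain G where G: "iterated_L_deriv (Suc p) U G"
    and D: "\<And>bs ys. bs \<in> tensor_index (Suc p) \<Longrightarrow> length ys = Suc p \<Longrightarrow>
      \<exists>E. has_L_deriv (\<lambda>m. G bs m ys) E \<and> (\<forall>b\<in>Basis. \<forall>m\<in>P2. \<forall>y. D (bs @ [b]) m (ys @ [y]) = E m y \<bullet> b)"
    unfolding iterated_L_deriv.simps(2)[of "Suc p"] by blast
  from Suc.IH[OF G] obtain E where E: "has_L_deriv U E"
    "\<And>b y. b \<in> Basis \<Longrightarrow> iterated_L_deriv p (\<lambda>m. E m y \<bullet> b) (\<lambda>bs m ys. G (b # bs) m (y # ys))" by blast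
  have "iterated_L_deriv (Suc p) (\<lambda>m. E m y \<bullet> b) (\<lambda>bs m ys. D (b # bs) m (y # ys))" if b: "b \<in> Basis" for b y
    unfolding iterated_L_deriv.simps(2)
  proof (intro exI[of _ "\<lambda>bs m ys. G (b # bs) m (y # ys)"] conjI ballI allI impI)
    fix bs ys :: "'a list" assume "bs \<in> tensor_index p" "length ys = p"
    then show "\<exists>E'. has_L_deriv (\<lambda>m. G (b # bs) m (y # ys)) E' \<and>
        (\<forall>b'\<in>Basis. \<forall>m\<in>P2. \<forall>y'. D (b # bs @ [b']) m (y # ys @ [y']) = E' m y' \<bullet> b')"
      using D[of "b # bs" "y # ys"] b by (simp add: tensor_index_def)
  qed (rule E(2)[OF b])
  then show ?case using E(1) by blast
qed

text \<open>Induction on \<open>p\<close> with \<open>U\<close> arbitrary: the hypothesis is applied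
  to each component of the first L-derivative at each fixed point, and
  \<open>antiderivative_chain\<close> integrates the resulting chains in that point. Each order
  multiplies the constant by the dimension.\<close>

lemma linear_functional_derivative_chain:
  fixes U :: "'a::euclidean_space measure \<Rightarrow> real" and B :: real
  assumes "iterated_L_deriv p U D" "B \<ge> 0"
    and "\<And>bs m ys. bs \<in> tensor_index p \<Longrightarrow> m \<in> P2 \<Longrightarrow> length ys = p \<Longrightarrow> \<bar>D bs m ys\<bar> \<le> B"
  shows "\<exists>\<Psi>. (\<forall>m\<in>P2. \<Psi> 0 m [] = U m) \<and> (\<forall>j<p. lin_fun_deriv_step j (\<Psi> j) (\<Psi> (Suc j))) \<and>
    (\<forall>m\<in>P2. \<forall>ws. length ws = p \<longrightarrow> \<bar>\<Psi> p m ws\<bar> \<le> DIM('a) ^ p * B * norm_prod ws)"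
  using assms(1,3)
proof (induction p arbitrary: U D)
  case 0
  then show ?case by (intro exI[of _ "\<lambda>_. D []"]) (auto simp: tensor_index_def)
next
  case (Suc p)
  obtain E where E: "has_L_deriv U E"
    "\<And>b y. b \<in> Basis \<Longrightarrow> iterated_L_deriv p (\<lambda>m. E m y \<bullet> b) (\<lambda>bs m ys. D (b # bs) m (y # ys))"
    using iterated_L_deriv_first[OF Suc.prems(1)] by blast
  obtain F1 where F1: "lin_fun_deriv 1 U F1" "\<And>m y. m \<in> P2 \<Longrightarrow> GDERIV (\<lambda>x. F1 m [x]) y :> E m y"
    using E(1) by (auto simp: has_L_deriv_def)
  obtain G0 where G0: "\<forall>m\<in>P2. G0 m [] = U m" "lin_fun_deriv_step 0 G0 F1"
    using F1(1) unfolding One_nat_def lin_fun_deriv.simps by blast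
  note S = lin_fun_deriv_stepD[OF G0(2)]
  define P where "P b y \<Psi> \<longleftrightarrow> (\<forall>m\<in>P2. \<Psi> 0 m [] = E m y \<bullet> b) \<and> (\<forall>j<p. lin_fun_deriv_step j (\<Psi> j) (\<Psi> (Suc j))) \<and>
    (\<forall>m\<in>P2. \<forall>ws. length ws = p \<longrightarrow> \<bar>\<Psi> p m ws\<bar> \<le> DIM('a) ^ p * B * norm_prod ws)" for b y \<Psi>
  have ex: "\<exists>\<Psi>. P b y \<Psi>" if b: "b \<in> Basis" for b y
    unfolding P_def
  proof (rule Suc.IH[OF E(2)[OF b]])
    show "\<bar>D (b # bs) m (y # ys)\<bar> \<le> B" if "bs \<in> tensor_index p" "m \<in> P2" "length ys = p" for bs m ys
      using that b by (intro Suc.prems(2)) (auto simp: tensor_index_def)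
  qed
  \<comment> \<open>The chain is chosen separately for each \<open>b\<close> and \<open>y\<close>;
    no regularity in \<open>y\<close> is asserted.\<close>
  define \<Phi> where "\<Phi> b y = (SOME \<Psi>. P b y \<Psi>)" for b y
  have P: "P b y (\<Phi> b y)" if "b \<in> Basis" for b y
    unfolding \<Phi>_def by (rule someI_ex[OF ex[OF that]])
  have P_0: "\<Phi> b y 0 m [] = E m y \<bullet> b" if "b \<in> Basis" "m \<in> P2" for b m y
    using P[OF that(1), of y] that(2) unfolding P_def by blast
  have P_step: "lin_fun_deriv_step j (\<Phi> b y j) (\<Phi> b y (Suc j))" if "b \<in> Basis" "j < p" for b y j
    using P[OF that(1), of y] that(2) unfolding P_def by blast
  have P_bound: "\<bar>\<Phi> b y p m ws\<bar> \<le> DIM('a) ^ p * B * norm_prod ws"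
    if "b \<in> Basis" "m \<in> P2" "length ws = p" for b m ws y
    using P[OF that(1), of y] that(2,3) unfolding P_def by blast
  have grad: "has_gradient (\<lambda>y. F1 m [y]) (\<lambda>b. \<Phi> b y 0 m []) y" if m: "m \<in> P2" for m y
  proof -
    have "((\<lambda>y. F1 m [y]) has_derivative (\<lambda>h. h \<bullet> E m y)) (at y)"
      using F1(2)[OF m] by (simp add: gderiv_def)
    moreover have "(\<lambda>h. h \<bullet> E m y) = (\<lambda>h. \<Sum>b\<in>Basis. (h \<bullet> b) * \<Phi> b y 0 m [])"
      unfolding euclidean_inner[of _ "E m y"] using m by (intro ext sum.cong refl) (simp add: P_0)
    ultimately show ?thesis by (simp add: has_gradient_def)
  qed
  have F1_0: "F1 m [0] = 0" if "m \<in> P2" for m using S(3)[OF that, of "[]"] by simp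
  show ?case
  proof (cases "p = 0")
    case True
    \<comment> \<open>Only the first derivative is present; it vanishes at 0 and its gradient is
      bounded.\<close>
    have "\<bar>F1 m [y]\<bar> \<le> DIM('a) * B * norm y" if m: "m \<in> P2" for m y
    proof -
      have "\<bar>F1 m [y] - F1 m [0]\<bar> \<le> DIM('a) * B * norm (y - 0)"
      proof (rule has_gradient_bound[OF grad[OF m]])
        fix b y :: 'a assume "b \<in> Basis"
        from P_bound[OF this m, of "[]" y] True show "\<bar>\<Phi> b y 0 m []\<bar> \<le> B" by simp
      qed
      then show ?thesis using F1_0[OF m] by simp
    qed
    then show ?thesis
      using G0 True by (intro exI[of _ "case_nat G0 (\<lambda>_. F1)"]) (auto simp: length_Suc_conv)
  next
    case False
    have "antiderivative 0 p (DIM('a) ^ p * B) F1 \<Phi>"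
    proof
      show "0 \<le> DIM('a) ^ p * B" using assms(2) by simp
      show "continuous_P2 (Suc 0) F1" "quadratic_growth_P2 (Suc 0) F1" by (fact S)+
      show "F1 m (0 # zs) = 0" if "m \<in> P2" "length zs = 0" for m zs using F1_0 that by simp
      show "has_gradient (\<lambda>y. F1 m (y # zs)) (\<lambda>b. \<Phi> b y 0 m zs) y" if "m \<in> P2" "length zs = 0" for m zs y
        using grad that by simp
      show "lin_fun_deriv_step (0 + j) (\<Phi> b y j) (\<Phi> b y (Suc j))" if "b \<in> Basis" "j < p" for b y j
        using P_step that by simp
      show "\<bar>\<Phi> b y p m ws\<bar> \<le> DIM('a) ^ p * B * norm_prod ws"
        if "b \<in> Basis" "m \<in> P2" "length ws = 0 + p" for b y m ws
        using P_bound that by simp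
    qed
    moreover have "1 \<le> p" using False by simp
    ultimately obtain \<Psi> where \<Psi>: "\<Psi> 0 = F1"
      "\<And>j. j < p \<Longrightarrow> lin_fun_deriv_step (Suc 0 + j) (\<Psi> j) (\<Psi> (Suc j))"
      "\<And>m ws. m \<in> P2 \<Longrightarrow> length ws = Suc 0 + p \<Longrightarrow> \<bar>\<Psi> p m ws\<bar> \<le> DIM('a) * (DIM('a) ^ p * B) * norm_prod ws"
      using antiderivative_chain[of p 0 "DIM('a) ^ p * B" F1 \<Phi>] by blast
    show ?thesis
    proof (intro exI[of _ "case_nat G0 \<Psi>"] conjI allI impI ballI)
      show "case_nat G0 \<Psi> 0 m [] = U m" if "m \<in> P2" for m using G0(1) that by simp
      show "lin_fun_deriv_step j (case_nat G0 \<Psi> j) (case_nat G0 \<Psi> (Suc j))" if "j < Suc p" for j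
        using that G0(2) \<Psi>(1) \<Psi>(2)[of "j - 1"] by (cases j) auto
      show "\<bar>case_nat G0 \<Psi> (Suc p) m ws\<bar> \<le> DIM('a) ^ Suc p * B * norm_prod ws"
        if "m \<in> P2" "length ws = Suc p" for m ws
        using \<Psi>(3)[of m ws] that by (simp add: mult.assoc)
    qed
  qed
qed

lemma norm_prod_le_power:
  "(\<And>y. y \<in> set ys \<Longrightarrow> norm y \<le> r) \<Longrightarrow> norm_prod ys \<le> r ^ length ys"
proof (induction ys)
  case (Cons y ys)
  have "norm y * norm_prod ys \<le> r * r ^ length ys"
    using Cons norm_prod_nonneg[of ys] order_trans[OF norm_ge_zero Cons.prems[of y]]
    by (intro mult_mono) auto
  then show ?case by simp
qed simp

text \<open>A product of \<open>p\<close> norms is at most the p-th power of the largest, and that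
  power is one of the summands.\<close>

lemma norm_prod_le_sum_powers:
  assumes "length ys = p" "p \<ge> 1"
  shows "norm_prod ys \<le> (\<Sum>y\<leftarrow>ys. norm y ^ p)"
proof -
  have "ys \<noteq> []" using assms by auto
  then have "Max (norm ` set ys) \<in> norm ` set ys" by (intro Max_in) auto
  then obtain x where x: "x \<in> set ys" "norm x = Max (norm ` set ys)" by auto
  have "norm_prod ys \<le> norm x ^ p"
    unfolding assms(1)[symmetric] x(2) by (rule norm_prod_le_power) auto
  also have "\<dots> \<le> (\<Sum>y\<leftarrow>ys. norm y ^ p)"
    using x(1) by (intro member_le_sum_list) auto
  finally show ?thesis .
qed

text \<open>Existence accompanies the bound, which would otherwise range over a possibly empty set
  of derivatives; the constant is chosen before \<open>F\<close>.\<close>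

theorem lemma2p5:
  fixes U :: "'a::euclidean_space measure \<Rightarrow> real"
    and D :: "'a list \<Rightarrow> 'a measure \<Rightarrow> 'a list \<Rightarrow> real"
    and p :: nat
  assumes "p \<ge> 1"
    and "iterated_L_deriv p U D"
    and "\<exists>B. \<forall>bs\<in>tensor_index p. \<forall>m\<in>P2. \<forall>ys. length ys = p \<longrightarrow> \<bar>D bs m ys\<bar> \<le> B"
  shows "(\<exists>F. lin_fun_deriv p U F) \<and>
    (\<exists>C>0. \<forall>F. lin_fun_deriv p U F \<longrightarrow>
       (\<forall>m\<in>P2. \<forall>ys. length ys = p \<longrightarrow> \<bar>F m ys\<bar> \<le> C * (\<Sum>y\<leftarrow>ys. norm y ^ p)))"
proof -
  obtain B0 where B0: "\<And>bs m ys. bs \<in> tensor_index p \<Longrightarrow> m \<in> P2 \<Longrightarrow> length ys = p \<Longrightarrow> \<bar>D bs m ys\<bar> \<le> B0"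
    using assms(3) by blast
  \<comment> \<open>The maximum with 1 makes the final constant positive.\<close>
  define B where "B = max B0 1"
  have B: "0 < B" "\<And>bs m ys. bs \<in> tensor_index p \<Longrightarrow> m \<in> P2 \<Longrightarrow> length ys = p \<Longrightarrow> \<bar>D bs m ys\<bar> \<le> B"
    using B0 by (auto simp: B_def le_max_iff_disj)
  obtain \<Psi> where \<Psi>: "\<forall>m\<in>P2. \<Psi> 0 m [] = U m" "\<And>j. j < p \<Longrightarrow> lin_fun_deriv_step j (\<Psi> j) (\<Psi> (Suc j))"
    "\<And>m ws. m \<in> P2 \<Longrightarrow> length ws = p \<Longrightarrow> \<bar>\<Psi> p m ws\<bar> \<le> DIM('a) ^ p * B * norm_prod ws"
    using linear_functional_derivative_chain[OF assms(2) less_imp_le[OF B(1)] B(2)] by blast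
  have "lin_fun_deriv j U (\<Psi> j)" if "j \<le> p" for j
    using that
  proof (induction j)
    case (Suc j)
    then show ?case using \<Psi>(2)[of j] by auto
  qed (use \<Psi>(1) in simp)
  then have ex: "lin_fun_deriv p U (\<Psi> p)" by simp
  have "\<bar>F m ys\<bar> \<le> DIM('a) ^ p * B * (\<Sum>y\<leftarrow>ys. norm y ^ p)"
    if F: "lin_fun_deriv p U F" and m: "m \<in> P2" "length ys = p" for F m ys
  proof -
    \<comment> \<open>Normalised derivatives agree on \<open>P2\<close>, so the bound for the
      constructed one passes to every \<open>F\<close>.\<close>
    have "\<bar>F m ys\<bar> \<le> DIM('a) ^ p * B * norm_prod ys"
      using \<Psi>(3)[OF m] lin_fun_deriv_unique[OF F ex m] by simp
    also have "\<dots> \<le> DIM('a) ^ p * B * (\<Sum>y\<leftarrow>ys. norm y ^ p)"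
      using B(1) by (intro mult_left_mono norm_prod_le_sum_powers m assms(1)) auto
    finally show ?thesis .
  qed
  moreover have "0 < DIM('a) ^ p * B" using B(1) by simp
  ultimately show ?thesis using ex by blast
qed

end
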